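(* For every $z\in\mathbb{C}^\times$ and every level $m\in\mathbb{Z}$, the half-vertex operators $e^{H_+(z)}$, $e^{H_-(z)}$ on the quantum Fock space $\mathfrak{F}_m$ equal the row transfer matrices of Delta ice and Gamma ice respectively: $$e^{H_+(z)}=T_\Delta(z),\qquad e^{H_-(z)}=T_\Gamma(z),$$ i.e. $\langle\eta|e^{H_+(z)}|\xi\rangle=\langle\eta|T_\Delta(z)|\xi\rangle$ and $\langle\eta|e^{H_-(z)}|\xi\rangle=\langle\eta|T_\Gamma(z)|\xi\rangle$ for all normal-ordered basis vectors $\xi,\eta$ of $\mathfrak{F}_m$.
   Context: Fix an integer $n\ge1$, a number $v\in\mathbb{C}^\times$ that is not a root of unity, and a function $g:\mathbb{Z}/n\mathbb{Z}\to\mathbb{C}$ with $g(0)=-v$ and $g(a)g(-a)=v$ for $a\not\equiv0$ mod $n$. Quantum Fock space. For $m\in\mathbb{Z}$, $\mathfrak{F}_m$ is the complex vector space spanned by semi-infinite wedges $u_{i_m}\wedge u_{i_{m-1}}\wedge\cdots$ ($i_k\in\mathbb{Z}$, $i_k=k$ for $k\ll0$) modulo the following relations, imposed in every pair of adjacent factors: for $l\equiv p$ mod $n$, $u_l\wedge u_p=-u_p\wedge u_l$; and for $p>l$, $p\not\equiv l$ mod $n$, with $0<i<n$, $i\equiv p-l$ mod $n$, $$u_l\wedge u_p=g(l-p)\,u_p\wedge u_l+(v-1)\sum_{t\ge0}v^t\big(u_{p-tn-i}\wedge u_{l+tn+i}+g(l-p)\,u_{p-(t+1)n}\wedge u_{l+(t+1)n}\big),$$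 where only those terms $u_a\wedge u_b$ on the right with $a>b$ are kept. The normal-ordered wedges ($i_m>i_{m-1}>\cdots$, $i_k=k$ for $k\ll0$) form a basis of $\mathfrak{F}_m$. For basis vectors, $\langle\eta|A|\xi\rangle$ denotes the coefficient of $\eta$ in $A\xi$. Heisenberg operators. For $k\in\mathbb{Z}\setminus\{0\}$, $J_k:\mathfrak{F}_m\to\mathfrak{F}_m$ is the (well-defined) operator sending $u_{i_m}\wedge u_{i_{m-1}}\wedge\cdots$ to $\sum_{j\le m}(\cdots\wedge u_{i_j-nk}\wedge\cdots)$, where in the $j$-th summand only the factor $u_{i_j}$ is replaced, by $u_{i_j-nk}$; all but finitely many summands vanish. Set $H_\pm(z)=\sum_{k\ge1}\frac1k(1-v^k)z^{\pm nk}J_{\pm k}$. All matrix coefficients $\langle\eta|e^{H_\pm(z)}|\xi\rangle$ are finite sums ($e^{H_-(z)}$ is not an operator on $\mathfrak{F}_m$ proper, but its matrix coefficients make sense; equivalently it acts on bras $\langle\eta|$). Ice. Consider one row of vertices, one in each column, the columns being labeled by all integers in decreasing order from left to right. Each vertex has a left, top, right and bottom edge, the right edge of a vertex being the left edge of the next. Vertical edges carry a spin $\pm$; horizontal edges carry a decorated spin $\pm^a$, $a\in\mathbb{Z}/n\mathbb{Z}$. For $\xi=u_{i_m}\wedge u_{i_{m-1}}\wedge\cdots$ and $\eta=u_{j_m}\wedge u_{j_{m-1}}\wedge\cdots$ normal ordered, the top edges are $-$ exactly in columns $i_m,i_{m-1},\dots$ and the bottom edges are $-$ exactly in columns $j_m,j_{m-1},\dots$.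 A state is an assignment of decorated spins to the horizontal edges such that all but finitely many are $+^0$ (Delta ice), resp. $-^0$ (Gamma ice); it is admissible if every vertex has one of the configurations (left, top, right, bottom) below, with the given weight. Delta ice: $(+^0,+,+^0,+)$: $1$; $(-^a,-,-^{a+1},-)$: $g(a)z$; $(+^0,-,+^0,-)$: $1$; $(-^a,+,-^{a+1},+)$: $z$; $(-^0,+,+^0,-)$: $(1-v)z$; $(+^0,-,-^1,+)$: $1$. Gamma ice: $(+^{a+1},+,+^a,+)$: $z^{-1}$; $(-^0,-,-^0,-)$: $1$; $(+^{a+1},-,+^a,-)$: $z^{-1}g(a)$; $(-^0,+,-^0,+)$: $1$; $(-^0,+,+^0,-)$: $1-v$; $(+^1,-,-^0,+)$: $z^{-1}$. Here $a\in\mathbb{Z}/n\mathbb{Z}$ is arbitrary. $\langle\eta|T_\Delta(z)|\xi\rangle$ (resp. $\langle\eta|T_\Gamma(z)|\xi\rangle$) is the sum over admissible states of Delta (resp. Gamma) ice of the product of the vertex weights. *)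

theory Defs
  imports Complex_Main "HOL-Library.Poly_Mapping" "HOL-Library.Groups_Big_Fun"
begin

section \<open>Quantum Fock space\<close>

text \<open>
  The wedge u_{i_m} \<and> u_{i_{m-1}} \<and> ... of level m is encoded by the sequence s with
  s j = i_{m-j}.  A function g on the integers modulo n is encoded as an n-periodic function on
  the integers.
\<close>

type_synonym wedge_seq = "nat \<Rightarrow> int"

definition semi_infinite :: "int \<Rightarrow> wedge_seq set" where
  "semi_infinite m = {s. \<exists>K. \<forall>j\<ge>K. s j = m - int j}"

definition normal_ordered :: "int \<Rightarrow> wedge_seq set" where
  "normal_ordered m = {s \<in> semi_infinite m. \<forall>j. s j > s (Suc j)}"

type_synonym wedge_vec = "wedge_seq \<Rightarrow>\<^sub>0 complex"

definition wscale :: "complex \<Rightarrow> wedge_vec \<Rightarrow> wedge_vec" where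
  "wscale c x = Poly_Mapping.map (\<lambda>y. c * y) x"

lemma lookup_wscale [simp]: "Poly_Mapping.lookup (wscale c x) s = c * Poly_Mapping.lookup x s"
  by (simp add: wscale_def Poly_Mapping.map.rep_eq when_def)

global_interpretation wvec: vector_space wscale
  by unfold_locales (auto intro!: poly_mapping_eqI simp: lookup_add algebra_simps)

abbreviation monomial :: "wedge_seq \<Rightarrow> wedge_vec" where
  "monomial s \<equiv> Poly_Mapping.single s 1"

definition free_wedges :: "int \<Rightarrow> wedge_vec set" where
  "free_wedges m = {x. Poly_Mapping.keys x \<subseteq> semi_infinite m}"

text \<open>The term u_a \<and> u_b in the positions j and j+1 of s, discarded unless a > b.\<close>

definition kept :: "wedge_seq \<Rightarrow> nat \<Rightarrow> int \<Rightarrow> int \<Rightarrow> wedge_vec" where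
  "kept s j a b = (if a > b then monomial (s(j := a, Suc j := b)) else 0)"

definition exchange :: "nat \<Rightarrow> complex \<Rightarrow> (int \<Rightarrow> complex) \<Rightarrow> wedge_seq \<Rightarrow> nat \<Rightarrow> wedge_vec" where
  "exchange n v g s j =
     (let l = s j; p = s (Suc j); N = int n; i = (p - l) mod N in
        wscale (g (l - p)) (kept s j p l)
        + wscale (v - 1) (Sum_any (\<lambda>t::nat. wscale (v ^ t)
            (kept s j (p - int t * N - i) (l + int t * N + i)
             + wscale (g (l - p)) (kept s j (p - (int t + 1) * N) (l + (int t + 1) * N))))))"

definition relators :: "nat \<Rightarrow> complex \<Rightarrow> (int \<Rightarrow> complex) \<Rightarrow> int \<Rightarrow> wedge_vec set" where
  "relators n v g m =
     {monomial s + monomial (s(j := s (Suc j), Suc j := s j)) | s j.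
        s \<in> semi_infinite m \<and> s j mod int n = s (Suc j) mod int n}
   \<union> {monomial s - exchange n v g s j | s j.
        s \<in> semi_infinite m \<and> s j < s (Suc j) \<and> s j mod int n \<noteq> s (Suc j) mod int n}"

definition fock_rel ::
    "nat \<Rightarrow> complex \<Rightarrow> (int \<Rightarrow> complex) \<Rightarrow> int \<Rightarrow> (wedge_vec \<times> wedge_vec) set" where
  "fock_rel n v g m =
     {(x, y). x \<in> free_wedges m \<and> y \<in> free_wedges m \<and> x - y \<in> wvec.span (relators n v g m)}"

definition fock :: "nat \<Rightarrow> complex \<Rightarrow> (int \<Rightarrow> complex) \<Rightarrow> int \<Rightarrow> wedge_vec set set" where
  "fock n v g m = free_wedges m // fock_rel n v g m"

definition fock_class ::
    "nat \<Rightarrow> complex \<Rightarrow> (int \<Rightarrow> complex) \<Rightarrow> int \<Rightarrow> wedge_vec \<Rightarrow> wedge_vec set" where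
  "fock_class n v g m x = fock_rel n v g m `` {x}"

text \<open>
  The coefficient of the normal-ordered wedge \<eta> in a vector of the Fock space.  The description is
  proper because every class contains exactly one combination of normal-ordered wedges.
\<close>

definition fock_coeff :: "int \<Rightarrow> wedge_seq \<Rightarrow> wedge_vec set \<Rightarrow> complex" where
  "fock_coeff m \<eta> X =
     (THE c. \<exists>x\<in>X. Poly_Mapping.keys x \<subseteq> normal_ordered m \<and> Poly_Mapping.lookup x \<eta> = c)"


section \<open>Heisenberg operators and half-vertex operators\<close>

text \<open>
  The sum over the factors is infinite at the level of representatives.  It is restricted to those
  summands that do not vanish in the Fock space, which are finite in number.
\<close>

definition heisenberg_monomial ::
    "nat \<Rightarrow> complex \<Rightarrow> (int \<Rightarrow> complex) \<Rightarrow> int \<Rightarrow> int \<Rightarrow> wedge_seq \<Rightarrow> wedge_vec" where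
  "heisenberg_monomial n v g m k s =
     (\<Sum>j | monomial (s(j := s j - int n * k)) \<notin> wvec.span (relators n v g m).
        monomial (s(j := s j - int n * k)))"

definition heisenberg_rep ::
    "nat \<Rightarrow> complex \<Rightarrow> (int \<Rightarrow> complex) \<Rightarrow> int \<Rightarrow> int \<Rightarrow> wedge_vec \<Rightarrow> wedge_vec" where
  "heisenberg_rep n v g m k x =
     (\<Sum>s\<in>Poly_Mapping.keys x. wscale (Poly_Mapping.lookup x s) (heisenberg_monomial n v g m k s))"

text \<open>The operator J_k on the quotient, lifted from representatives.\<close>

definition heisenberg ::
    "nat \<Rightarrow> complex \<Rightarrow> (int \<Rightarrow> complex) \<Rightarrow> int \<Rightarrow> int \<Rightarrow> wedge_vec set \<Rightarrow> wedge_vec set" where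
  "heisenberg n v g m k X = (\<Union>x\<in>X. fock_class n v g m (heisenberg_rep n v g m k x))"

text \<open>
  Matrix coefficients of e^H with H = sum over k \<ge> 1 of (1/k) (1 - v^k) z^(\<epsilon> n k) J_(\<epsilon> k), where
  \<epsilon> = 1 for H_+ and \<epsilon> = -1 for H_-.  Since H_- is itself an infinite sum of operators, e^H is
  expanded into products: the term of 1/r! H^r belonging to J_(\<epsilon> k_1) ... J_(\<epsilon> k_r) is indexed by
  the list [k_1, ..., k_r].  Only finitely many terms are nonzero, because J_k changes the degree
  of a wedge by -n k.
\<close>

definition half_vertex_coeff ::
    "nat \<Rightarrow> complex \<Rightarrow> (int \<Rightarrow> complex) \<Rightarrow> int \<Rightarrow> int \<Rightarrow> complex \<Rightarrow> wedge_seq \<Rightarrow> wedge_seq \<Rightarrow> complex" where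
  "half_vertex_coeff n v g m \<epsilon> z \<eta> \<xi> =
     Sum_any (\<lambda>ks::nat list. if 0 \<in> set ks then 0 else
       1 / fact (length ks)
       * (\<Prod>k\<leftarrow>ks. 1 / of_nat k * (1 - v ^ k) * z powi (\<epsilon> * int n * int k))
       * fock_coeff m \<eta>
           (foldr (\<lambda>k. heisenberg n v g m (\<epsilon> * int k)) ks (fock_class n v g m (monomial \<xi>))))"

definition exp_H_plus ::
    "nat \<Rightarrow> complex \<Rightarrow> (int \<Rightarrow> complex) \<Rightarrow> int \<Rightarrow> complex \<Rightarrow> wedge_seq \<Rightarrow> wedge_seq \<Rightarrow> complex" where
  "exp_H_plus n v g m z \<eta> \<xi> = half_vertex_coeff n v g m 1 z \<eta> \<xi>"

definition exp_H_minus ::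
    "nat \<Rightarrow> complex \<Rightarrow> (int \<Rightarrow> complex) \<Rightarrow> int \<Rightarrow> complex \<Rightarrow> wedge_seq \<Rightarrow> wedge_seq \<Rightarrow> complex" where
  "exp_H_minus n v g m z \<eta> \<xi> = half_vertex_coeff n v g m (-1) z \<eta> \<xi>"


section \<open>Row transfer matrices of Delta and Gamma ice\<close>

datatype spin = Plus | Minus

text \<open>The decoration is the residue in {0..<n}.\<close>

type_synonym decorated_spin = "spin \<times> int"

text \<open>
  Vertex weights in the order left, top, right, bottom; \<^const>\<open>None\<close> means that the configuration
  is not admissible.
\<close>

fun delta_weight :: "nat \<Rightarrow> complex \<Rightarrow> (int \<Rightarrow> complex) \<Rightarrow> complex \<Rightarrow>
    decorated_spin \<Rightarrow> spin \<Rightarrow> decorated_spin \<Rightarrow> spin \<Rightarrow> complex option" where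
  "delta_weight n v g z (Plus, a) Plus (Plus, b) Plus =
     (if a = 0 \<and> b = 0 then Some 1 else None)"
| "delta_weight n v g z (Minus, a) Minus (Minus, b) Minus =
     (if b = (a + 1) mod int n then Some (g a * z) else None)"
| "delta_weight n v g z (Plus, a) Minus (Plus, b) Minus =
     (if a = 0 \<and> b = 0 then Some 1 else None)"
| "delta_weight n v g z (Minus, a) Plus (Minus, b) Plus =
     (if b = (a + 1) mod int n then Some z else None)"
| "delta_weight n v g z (Minus, a) Plus (Plus, b) Minus =
     (if a = 0 \<and> b = 0 then Some ((1 - v) * z) else None)"
| "delta_weight n v g z (Plus, a) Minus (Minus, b) Plus =
     (if a = 0 \<and> b = 1 mod int n then Some 1 else None)"
| "delta_weight n v g z _ _ _ _ = None"

fun gamma_weight :: "nat \<Rightarrow> complex \<Rightarrow> (int \<Rightarrow> complex) \<Rightarrow> complex \<Rightarrow>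
    decorated_spin \<Rightarrow> spin \<Rightarrow> decorated_spin \<Rightarrow> spin \<Rightarrow> complex option" where
  "gamma_weight n v g z (Plus, b) Plus (Plus, a) Plus =
     (if b = (a + 1) mod int n then Some (inverse z) else None)"
| "gamma_weight n v g z (Minus, b) Minus (Minus, a) Minus =
     (if b = 0 \<and> a = 0 then Some 1 else None)"
| "gamma_weight n v g z (Plus, b) Minus (Plus, a) Minus =
     (if b = (a + 1) mod int n then Some (inverse z * g a) else None)"
| "gamma_weight n v g z (Minus, b) Plus (Minus, a) Plus =
     (if b = 0 \<and> a = 0 then Some 1 else None)"
| "gamma_weight n v g z (Minus, b) Plus (Plus, a) Minus =
     (if b = 0 \<and> a = 0 then Some (1 - v) else None)"
| "gamma_weight n v g z (Plus, b) Minus (Minus, a) Plus =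
     (if b = 1 mod int n \<and> a = 0 then Some (inverse z) else None)"
| "gamma_weight n v g z _ _ _ _ = None"

definition vertical_spin :: "wedge_seq \<Rightarrow> int \<Rightarrow> spin" where
  "vertical_spin s c = (if c \<in> range s then Minus else Plus)"

text \<open>
  A state h gives the decorated spin h c of the edge to the left of the vertex in column c.  As the
  column labels decrease from left to right, the edge to the right of that vertex is h (c - 1).
\<close>

definition admissible_states ::
    "nat \<Rightarrow> decorated_spin \<Rightarrow> (decorated_spin \<Rightarrow> spin \<Rightarrow> decorated_spin \<Rightarrow> spin \<Rightarrow> complex option) \<Rightarrow>
     wedge_seq \<Rightarrow> wedge_seq \<Rightarrow> (int \<Rightarrow> decorated_spin) set" where
  "admissible_states n d W \<eta> \<xi> =
     {h. (\<forall>c. snd (h c) \<in> {0..<int n}) \<and> finite {c. h c \<noteq> d} \<and>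
         (\<forall>c. W (h c) (vertical_spin \<xi> c) (h (c - 1)) (vertical_spin \<eta> c) \<noteq> None)}"

definition ice_partition ::
    "nat \<Rightarrow> decorated_spin \<Rightarrow> (decorated_spin \<Rightarrow> spin \<Rightarrow> decorated_spin \<Rightarrow> spin \<Rightarrow> complex option) \<Rightarrow>
     wedge_seq \<Rightarrow> wedge_seq \<Rightarrow> complex" where
  "ice_partition n d W \<eta> \<xi> =
     (\<Sum>h\<in>admissible_states n d W \<eta> \<xi>.
        Prod_any (\<lambda>c. the (W (h c) (vertical_spin \<xi> c) (h (c - 1)) (vertical_spin \<eta> c))))"

definition T_Delta ::
    "nat \<Rightarrow> complex \<Rightarrow> (int \<Rightarrow> complex) \<Rightarrow> complex \<Rightarrow> wedge_seq \<Rightarrow> wedge_seq \<Rightarrow> complex" where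
  "T_Delta n v g z \<eta> \<xi> = ice_partition n (Plus, 0) (delta_weight n v g z) \<eta> \<xi>"

definition T_Gamma ::
    "nat \<Rightarrow> complex \<Rightarrow> (int \<Rightarrow> complex) \<Rightarrow> complex \<Rightarrow> wedge_seq \<Rightarrow> wedge_seq \<Rightarrow> complex" where
  "T_Gamma n v g z \<eta> \<xi> = ice_partition n (Minus, 0) (gamma_weight n v g z) \<eta> \<xi>"

end

theory Submission
  imports Defs
begin

text \<open>
  The Fock space is studied through the functionals on wedges that respect the exchange relations.
  A function f on pairs respects the two-body relations iff it is antisymmetric for an operator R,
  conjugate to a generator of a Hecke algebra; antisymmetrizers built from R yield enough
  functionals to make the normal-ordered wedges independent.

  As H is a sum over the factors, e^H (u_a \<and> s) is the sum over d of e_d u_(a \<mp> d n) \<and> e^H s, where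
  e_0 = 1 and e_d = 1 - v for d > 0 are the coefficients of
  exp (\<Sum> (1 - v^k) X^k / k) = (1 - v X) / (1 - X).
  In these terms the exchange relation is the identity
  \<Sum> e_d u_(l + d n) \<and> u_(p - d n) = g (l - p) u_p \<and> u_l for l \<le> p, the sum running over d n \<le> p - l.
  With it, a recursion on the first factor of the top wedge turns into the sum over the states of the
  leftmost column of the ice.  For Delta ice the recursion descends through finitely many columns.  For
  Gamma ice it descends in energy, except at the vacuum, where removing the first factor gives the
  vacuum of the level below; after enough removals every contributing wedge vanishes.
\<close>

section \<open>The exchange law\<close>

text \<open>The dual side is chosen for two reasons. Independence of the normal-ordered wedges would
  otherwise require confluence of the straightening rules; here it requires only enough functionals
  that kill the relators. And e^(H_-) acts on bras but not on vectors, so the recursions are stated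
  for functionals. No functional has to be antisymmetrized at infinitely many positions: an element
  of the span of the relators involves finitely many of them, so antisymmetry at the first M
  positions is enough. Once independence is known, the coordinates themselves respect the relations.

  The Hecke algebra is of affine type: its commuting generators shift one index by n. In these terms
  J_k is a power sum, symmetric in the shifts, and therefore commutes with R; this is why J_k is
  well defined on the quotient.

  The two kinds of ice need different recursions because e^(H_+) lowers indices, so that the bottom
  row stays below the top of the given wedge, whereas e^(H_-) raises them and only the energy bounds
  the columns that matter.\<close>

definition pair :: "(wedge_seq \<Rightarrow> complex) \<Rightarrow> wedge_vec \<Rightarrow> complex" where
  "pair \<phi> x = (\<Sum>s\<in>Poly_Mapping.keys x. Poly_Mapping.lookup x s * \<phi> s)"

lemma pair_superset:
  "finite S \<Longrightarrow> Poly_Mapping.keys x \<subseteq> S \<Longrightarrow> pair \<phi> x = (\<Sum>s\<in>S. Poly_Mapping.lookup x s * \<phi> s)"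
  unfolding pair_def by (rule sum.mono_neutral_left) (auto simp: in_keys_iff)

lemma pair_add: "pair \<phi> (x + y) = pair \<phi> x + pair \<phi> y"
proof -
  let ?S = "Poly_Mapping.keys x \<union> Poly_Mapping.keys y"
  have "Poly_Mapping.keys (x + y) \<subseteq> ?S" by (rule Poly_Mapping.keys_add)
  then show ?thesis
    using pair_superset[of ?S x \<phi>] pair_superset[of ?S y \<phi>] pair_superset[of ?S "x + y" \<phi>]
    by (simp add: lookup_add algebra_simps sum.distrib)
qed

lemma keys_wscale: "Poly_Mapping.keys (wscale c x) \<subseteq> Poly_Mapping.keys x"
  by (auto simp: in_keys_iff)

lemma pair_wscale: "pair \<phi> (wscale c x) = c * pair \<phi> x"
  using pair_superset[OF _ keys_wscale, of x \<phi> c]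
  by (simp add: pair_def sum_distrib_left mult.assoc)

lemma pair_zero [simp]: "pair \<phi> 0 = 0"
  by (simp add: pair_def)

lemma pair_diff: "pair \<phi> (x - y) = pair \<phi> x - pair \<phi> y"
  using pair_add[of \<phi> "x - y" y] by simp

lemma pair_sum: "pair \<phi> (\<Sum>i\<in>I. F i) = (\<Sum>i\<in>I. pair \<phi> (F i))"
  by (induction I rule: infinite_finite_induct) (simp_all add: pair_add)

lemma pair_monomial [simp]: "pair \<phi> (monomial s) = \<phi> s"
  by (simp add: pair_def)

lemma semi_infinite_update: "s \<in> semi_infinite m \<Longrightarrow> s(j := a) \<in> semi_infinite m"
proof -
  assume "s \<in> semi_infinite m"
  then obtain K where "\<forall>i\<ge>K. s i = m - int i" by (auto simp: semi_infinite_def)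
  then have "\<forall>i\<ge>max K (Suc j). (s(j := a)) i = m - int i" by auto
  then show ?thesis unfolding semi_infinite_def by blast
qed

text \<open>\<open>v_not_neg1\<close> keeps the eigenvalues 1 and -v of the operator
  \<open>R\<close> below apart; it comes from v^2 \<noteq> 1.\<close>

locale fock_params =
  fixes n :: nat and v :: complex and g :: "int \<Rightarrow> complex"
  assumes n_pos: "n \<ge> 1"
    and v_nz: "v \<noteq> 0"
    and v_not_neg1: "1 + v \<noteq> 0"
    and g_periodic: "g (a + int n) = g a"
    and g_zero: "g 0 = - v"
    and g_inverse: "\<not> int n dvd a \<Longrightarrow> g a * g (- a) = v"
begin

abbreviation N :: int where "N \<equiv> int n"

lemma N_pos: "N > 0"
  using n_pos by simp

lemma g_shift: "g (a + k * N) = g a"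
proof (induction k arbitrary: a rule: int_induct[where k = 0])
  case (step1 i)
  then show ?case using g_periodic[of "a + i * N"] by (simp add: algebra_simps)
next
  case (step2 i)
  then show ?case using g_periodic[of "a + (i - 1) * N"] by (simp add: algebra_simps)
qed simp

lemma g_mod: "a mod N = b mod N \<Longrightarrow> g a = g b"
  by (metis g_shift mod_div_mult_eq)

lemma g_dvd: "N dvd a \<Longrightarrow> g a = - v"
  using g_mod[of a 0] g_zero by (simp add: mod_eq_0_iff_dvd)

lemma g_nz: "g a \<noteq> 0"
  using g_dvd[of a] g_inverse[of a] v_nz by (cases "N dvd a") auto

section \<open>The Hecke operator on functions of two indices\<close>

definition steps :: "int \<Rightarrow> nat" where "steps x = nat ((x + N - 1) div N)"

text \<open>\<open>steps x\<close> is the ceiling of x/N cut off at 0, hence counts the d \<ge> 0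
  with d N < x; this fixes the ranges of the sums in the exchange relations.\<close>

lemma less_steps: "d < steps x \<longleftrightarrow> int d * N < x"
proof -
  define q where "q = (x + N - 1) div N"
  have q: "x + N - 1 = q * N + (x + N - 1) mod N" unfolding q_def by simp
  have r: "0 \<le> (x + N - 1) mod N" "(x + N - 1) mod N < N" using N_pos by auto
  have "d < steps x \<longleftrightarrow> int d < q" unfolding steps_def q_def by auto
  also have "\<dots> \<longleftrightarrow> int d * N < x"
  proof
    assume "int d < q"
    then have "(int d + 1) * N \<le> q * N" using N_pos by (intro mult_right_mono) auto
    then have "(int d + 1) * N \<le> x + N - 1" using q r by linarith
    then show "int d * N < x" by (simp add: algebra_simps)
  next
    assume "int d * N < x"
    show "int d < q"
    proof (rule ccontr)
      assume "\<not> int d < q"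
      then have "q * N \<le> int d * N" using N_pos by (intro mult_right_mono) auto
      then show False using q r \<open>int d * N < x\<close> by linarith
    qed
  qed
  finally show ?thesis .
qed

lemma steps_unique: "(\<And>d. d < k \<longleftrightarrow> int d * N < x) \<Longrightarrow> steps x = k"
  using less_steps by (metis linorder_neqE_nat less_irrefl)

lemma steps_add: "x > - N \<Longrightarrow> steps (x + N) = Suc (steps x)"
proof (rule steps_unique)
  fix d assume x: "x > - N"
  show "d < Suc (steps x) \<longleftrightarrow> int d * N < x + N"
    by (cases d) (use x less_steps in \<open>auto simp: algebra_simps\<close>)
qed

lemma steps_nonpos: "x \<le> 0 \<Longrightarrow> steps x = 0"
  by (rule steps_unique) (use N_pos in \<open>auto simp: not_less intro: order_trans\<close>)

lemma steps_small: "0 < x \<Longrightarrow> x \<le> N \<Longrightarrow> steps x = 1"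
  using steps_add[of "x - N"] steps_nonpos[of "x - N"] by simp

lemma steps_pos: "0 < x \<Longrightarrow> steps x > 0"
  using less_steps[of 0 x] by simp

text \<open>The normalization is chosen such that exchanging an argument shift with R costs a single term
  (\<open>R_bernstein1\<close>, \<open>R_bernstein2\<close>); this reduces the quadratic and the braid relation to arguments
  in one window of length N, where the sums in R have at most one term.\<close>

definition R :: "(int \<Rightarrow> int \<Rightarrow> complex) \<Rightarrow> int \<Rightarrow> int \<Rightarrow> complex" where
  "R f l p =
     (if p < l then - g (l - p) * f p l
        + (v - 1) * (\<Sum>d\<in>{1..<steps (l - p)}. f (l - int d * N) (p + int d * N))
      else if l = p then f l l
      else (if N dvd p - l then 1 else - g (l - p)) * f p l
        - (v - 1) * (\<Sum>d<steps (p - l). f (l + int d * N) (p - int d * N)))"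

lemma R_add: "R (\<lambda>a b. f a b + h a b) l p = R f l p + R h l p"
  by (simp add: R_def sum.distrib algebra_simps)

lemma R_scale: "R (\<lambda>a b. c * f a b) l p = c * R f l p"
  by (simp add: R_def algebra_simps sum_distrib_left)

lemma R_diff: "R (\<lambda>a b. f a b - h a b) l p = R f l p - R h l p"
  using R_add[of f "\<lambda>a b. (-1) * h a b"] R_scale[of "-1" h] by simp

lemma R_zero: "R (\<lambda>a b. 0) l p = 0"
  by (simp add: R_def)

lemma R_sum: "R (\<lambda>a b. \<Sum>i\<in>I. F i a b) l p = (\<Sum>i\<in>I. R (F i) l p)"
  by (induction I rule: infinite_finite_induct) (simp_all add: R_zero R_add)

lemma R_translate: "R f (l + c) (p + c) = R (\<lambda>a b. f (a + c) (b + c)) l p"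
  by (simp add: R_def algebra_simps)

lemma sum_shift1: "(\<Sum>d\<in>{1..<Suc k}. (F::nat \<Rightarrow> complex) d) = (\<Sum>d<k. F (Suc d))"
  by (rule sum.reindex_bij_witness[of _ Suc "\<lambda>d. d - 1"]) auto

lemma sum_from1: "k > 0 \<Longrightarrow> (\<Sum>d<k. (F::nat \<Rightarrow> complex) d) = F 0 + (\<Sum>d\<in>{1..<k}. F d)"
  by (simp add: sum.atLeast1_atMost_eq lessThan_atLeast0 sum.atLeast_Suc_lessThan)

text \<open>The Bernstein relation of an affine Hecke algebra, with the shift of one index by N as
  lattice generator. Moving l up by N lengthens the sum in \<open>R\<close> by one term if l is
  above p, and removes the term d = 0 if l is far below p; for the gaps between, at most one term is
  present on either side.\<close>

lemma R_bernstein1: "R f (l + N) p = R (\<lambda>a b. f a (b + N)) l p + (v - 1) * f l (p + N)"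
proof -
  consider "p < l" | "p = l" | "l < p" "p < l + N" | "l + N = p" | "l + N < p" by linarith
  then show ?thesis
  proof cases
    case 1
    then have pos: "steps (l - p) > 0" and st: "steps (l + N - p) = Suc (steps (l - p))"
      using steps_pos steps_add[of "l - p"] N_pos by (auto simp: algebra_simps)
    have "(\<Sum>d\<in>{1..<steps (l + N - p)}. f (l + N - int d * N) (p + int d * N))
       = (\<Sum>d<steps (l - p). f (l - int d * N) (p + int d * N + N))"
      unfolding st sum_shift1 by (simp add: algebra_simps)
    also have "\<dots> = f l (p + N) + (\<Sum>d\<in>{1..<steps (l - p)}. f (l - int d * N) (p + int d * N + N))"
      using pos by (simp add: sum_from1)
    finally show ?thesis using 1 N_pos g_periodic[of "l - p"]
      by (simp add: R_def algebra_simps)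
  next
    case 2
    then show ?thesis using N_pos g_periodic[of 0] g_zero steps_small[of N]
      by (simp add: R_def algebra_simps)
  next
    case 3
    then have "\<not> N dvd p - l" using zdvd_not_zless[of "p - l" N] by auto
    then show ?thesis using 3 N_pos steps_small[of "p - l"] steps_small[of "l + N - p"] g_periodic[of "l - p"]
      by (simp add: R_def algebra_simps)
  next
    case 4
    have "p = l + N" using 4 by auto
    then show ?thesis using N_pos steps_small[of N] by (simp add: R_def)
  next
    case 5
    then have st: "steps (p - l) = Suc (steps (p - l - N))"
      using steps_add[of "p - l - N"] N_pos by (simp add: algebra_simps)
    have "(\<Sum>d<steps (p - l). f (l + int d * N) (p - int d * N + N)) = f l (p + N)
       + (\<Sum>d<steps (p - (l + N)). f (l + N + int d * N) (p - int d * N))"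
    proof -
      have "(\<Sum>d<Suc k. f (l + int d * N) (p - int d * N + N)) = f l (p + N)
         + (\<Sum>d<k. f (l + N + int d * N) (p - int d * N))" for k
        unfolding sum.lessThan_Suc_shift by (simp add: distrib_right add.assoc)
      moreover have "p - (l + N) = p - l - N" by simp
      ultimately show ?thesis unfolding st by (simp only:)
    qed
    moreover have "N dvd p - (l + N) \<longleftrightarrow> N dvd p - l"
      using dvd_add_triv_right_iff[of N "p - l - N"] by (simp add: diff_diff_eq)
    moreover have "g (l + N - p) = g (l - p)" using g_periodic[of "l - p"] by (simp add: algebra_simps)
    ultimately show ?thesis using 5 N_pos by (simp add: R_def algebra_simps)
  qed
qed

text \<open>A shift of both indices commutes with \<open>R\<close>, so the relation for the second
  index follows from that for the first, applied to the function whose second argument is moved back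
  by N.\<close>

lemma R_bernstein2: "R f l (p + N) = R (\<lambda>a b. f (a + N) b) l p - (v - 1) * f l (p + N)"
proof -
  have "R f (l + N) (p + N) = R (\<lambda>a b. f (a + N) (b + N)) l p" by (rule R_translate)
  moreover have "R f (l + N) (p + N) = R (\<lambda>a b. f a (b + N)) l (p + N) + (v - 1) * f l (p + N + N)"
    by (rule R_bernstein1)
  ultimately have *: "R (\<lambda>a b. f a (b + N)) l (p + N) = R (\<lambda>a b. f (a + N) (b + N)) l p - (v - 1) * f l (p + N + N)"
    for f by (metis R_bernstein1 R_translate add_diff_cancel_right')
  show ?thesis using *[of "\<lambda>a b. f a (b - N)"] by (simp add: algebra_simps)
qed

text \<open>In a window of length N the sums in \<open>R\<close> have at most one term, and
  \<open>R\<close> becomes a generator of a finite Hecke algebra, twisted by the factors g.\<close>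

lemma R_near:
  assumes "\<bar>l - p\<bar> < N"
  shows "R f l p = (if l = p then f l l else - g (l - p) * f p l - (if l < p then (v - 1) * f l p else 0))"
proof -
  have "\<not> N dvd p - l" if "l < p" using that assms zdvd_not_zless[of "p - l" N] by auto
  then show ?thesis using assms steps_small[of "p - l"] steps_small[of "l - p"]
    by (auto simp: R_def)
qed

lemma not_dvd_near: "\<bar>l - p\<bar> < N \<Longrightarrow> l \<noteq> p \<Longrightarrow> \<not> N dvd l - p"
  using dvd_imp_le_int[of "l - p" N] by auto

text \<open>It is applied to statements quantified over all functions: these are invariant under
  shifts by N because a shift of an index is absorbed into the function.\<close>

lemma residue_induct:
  assumes up: "\<And>x. P (x + N) \<longleftrightarrow> P x" and base: "\<And>x. 0 \<le> x \<Longrightarrow> x < N \<Longrightarrow> P x"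
  shows "P (x::int)"
proof -
  have "P (x + k * N) \<longleftrightarrow> P x" for k x
  proof (induction k rule: int_induct[where k = 0])
    case (step1 i)
    then show ?case using up[of "x + i * N"] by (simp add: algebra_simps)
  next
    case (step2 i)
    then show ?case using up[of "x + (i - 1) * N"] by (simp add: algebra_simps)
  qed simp
  from this[of "x mod N" "x div N"] base[of "x mod N"] N_pos show ?thesis by simp
qed

text \<open>The polynomial is (X - 1)(X + v). The Bernstein corrections cancel in \<open>Q\<close>,
  and two applications of \<open>R\<close> return the shift to its own argument, so shifting an
  index merely replaces f by a shifted f. Inside one window the claim comes down to g(a) g(-a) =
  v.\<close>

lemma R_quadratic: "R (R f) l p = v * f l p - (v - 1) * R f l p"
proof -
  define Q where "Q f l p = R (R f) l p - v * f l p + (v - 1) * R f l p" for f l p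
  have Q1: "Q f (l + N) p = Q (\<lambda>a b. f (a + N) b) l p" for f l p
  proof -
    have "R (R f) (l + N) p = R (\<lambda>a b. R f a (b + N)) l p + (v - 1) * R f l (p + N)"
      by (rule R_bernstein1)
    also have "\<dots> = R (R (\<lambda>a b. f (a + N) b)) l p - (v - 1) * R (\<lambda>a b. f a (b + N)) l p
       + (v - 1) * (R (\<lambda>a b. f (a + N) b) l p - (v - 1) * f l (p + N))"
      by (simp add: R_bernstein2 R_diff R_scale)
    finally show ?thesis unfolding Q_def R_bernstein1 by (simp add: algebra_simps)
  qed
  have Q2: "Q f l (p + N) = Q (\<lambda>a b. f a (b + N)) l p" for f l p
  proof -
    have "R (R f) l (p + N) = R (\<lambda>a b. R f (a + N) b) l p - (v - 1) * R f l (p + N)"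
      by (rule R_bernstein2)
    also have "\<dots> = R (R (\<lambda>a b. f a (b + N))) l p + (v - 1) * R (\<lambda>a b. f a (b + N)) l p
       - (v - 1) * R f l (p + N)"
      by (simp add: R_bernstein1 R_add R_scale)
    finally show ?thesis unfolding Q_def by (simp add: algebra_simps)
  qed
  have "\<forall>f. Q f l p = 0" for l p
  proof (rule residue_induct[of "\<lambda>l. \<forall>f. Q f l p = 0"])
    show "(\<forall>f. Q f (x + N) p = 0) = (\<forall>f. Q f x p = 0)" for x
    proof
      assume H: "\<forall>f. Q f (x + N) p = 0"
      show "\<forall>f. Q f x p = 0"
        using H Q1[of "\<lambda>a b. h (a - N) b" x p for h] by simp
    qed (simp add: Q1)
    fix l assume l: "0 \<le> l" "l < N"
    show "\<forall>f. Q f l p = 0"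
    proof (rule residue_induct[of "\<lambda>p. \<forall>f. Q f l p = 0"])
      show "(\<forall>f. Q f l (x + N) = 0) = (\<forall>f. Q f l x = 0)" for x
      proof
        assume H: "\<forall>f. Q f l (x + N) = 0"
        show "\<forall>f. Q f l x = 0"
          using H Q2[of "\<lambda>a b. h a (b - N)" l x for h] by simp
      qed (simp add: Q2)
      fix p assume p: "0 \<le> p" "p < N"
      have near: "\<bar>l - p\<bar> < N" "\<bar>p - l\<bar> < N" using l p by auto
      have "g (l - p) * g (p - l) = v" if "l \<noteq> p"
        using g_inverse[of "l - p"] not_dvd_near[OF near(1) that] by simp
      then show "\<forall>f. Q f l p = 0"
        using near by (auto simp: Q_def R_near algebra_simps)
    qed
  qed
  then show ?thesis unfolding Q_def by (simp add: algebra_simps)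
qed

section \<open>The exchange law as an eigenvalue equation for \<open>R\<close>\<close>

definition exchange_law :: "(int \<Rightarrow> int \<Rightarrow> complex) \<Rightarrow> bool" where
  "exchange_law f \<longleftrightarrow>
     (\<forall>a b. N dvd a - b \<longrightarrow> f a b = - f b a) \<and>
     (\<forall>l p. l < p \<longrightarrow> \<not> N dvd p - l \<longrightarrow>
        f l p = g (l - p) * f p l + (v - 1) * (\<Sum>d\<in>{1..<steps (p - l)}. f (l + int d * N) (p - int d * N)))"

lemma steps_mult: "steps (int t * N) = t"
  using N_pos by (intro steps_unique) simp

text \<open>With t N = p - l, the substitution of t - d for d interchanges the two indices, so the
  sum is its own negative.\<close>

lemma antisymmetric_sum_zero:
  assumes "l < p" "N dvd p - l"
    and "\<And>d. d \<in> {1..<steps (p - l)} \<Longrightarrow> f (l + int d * N) (p - int d * N) = - f (p - int d * N) (l + int d * N)"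
  shows "(\<Sum>d\<in>{1..<steps (p - l)}. (f (l + int d * N) (p - int d * N) :: complex)) = 0"
proof -
  obtain k where k: "p - l = N * k" using assms(2) by (auto simp: dvd_def)
  then have "k \<ge> 0" using assms(1) N_pos by (metis diff_gt_0_iff_gt order_less_imp_le zero_less_mult_pos)
  then obtain t where t: "k = int t" using nonneg_int_cases by blast
  have p: "p = l + int t * N" using k t by (simp add: algebra_simps)
  have st: "steps (p - l) = t" using p steps_mult by simp
  let ?F = "\<lambda>d. f (l + int d * N) (p - int d * N)"
  have "(\<Sum>d\<in>{1..<t}. ?F d) = (\<Sum>d\<in>{1..<t}. - ?F d)"
  proof (rule sum.reindex_bij_witness[of _ "\<lambda>d. t - d" "\<lambda>d. t - d"])
    fix d assume d: "d \<in> {1..<t}"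
    then have 1: "t - d \<in> {1..<steps (p - l)}" using st by auto
    show "- f (l + int (t - d) * N) (p - int (t - d) * N) = f (l + int d * N) (p - int d * N)"
      unfolding assms(3)[OF 1] using d by (simp add: p of_nat_diff algebra_simps)
  qed auto
  then show ?thesis unfolding st sum_negf by simp
qed

text \<open>\<psi> = R f + v f has to vanish, and the quadratic relation gives R \<psi> = \<psi>.
  For l \<le> p, and whenever N divides l - p, the law yields \<psi> = 0 outright. For the other
  pairs with l > p, the equation R \<psi> = \<psi> at (p, l) expresses \<psi> l p through values of
  \<psi> at l \<le> p or at smaller gaps.\<close>

lemma exchange_law_imp_R:
  assumes "exchange_law f"
  shows "R f l p = - v * f l p"
proof -
  have anti: "f a b = - f b a" if "N dvd a - b" for a b
    using assms that unfolding exchange_law_def by blast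
  have law: "f l p = g (l - p) * f p l + (v - 1) * (\<Sum>d\<in>{1..<steps (p - l)}. f (l + int d * N) (p - int d * N))"
    if "l < p" "\<not> N dvd p - l" for l p
    using assms that unfolding exchange_law_def by blast
  define \<psi> where "\<psi> a b = R f a b + v * f a b" for a b
  have R\<psi>: "R \<psi> a b = \<psi> a b" for a b
  proof -
    have "R \<psi> a b = R (R f) a b + v * R f a b"
      unfolding \<psi>_def by (simp add: R_add R_scale)
    then show ?thesis by (simp add: R_quadratic \<psi>_def algebra_simps)
  qed
  have sum0: "(\<Sum>d\<in>{1..<steps (p - l)}. f (l + int d * N) (p - int d * N)) = 0"
    if "l < p" "N dvd p - l" for l p
  proof (rule antisymmetric_sum_zero[OF that])
    fix d
    have "(l + int d * N) - (p - int d * N) = 2 * int d * N - (p - l)" by (simp add: algebra_simps)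
    then have "N dvd (l + int d * N) - (p - int d * N)" using that(2) by (metis dvd_diff dvd_triv_right)
    then show "f (l + int d * N) (p - int d * N) = - f (p - int d * N) (l + int d * N)" by (rule anti)
  qed
  have eq: "\<psi> l l = 0" for l
    using anti[of l l] by (simp add: \<psi>_def R_def)
  have up: "\<psi> l p = 0" if "l < p" for l p
  proof (cases "N dvd p - l")
    case True
    have "N dvd l - p" using True by (metis dvd_minus_iff minus_diff_eq)
    then show ?thesis using that True sum0[OF that True] anti[of l p] steps_pos[of "p - l"]
      by (simp add: \<psi>_def R_def sum_from1 algebra_simps)
  next
    case False
    then show ?thesis using that law[OF that False] steps_pos[of "p - l"]
      by (simp add: \<psi>_def R_def sum_from1) (simp add: algebra_simps)
  qed
  have down: "p < l \<longrightarrow> nat (l - p) = k \<longrightarrow> \<psi> l p = 0" for k l p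
  proof (induction k arbitrary: l p rule: less_induct)
    case (less k)
    show ?case
    proof (intro impI)
      assume pl: "p < l" and k: "nat (l - p) = k"
      show "\<psi> l p = 0"
      proof (cases "N dvd l - p")
        case True
        have "(\<Sum>d\<in>{1..<steps (l - p)}. f (l - int d * N) (p + int d * N))
            = - (\<Sum>d\<in>{1..<steps (l - p)}. f (p + int d * N) (l - int d * N))"
          unfolding sum_negf[symmetric]
        proof (rule sum.cong)
          fix d
          have "(l - int d * N) - (p + int d * N) = (l - p) - 2 * int d * N" by (simp add: algebra_simps)
          then have "N dvd (l - int d * N) - (p + int d * N)" using True by (metis dvd_diff dvd_triv_right)
          then show "f (l - int d * N) (p + int d * N) = - f (p + int d * N) (l - int d * N)" by (rule anti)
        qed simp
        then show ?thesis using pl sum0[OF pl True] anti[of l p] True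
          by (simp add: \<psi>_def R_def g_dvd)
      next
        case False
        have z: "\<psi> (p + int d * N) (l - int d * N) = 0" if "d < steps (l - p)" for d
        proof -
          consider "p + int d * N < l - int d * N" | "p + int d * N = l - int d * N"
            | "l - int d * N < p + int d * N" by linarith
          then show ?thesis
          proof cases
            case 2
            then show ?thesis using eq by metis
          next
            case 3
            have "int d * N < l - p" using that less_steps by blast
            then have "nat ((p + int d * N) - (l - int d * N)) < k" using k 3 pl by linarith
            then show ?thesis using less.IH 3 by blast
          qed (use up in auto)
        qed
        have "R \<psi> p l = - g (p - l) * \<psi> l p"
          using pl False z by (simp add: R_def)
        then show ?thesis using R\<psi>[of p l] up[OF pl] g_nz[of "p - l"] by simp
      qed
    qed
  qed
  have "\<psi> l p = 0" using eq up down by (cases l p rule: linorder_cases) auto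
  then show ?thesis unfolding \<psi>_def by (simp add: algebra_simps add_eq_0_iff)
qed

text \<open>At l = p the equation reads (1 + v) f l l = 0. If N divides p - l > 0, it reads f l p +
  f p l = (v - 1) times the sum, and the sum vanishes by antisymmetry at smaller gaps. Otherwise it
  is the exchange law rearranged.\<close>

lemma R_imp_exchange_law:
  assumes "\<And>l p. R f l p = - v * f l p"
  shows "exchange_law f"
proof -
  have eq: "f l l = 0" for l
  proof -
    have "(1 + v) * f l l = 0" using assms[of l l] by (simp add: R_def distrib_right eq_neg_iff_add_eq_0)
    then show ?thesis using v_not_neg1 by simp
  qed
  have up: "N dvd p - l \<longrightarrow> l < p \<longrightarrow> nat (p - l) = k \<longrightarrow> f l p = - f p l" for k l p
  proof (induction k arbitrary: l p rule: less_induct)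
    case (less k)
    show ?case
    proof (intro impI)
      assume dv: "N dvd p - l" and lp: "l < p" and k: "nat (p - l) = k"
      have "(\<Sum>d\<in>{1..<steps (p - l)}. f (l + int d * N) (p - int d * N)) = 0"
      proof (rule antisymmetric_sum_zero[OF lp dv])
        fix d assume "d \<in> {1..<steps (p - l)}"
        then have d: "int d * N < p - l" "d \<ge> 1" using less_steps by auto
        then have d0: "int d * N > 0" using N_pos by simp
        let ?a = "l + int d * N" and ?b = "p - int d * N"
        have "?b - ?a = (p - l) - 2 * int d * N" "?a - ?b = 2 * int d * N - (p - l)" by (simp_all add: algebra_simps)
        then have dd: "N dvd ?b - ?a" "N dvd ?a - ?b" using dv by (metis dvd_diff dvd_triv_right)+
        consider "?a < ?b" | "?a = ?b" | "?b < ?a" by linarith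
        then show "f ?a ?b = - f ?b ?a"
        proof cases
          case 1
          then have "nat (?b - ?a) < k" using d0 k lp by linarith
          then show ?thesis using less.IH 1 dd by blast
        next
          case 2
          then have "f ?a ?b = 0" "f ?b ?a = 0" using eq[of ?a] by metis+
          then show ?thesis by simp
        next
          case 3
          then have "nat (?a - ?b) < k" using d k lp by linarith
          then have "f ?b ?a = - f ?a ?b" using less.IH 3 dd by blast
          then show ?thesis by simp
        qed
      qed
      then have "f l p + f p l = 0" using assms[of l p] lp dv steps_pos[of "p - l"]
        by (simp add: R_def sum_from1 algebra_simps)
      then show "f l p = - f p l" by (simp only: eq_neg_iff_add_eq_0)
    qed
  qed
  have "f a b = - f b a" if "N dvd a - b" for a b
  proof -
    have "N dvd b - a" using that by (metis dvd_minus_iff minus_diff_eq)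
    then show ?thesis using up[of b a] up[of a b] eq that by (cases a b rule: linorder_cases) auto
  qed
  moreover have "f l p = g (l - p) * f p l + (v - 1) * (\<Sum>d\<in>{1..<steps (p - l)}. f (l + int d * N) (p - int d * N))"
    if "l < p" "\<not> N dvd p - l" for l p
    using assms[of l p] that steps_pos[of "p - l"] by (simp add: R_def sum_from1 algebra_simps)
  ultimately show ?thesis unfolding exchange_law_def by blast
qed

lemma exchange_law_iff_R: "exchange_law f \<longleftrightarrow> (\<forall>l p. R f l p = - v * f l p)"
  using exchange_law_imp_R R_imp_exchange_law by blast

text \<open>\<open>kms_series\<close> is the sum in the relations of Kashiwara, Miwa and Stern as imposed on the Fock space.
  From the relation for (l, p), v times that for (l + N, p - N) is subtracted; what remains is the
  same as for \<open>exchange_law\<close> with the factor v replaced by 1, so both systems are equivalent.\<close>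

definition kept_term :: "(int \<Rightarrow> int \<Rightarrow> complex) \<Rightarrow> int \<Rightarrow> int \<Rightarrow> complex" where
  "kept_term f a b = (if a > b then f a b else 0)"

definition kms_series :: "(int \<Rightarrow> int \<Rightarrow> complex) \<Rightarrow> nat \<Rightarrow> int \<Rightarrow> int \<Rightarrow> complex" where
  "kms_series f T l p = (\<Sum>t<T. v ^ t *
     (kept_term f (p - int t * N - (p - l) mod N) (l + int t * N + (p - l) mod N)
      + g (l - p) * kept_term f (p - (int t + 1) * N) (l + (int t + 1) * N)))"

lemma shift_mod: "(p - N - (l + N)) mod N = (p - l) mod N"
proof -
  have "p - N - (l + N) = (p - l) + (- 2) * N" by (simp add: algebra_simps)
  then show ?thesis by (metis mod_mult_self1)
qed

text \<open>The summand t + 1 at (l, p) is v times the summand t at (l + N, p - N), because the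
  residue of the gap and the factor g depend only on p - l modulo N.\<close>

lemma kms_series_Suc:
  "kms_series f (Suc T) l p =
     kept_term f (p - (p - l) mod N) (l + (p - l) mod N) + g (l - p) * kept_term f (p - N) (l + N)
     + v * kms_series f T (l + N) (p - N)"
proof -
  have gg: "g (l + N - (p - N)) = g (l - p)"
    using g_shift[of "l - p" 2] by (simp add: algebra_simps)
  show ?thesis
    unfolding kms_series_def sum.lessThan_Suc_shift sum_distrib_left shift_mod gg
    by (simp add: algebra_simps)
qed

lemma kms_series_zero:
  assumes "p \<le> l"
  shows "kms_series f T l p = 0"
proof -
  have 1: "\<not> p - int t * N - (p - l) mod N > l + int t * N + (p - l) mod N" for t
  proof -
    have "int t * N \<ge> 0" "(p - l) mod N \<ge> 0" using N_pos by auto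
    then show ?thesis using assms by linarith
  qed
  have 2: "\<not> p - (int t + 1) * N > l + (int t + 1) * N" for t
  proof -
    have "(int t + 1) * N \<ge> 0" using N_pos by auto
    then show ?thesis using assms by linarith
  qed
  show ?thesis unfolding kms_series_def kept_term_def using 1 2 by simp
qed

definition kms_defect where
  "kms_defect f T l p = f l p - g (l - p) * f p l - (v - 1) * kms_series f T l p"

definition exchange_defect where
  "exchange_defect f l p = f l p - g (l - p) * f p l
     - (v - 1) * (\<Sum>d\<in>{1..<steps (p - l)}. f (l + int d * N) (p - int d * N))"

text \<open>For a gap below 2 N the series keeps at most one term: none if the gap is below N, and
  u_(l + N) \<and> u_(p - N) otherwise. The exchange law has the same term.\<close>

lemma kms_defect_small:
  assumes "l < p" "p - l < 2 * N" "\<not> N dvd p - l" "T > 0"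
  shows "kms_defect f T l p = exchange_defect f l p"
proof -
  obtain T' where T: "T = Suc T'" using assms(4) gr0_implies_Suc by blast
  have z: "kms_series f T' (l + N) (p - N) = 0" "\<not> p - N > l + N"
    using assms(2) by (auto intro: kms_series_zero)
  show ?thesis
  proof (cases "p - l < N")
    case True
    have m: "(p - l) mod N = p - l" using True assms(1) by simp
    show ?thesis using True assms(1) z
      by (simp add: kms_defect_def exchange_defect_def T kms_series_Suc m kept_term_def steps_small)
  next
    case False
    have "p - l \<noteq> N" using assms(3) by auto
    then have gt: "p - l > N" using False by simp
    have m: "(p - l) mod N = p - l - N"
      using gt assms(2) minus_mod_self2[of "p - l" N] mod_pos_pos_trivial[of "p - l - N" N] by linarith
    have st: "steps (p - l) = 2" using steps_add[of "p - l - N"] steps_small[of "p - l - N"] gt assms(2) by simp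
    have "{1..<2::nat} = {1}" by auto
    then show ?thesis using z gt assms(2)
      by (simp add: kms_defect_def exchange_defect_def T kms_series_Suc m kept_term_def st)
  qed
qed

lemma steps_not_dvd:
  assumes "x > 0" "\<not> N dvd x"
  shows "int (steps x) = x div N + 1"
proof -
  have "x mod N \<noteq> 0" using assms(2) by (simp add: dvd_eq_mod_eq_0)
  moreover have "x mod N \<ge> 0" "x mod N < N" using N_pos by (rule pos_mod_sign, rule pos_mod_bound)
  ultimately have r: "x mod N > 0" "x mod N < N" by linarith+
  have q: "x div N \<ge> 0" using assms(1) N_pos by (simp add: pos_imp_zdiv_nonneg_iff)
  have x: "x = (x div N) * N + x mod N" by simp
  have "steps x = nat (x div N + 1)"
  proof (rule steps_unique)
    fix d
    have "int d * N < x \<longleftrightarrow> int d \<le> x div N"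
    proof
      assume "int d * N < x"
      show "int d \<le> x div N"
      proof (rule ccontr)
        assume "\<not> int d \<le> x div N"
        then have "(x div N + 1) * N \<le> int d * N" using N_pos by (intro mult_right_mono) auto
        moreover have "(x div N + 1) * N = (x div N) * N + N" by (simp add: distrib_right)
        ultimately show False using \<open>int d * N < x\<close> x r by linarith
      qed
    next
      assume "int d \<le> x div N"
      then have "int d * N \<le> (x div N) * N" using N_pos by (intro mult_right_mono) auto
      then show "int d * N < x" using x r by linarith
    qed
    then show "d < nat (x div N + 1) \<longleftrightarrow> int d * N < x" using q by auto
  qed
  then show ?thesis using q by simp
qed

text \<open>Write the gap as (k + 2) N + r with 0 \<le> r < N. In the exchange law at (l, p) the
  term d = k + 2 is f (p - r) (l + r), kept in the first summand of the series; the term d = 1 is f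
  (l + N) (p - N) and comes from the relation that is subtracted; the terms between form the sum of
  the law at (l + N, p - N).\<close>

lemma kms_defect_large:
  assumes "p - l > 2 * N" "\<not> N dvd p - l"
  shows "kms_defect f (Suc T) l p - v * kms_defect f T (l + N) (p - N)
       = exchange_defect f l p - exchange_defect f (l + N) (p - N)"
proof -
  obtain k where k: "steps (p - N - (l + N)) = Suc k"
    using assms steps_pos[of "p - N - (l + N)"] gr0_implies_Suc by auto
  have st: "steps (p - l) = Suc (Suc (Suc k))"
  proof -
    have "steps (p - l) = Suc (steps (p - l - N))" "steps (p - l - N) = Suc (steps (p - N - (l + N)))"
      using assms N_pos steps_add[of "p - l - N"] steps_add[of "p - N - (l + N)"] by (simp_all add: algebra_simps)
    then show ?thesis using k by simp
  qed
  let ?F = "\<lambda>d. f (l + int d * N) (p - int d * N)"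
  define r where "r = (p - l) mod N"
  have r: "0 \<le> r" "r < N" using N_pos unfolding r_def by auto
  have split: "(\<Sum>d\<in>{1..<steps (p - l)}. ?F d) = ?F 1 + (\<Sum>d\<in>{1..<Suc k}. ?F (Suc d)) + ?F (Suc (Suc k))"
  proof -
    have "(\<Sum>d<Suc (Suc k). ?F (Suc d)) = (\<Sum>d<Suc k. ?F (Suc d)) + ?F (Suc (Suc k))"
      by (rule sum.lessThan_Suc)
    moreover have "(\<Sum>d<Suc k. ?F (Suc d)) = ?F 1 + (\<Sum>d<k. ?F (Suc (Suc d)))"
      by (simp only: sum.lessThan_Suc_shift One_nat_def)
    ultimately show ?thesis unfolding st sum_shift1 by (simp only: add.assoc)
  qed
  have "(p - l) div N = int (Suc (Suc k))"
    using steps_not_dvd[of "p - l"] assms N_pos st by simp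
  then have kk: "int (Suc (Suc k)) * N = p - l - r"
    unfolding r_def using minus_mod_eq_div_mult[of "p - l" N] by simp
  have last: "?F (Suc (Suc k)) = f (p - r) (l + r)"
    unfolding kk by (rule arg_cong2[where f = f]) simp_all
  have kept: "kept_term f (p - r) (l + r) = f (p - r) (l + r)" "kept_term f (p - N) (l + N) = f (p - N) (l + N)"
    using r assms(1) by (auto simp: kept_term_def)
  have gg: "g (l + N - (p - N)) = g (l - p)"
    using g_shift[of "l - p" 2] by (simp add: algebra_simps)
  have inner: "(\<Sum>d\<in>{1..<Suc k}. ?F (Suc d)) = (\<Sum>d\<in>{1..<Suc k}. f (l + N + int d * N) (p - N - int d * N))"
    by (simp add: algebra_simps)
  have alg: "(A - h * B - (v - 1) * (F + h * Y + v * V)) - v * (X - h * Y - (v - 1) * V)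
      = (A - h * B - (v - 1) * (X + S + F)) - (X - h * Y - (v - 1) * S)" for A B F S V X Y h :: complex
    by algebra
  have S: "kms_series f (Suc T) l p = f (p - r) (l + r) + g (l - p) * f (p - N) (l + N) + v * kms_series f T (l + N) (p - N)"
    unfolding kms_series_Suc r_def[symmetric] kept ..
  have E: "exchange_defect f l p = f l p - g (l - p) * f p l - (v - 1) * (f (l + N) (p - N)
     + (\<Sum>d\<in>{1..<Suc k}. f (l + N + int d * N) (p - N - int d * N)) + f (p - r) (l + r))"
    by (simp only: exchange_defect_def split last inner of_nat_1 mult_1)
  show ?thesis
    by (simp only: kms_defect_def S E exchange_defect_def[of _ "l + N"] k gg alg)
qed

lemma gap_shift_dvd: "N dvd p - N - (l + N) \<longleftrightarrow> N dvd p - l"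
  using shift_mod[of p l] by (simp add: dvd_eq_mod_eq_0)

text \<open>Induction on the gap, moving both indices inwards by N. A gap of exactly 2 N, which
  neither rule covers, is divisible by N.\<close>

lemma all_defects:
  assumes base: "\<And>l p. l < p \<Longrightarrow> p - l < 2 * N \<Longrightarrow> \<not> N dvd p - l \<Longrightarrow> P l p"
    and step: "\<And>l p. p - l > 2 * N \<Longrightarrow> \<not> N dvd p - l \<Longrightarrow> P (l + N) (p - N) \<Longrightarrow> P l p"
  shows "l < p \<Longrightarrow> \<not> N dvd p - l \<Longrightarrow> P l p"
proof (induction "nat (p - l)" arbitrary: l p rule: less_induct)
  case less
  show ?case
  proof (cases "p - l < 2 * N")
    case True
    show ?thesis by (rule base[OF less.prems(1) True less.prems(2)])
  next
    case False
    have "p - l \<noteq> 2 * N" using less.prems(2) by auto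
    then have gt: "p - l > 2 * N" using False by linarith
    have "nat (p - N - (l + N)) < nat (p - l)" "l + N < p - N" using gt N_pos by linarith+
    moreover have "\<not> N dvd p - N - (l + N)" using less.prems(2) gap_shift_dvd by blast
    ultimately have "P (l + N) (p - N)" by (rule less.hyps)
    then show ?thesis by (rule step[OF gt less.prems(2)])
  qed
qed

text \<open>The truncation T is left free above \<open>steps (p - l)\<close>, since the inductive
  step lowers T by one while the gap drops by 2 N.\<close>

lemma kms_defect_iff:
  "(\<forall>l p T. l < p \<longrightarrow> \<not> N dvd p - l \<longrightarrow> T \<ge> steps (p - l) \<longrightarrow> kms_defect f T l p = 0) \<longleftrightarrow>
   (\<forall>l p. l < p \<longrightarrow> \<not> N dvd p - l \<longrightarrow> exchange_defect f l p = 0)" (is "?K \<longleftrightarrow> ?E")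
proof
  assume K: ?K
  have "exchange_defect f l p = 0" if "l < p" "\<not> N dvd p - l" for l p
  proof (rule all_defects[of "\<lambda>l p. exchange_defect f l p = 0", OF _ _ that])
    fix l p assume "l < p" "p - l < 2 * N" "\<not> N dvd p - l"
    then show "exchange_defect f l p = 0"
      using kms_defect_small[of l p "steps (p - l)" f] K steps_pos[of "p - l"] by simp
  next
    fix l p assume a: "p - l > 2 * N" "\<not> N dvd p - l" "exchange_defect f (l + N) (p - N) = 0"
    have "kms_defect f (Suc (steps (p - l))) l p = 0" using K a N_pos by auto
    moreover have "kms_defect f (steps (p - l)) (l + N) (p - N) = 0"
    proof -
      have "steps (p - N - (l + N)) \<le> steps (p - l)"
        using N_pos unfolding steps_def by (intro nat_mono zdiv_mono1) auto
      then show ?thesis using K a gap_shift_dvd N_pos by auto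
    qed
    ultimately show "exchange_defect f l p = 0"
      using kms_defect_large[OF a(1,2), of f "steps (p - l)"] a(3) by simp
  qed
  then show ?E by blast
next
  assume E: ?E
  have "\<forall>T\<ge>steps (p - l). kms_defect f T l p = 0" if "l < p" "\<not> N dvd p - l" for l p
  proof (rule all_defects[of "\<lambda>l p. \<forall>T\<ge>steps (p - l). kms_defect f T l p = 0", OF _ _ that])
    fix l p assume "l < p" "p - l < 2 * N" "\<not> N dvd p - l"
    then show "\<forall>T\<ge>steps (p - l). kms_defect f T l p = 0"
      using kms_defect_small[of l p _ f] E steps_pos[of "p - l"] by fastforce
  next
    fix l p assume a: "p - l > 2 * N" "\<not> N dvd p - l"
      "\<forall>T\<ge>steps (p - N - (l + N)). kms_defect f T (l + N) (p - N) = 0"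
    show "\<forall>T\<ge>steps (p - l). kms_defect f T l p = 0"
    proof (intro allI impI)
      fix T assume T: "steps (p - l) \<le> T"
      have "steps (p - l) = Suc (steps (p - l - N))"
        using a N_pos steps_add[of "p - l - N"] by simp
      then obtain T' where T': "T = Suc T'" "steps (p - l - N) \<le> T'" using T by (cases T) auto
      have "steps (p - N - (l + N)) \<le> steps (p - l - N)"
        using N_pos unfolding steps_def by (intro nat_mono zdiv_mono1) auto
      then have "kms_defect f T' (l + N) (p - N) = 0" using a(3) T' by auto
      then show "kms_defect f T l p = 0"
        using kms_defect_large[OF a(1,2), of f T'] E a gap_shift_dvd N_pos T' by auto
    qed
  qed
  then show ?K by blast
qed

lemma exchange_law_alt:
  "exchange_law f \<longleftrightarrow> (\<forall>a b. N dvd a - b \<longrightarrow> f a b = - f b a) \<and>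
     (\<forall>l p. l < p \<longrightarrow> \<not> N dvd p - l \<longrightarrow> exchange_defect f l p = 0)"
  unfolding exchange_law_def exchange_defect_def diff_diff_eq right_minus_eq ..

section \<open>Functionals that respect the relations of the Fock space\<close>

definition local :: "(wedge_seq \<Rightarrow> complex) \<Rightarrow> wedge_seq \<Rightarrow> nat \<Rightarrow> int \<Rightarrow> int \<Rightarrow> complex" where
  "local \<phi> s j a b = \<phi> (s(j := a, Suc j := b))"

lemma local_update: "local \<phi> (s(j := a, Suc j := b)) j = local \<phi> s j"
  by (intro ext) (simp add: local_def fun_upd_twist)

lemma local_self: "local \<phi> s j (s j) (s (Suc j)) = \<phi> s"
  by (simp add: local_def)

text \<open>The terms with t \<ge> \<open>steps (p - l)\<close> are discarded by
  \<open>kept\<close>, so the sum over all t is a truncated series.\<close>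

lemma pair_exchange:
  assumes "l = s j" "p = s (Suc j)" "T \<ge> steps (p - l)"
  shows "pair \<phi> (exchange n v g s j)
     = g (l - p) * kept_term (local \<phi> s j) p l + (v - 1) * kms_series (local \<phi> s j) T l p"
proof -
  have K: "pair \<phi> (kept s j a b) = kept_term (local \<phi> s j) a b" for a b
    by (simp add: kept_def kept_term_def local_def)
  define G where "G t = wscale (v ^ t) (kept s j (p - int t * N - (p - l) mod N) (l + int t * N + (p - l) mod N)
             + wscale (g (l - p)) (kept s j (p - (int t + 1) * N) (l + (int t + 1) * N)))" for t :: nat
  have G0: "G t = 0" if "t \<ge> T" for t
  proof -
    have "int t * N \<ge> p - l" using that assms(3) less_steps[of t "p - l"] by auto
    moreover have "int t * N \<ge> 0" "(p - l) mod N \<ge> 0" "(int t + 1) * N = int t * N + N"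
      using N_pos by (auto simp: distrib_right)
    ultimately have "\<not> p - int t * N - (p - l) mod N > l + int t * N + (p - l) mod N"
      "\<not> p - (int t + 1) * N > l + (int t + 1) * N" using N_pos by linarith+
    then show ?thesis by (simp add: G_def kept_def)
  qed
  have "{t. G t \<noteq> 0} \<subseteq> {..<T}"
  proof
    fix t assume "t \<in> {t. G t \<noteq> 0}"
    then show "t \<in> {..<T}" using G0[of t] by (cases "T \<le> t") auto
  qed
  then have "Sum_any G = (\<Sum>t<T. G t)"
    by (intro Sum_any.expand_superset) auto
  then have "pair \<phi> (Sum_any G) = kms_series (local \<phi> s j) T l p"
    by (simp add: pair_sum G_def pair_wscale pair_add K kms_series_def)
  moreover have "exchange n v g s j = wscale (g (l - p)) (kept s j p l) + wscale (v - 1) (Sum_any G)"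
    unfolding exchange_def Let_def assms(1,2) G_def ..
  ultimately show ?thesis by (simp add: pair_add pair_wscale K)
qed

text \<open>The dual of the Fock space of level m, realized by functions on all sequences. Values
  outside \<open>semi_infinite m\<close> are unconstrained, which is why the congruence lemmas ask
  for agreement on \<open>semi_infinite m\<close> only.\<close>

definition ann :: "int \<Rightarrow> (wedge_seq \<Rightarrow> complex) set" where
  "ann m = {\<phi>. \<forall>x\<in>relators n v g m. pair \<phi> x = 0}"

text \<open>The place (s, j) depends on the relator alone and not on \<phi>: in the proof of
  independence a functional has to obey the law only at the finitely many places of the relators
  involved.\<close>

lemma relator_killed:
  assumes "x \<in> relators n v g m"
  obtains s j where "s \<in> semi_infinite m" "\<And>\<phi>. exchange_law (local \<phi> s j) \<Longrightarrow> pair \<phi> x = 0"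
proof -
  from assms consider (1) s j where "x = monomial s + monomial (s(j := s (Suc j), Suc j := s j))"
      "s \<in> semi_infinite m" "s j mod N = s (Suc j) mod N"
    | (2) s j where "x = monomial s - exchange n v g s j"
      "s \<in> semi_infinite m" "s j < s (Suc j)" "s j mod N \<noteq> s (Suc j) mod N"
    unfolding relators_def by blast
  then show thesis
  proof cases
    case 1
    have "pair \<phi> x = 0" if E: "exchange_law (local \<phi> s j)" for \<phi>
    proof -
      have "local \<phi> s j (s j) (s (Suc j)) = - local \<phi> s j (s (Suc j)) (s j)"
        using E 1 unfolding exchange_law_def by (auto simp: mod_eq_dvd_iff)
      then show ?thesis using 1 by (simp add: pair_add local_self) (simp add: local_def)
    qed
    with 1(2) show thesis by (rule that)
  next
    case 2
    have "pair \<phi> x = 0" if E: "exchange_law (local \<phi> s j)" for \<phi>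
    proof -
      let ?l = "s j" and ?p = "s (Suc j)" and ?f = "local \<phi> s j"
      have "\<not> N dvd ?p - ?l" using 2(4) by (metis mod_eq_dvd_iff)
      then have "kms_defect ?f (steps (?p - ?l)) ?l ?p = 0"
        using kms_defect_iff[of ?f] E 2(3) unfolding exchange_law_alt by blast
      moreover have "kept_term ?f ?p ?l = ?f ?p ?l" using 2(3) by (simp add: kept_term_def)
      moreover have "?f ?l ?p = \<phi> s" by (rule local_self)
      ultimately show ?thesis unfolding 2(1) pair_diff pair_exchange[of ?l s j ?p "steps (?p - ?l)" \<phi>, OF refl refl order_refl]
        by (simp add: kms_defect_def diff_diff_eq)
    qed
    with 2(2) show thesis by (rule that)
  qed
qed

lemma ann_iff: "\<phi> \<in> ann m \<longleftrightarrow> (\<forall>s\<in>semi_infinite m. \<forall>j. exchange_law (local \<phi> s j))"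
proof
  assume A: "\<phi> \<in> ann m"
  show "\<forall>s\<in>semi_infinite m. \<forall>j. exchange_law (local \<phi> s j)"
  proof (intro ballI allI)
    fix s j assume s: "s \<in> semi_infinite m"
    let ?f = "local \<phi> s j"
    have "?f a b = - ?f b a" if "N dvd a - b" for a b
    proof -
      let ?s = "s(j := a, Suc j := b)"
      have "monomial ?s + monomial (?s(j := ?s (Suc j), Suc j := ?s j)) \<in> relators n v g m"
        unfolding relators_def using that s semi_infinite_update
        by (intro UnI1 CollectI exI[of _ ?s] exI[of _ j]) (auto simp: mod_eq_dvd_iff)
      then have "pair \<phi> (monomial ?s + monomial (?s(j := ?s (Suc j), Suc j := ?s j))) = 0"
        using A unfolding ann_def by blast
      then show ?thesis by (simp add: pair_add local_def fun_upd_twist eq_neg_iff_add_eq_0)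
    qed
    moreover have "kms_defect ?f T l p = 0" if "l < p" "\<not> N dvd p - l" "T \<ge> steps (p - l)" for l p T
    proof -
      let ?s = "s(j := l, Suc j := p)"
      have "\<not> N dvd l - p" using that(2) by (metis dvd_minus_iff minus_diff_eq)
      then have "monomial ?s - exchange n v g ?s j \<in> relators n v g m"
        unfolding relators_def using that s semi_infinite_update
        by (intro UnI2 CollectI exI[of _ ?s] exI[of _ j]) (auto simp: mod_eq_dvd_iff)
      then have "pair \<phi> (monomial ?s - exchange n v g ?s j) = 0"
        using A unfolding ann_def by blast
      moreover have "pair \<phi> (exchange n v g ?s j) = g (l - p) * kept_term ?f p l + (v - 1) * kms_series ?f T l p"
        using pair_exchange[of l ?s j p T \<phi>] that(3) by (simp add: local_update)
      ultimately show ?thesis using that(1)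
        by (simp add: pair_diff kms_defect_def kept_term_def local_def)
    qed
    ultimately show "exchange_law ?f"
      using kms_defect_iff[of ?f] unfolding exchange_law_alt by blast
  qed
next
  assume A: "\<forall>s\<in>semi_infinite m. \<forall>j. exchange_law (local \<phi> s j)"
  show "\<phi> \<in> ann m" unfolding ann_def
    using A by (auto elim: relator_killed)
qed

lemma ann_R: "\<phi> \<in> ann m \<Longrightarrow> s \<in> semi_infinite m \<Longrightarrow> R (local \<phi> s j) l p = - v * local \<phi> s j l p"
  using ann_iff exchange_law_iff_R by blast

lemma ann_iff_R:
  "\<phi> \<in> ann m \<longleftrightarrow> (\<forall>s\<in>semi_infinite m. \<forall>j l p. R (local \<phi> s j) l p = - v * local \<phi> s j l p)"
  using ann_iff exchange_law_iff_R by blast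

end

section \<open>Independence of the normal-ordered wedges\<close>

context fock_params begin

section \<open>The braid relation on three indices\<close>

definition R12 :: "(int \<Rightarrow> int \<Rightarrow> int \<Rightarrow> complex) \<Rightarrow> int \<Rightarrow> int \<Rightarrow> int \<Rightarrow> complex" where
  "R12 F a b c = R (\<lambda>x y. F x y c) a b"

definition R23 :: "(int \<Rightarrow> int \<Rightarrow> int \<Rightarrow> complex) \<Rightarrow> int \<Rightarrow> int \<Rightarrow> int \<Rightarrow> complex" where
  "R23 F a b c = R (\<lambda>y z. F a y z) b c"

lemma R12_shift:
  "R12 F (a + N) b c = R12 (\<lambda>x y z. F x (y + N) z) a b c + (v - 1) * F a (b + N) c"
  "R12 F a (b + N) c = R12 (\<lambda>x y z. F (x + N) y z) a b c - (v - 1) * F a (b + N) c"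
  "R12 F a b (c + N) = R12 (\<lambda>x y z. F x y (z + N)) a b c"
  unfolding R12_def by (simp_all only: R_bernstein1[of _ a] R_bernstein2[of _ a b])

lemma R23_shift:
  "R23 F a (b + N) c = R23 (\<lambda>x y z. F x y (z + N)) a b c + (v - 1) * F a b (c + N)"
  "R23 F a b (c + N) = R23 (\<lambda>x y z. F x (y + N) z) a b c - (v - 1) * F a b (c + N)"
  "R23 F (a + N) b c = R23 (\<lambda>x y z. F (x + N) y z) a b c"
  unfolding R23_def by (simp_all only: R_bernstein1[of _ b] R_bernstein2[of _ b c])

lemma R12_linear:
  "R12 (\<lambda>x y z. F x y z + G x y z) a b c = R12 F a b c + R12 G a b c"
  "R12 (\<lambda>x y z. F x y z - G x y z) a b c = R12 F a b c - R12 G a b c"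
  "R12 (\<lambda>x y z. k * F x y z) a b c = k * R12 F a b c"
  unfolding R12_def by (simp_all only: R_add R_diff R_scale)

lemma R23_linear:
  "R23 (\<lambda>x y z. F x y z + G x y z) a b c = R23 F a b c + R23 G a b c"
  "R23 (\<lambda>x y z. F x y z - G x y z) a b c = R23 F a b c - R23 G a b c"
  "R23 (\<lambda>x y z. k * F x y z) a b c = k * R23 F a b c"
  unfolding R23_def by (simp_all only: R_add R_diff R_scale)

lemma R12_quadratic: "R12 (R12 F) a b c = v * F a b c - (v - 1) * R12 F a b c"
  unfolding R12_def by (rule R_quadratic)

lemma R23_quadratic: "R23 (R23 F) a b c = v * F a b c - (v - 1) * R23 F a b c"
  unfolding R23_def by (rule R_quadratic)

definition braid_defect where
  "braid_defect F a b c = R12 (R23 (R12 F)) a b c - R23 (R12 (R23 F)) a b c"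

lemmas braid_simps = R12_shift R23_shift R12_linear R23_linear R12_quadratic R23_quadratic

text \<open>Both words of the braid relation reverse the order of the three indices, so a shift of
  the first index comes out as a shift of the third argument. The Bernstein corrections of the two
  words agree modulo the quadratic relation.\<close>

lemma braid_defect_shift:
  "braid_defect F (a + N) b c = braid_defect (\<lambda>x y z. F x y (z + N)) a b c"
  "braid_defect F a (b + N) c = braid_defect (\<lambda>x y z. F x (y + N) z) a b c"
  "braid_defect F a b (c + N) = braid_defect (\<lambda>x y z. F (x + N) y z) a b c"
  unfolding braid_defect_def braid_simps by algebra+

lemma R12_near: "\<bar>a - b\<bar> < N \<Longrightarrow> R12 F a b c =
    (if a = b then F a a c else - g (a - b) * F b a c - (if a < b then (v - 1) * F a b c else 0))"
  unfolding R12_def by (rule R_near)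

lemma R23_near: "\<bar>b - c\<bar> < N \<Longrightarrow> R23 F a b c =
    (if b = c then F a b b else - g (b - c) * F a c b - (if b < c then (v - 1) * F a b c else 0))"
  unfolding R23_def by (rule R_near)

text \<open>All differences are below N, so each weak ordering of a, b, c gives an identity of
  polynomials in v and the factors g, with g(x - y) g(y - x) = v as the only input.\<close>

lemma braid_defect_base:
  assumes "0 \<le> a" "a < N" "0 \<le> b" "b < N" "0 \<le> c" "c < N"
  shows "braid_defect F a b c = 0"
proof -
  have near: "\<bar>a - b\<bar> < N" "\<bar>b - a\<bar> < N" "\<bar>a - c\<bar> < N" "\<bar>c - a\<bar> < N" "\<bar>b - c\<bar> < N" "\<bar>c - b\<bar> < N"
    using assms by auto
  have gg: "x \<noteq> y \<longrightarrow> g (x - y) * g (y - x) = v" if "\<bar>x - y\<bar> < N" for x y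
    using g_inverse[of "x - y"] not_dvd_near[of x y] that by simp
  note swap = near[THEN R12_near] near[THEN R23_near]
  have diag: "R12 F x x z = F x x z" "R23 F z x x = F z x x" for F x z
    using N_pos by (simp_all add: R12_near R23_near)
  show ?thesis unfolding braid_defect_def
    by (cases a b rule: linorder_cases; cases b c rule: linorder_cases; cases a c rule: linorder_cases;
        (linarith | (insert near[THEN gg]; simp add: swap diag; simp add: algebra_simps)))
qed

lemma braid_defect_zero: "braid_defect F a b c = 0"
proof -
  have c: "(\<forall>F. braid_defect F a b (c + N) = 0) = (\<forall>F. braid_defect F a b c = 0)" for a b c
    using braid_defect_shift(3)[of "\<lambda>x y z. G (x - N) y z" a b c for G] braid_defect_shift(3)[of _ a b c] by fastforce
  have b: "(\<forall>F. braid_defect F a (b + N) c = 0) = (\<forall>F. braid_defect F a b c = 0)" for a b c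
    using braid_defect_shift(2)[of "\<lambda>x y z. G x (y - N) z" a b c for G] braid_defect_shift(2)[of _ a b c] by fastforce
  have a: "(\<forall>F. braid_defect F (a + N) b c = 0) = (\<forall>F. braid_defect F a b c = 0)" for a b c
    using braid_defect_shift(1)[of "\<lambda>x y z. G x y (z - N)" a b c for G] braid_defect_shift(1)[of _ a b c] by fastforce
  have "\<forall>F. braid_defect F a b c = 0"
    apply (rule residue_induct[of "\<lambda>a. \<forall>F. braid_defect F a b c = 0", OF a])
    apply (rule residue_induct[of "\<lambda>b. \<forall>F. braid_defect F _ b c = 0", OF b])
    apply (rule residue_induct[of "\<lambda>c. \<forall>F. braid_defect F _ _ c = 0", OF c])
    apply (simp add: braid_defect_base)
    done
  then show ?thesis by blast
qed

lemma braid3: "R12 (R23 (R12 F)) = R23 (R12 (R23 F))"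
  using braid_defect_zero[of F] unfolding braid_defect_def by (intro ext) simp

section \<open>Hecke action on functionals of wedges, and partial antisymmetrizers\<close>

definition H :: "nat \<Rightarrow> (wedge_seq \<Rightarrow> complex) \<Rightarrow> wedge_seq \<Rightarrow> complex" where
  "H j \<phi> s = R (local \<phi> s j) (s j) (s (Suc j))"

definition local3 :: "(wedge_seq \<Rightarrow> complex) \<Rightarrow> wedge_seq \<Rightarrow> nat \<Rightarrow> int \<Rightarrow> int \<Rightarrow> int \<Rightarrow> complex" where
  "local3 \<phi> s j a b c = \<phi> (s(j := a, Suc j := b, Suc (Suc j) := c))"

lemma local_H: "local (H j \<phi>) s j = R (local \<phi> s j)"
proof (intro ext)
  fix a b
  show "local (H j \<phi>) s j a b = R (local \<phi> s j) a b"
    unfolding local_def[of "H j \<phi>"] H_def local_update by simp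
qed

lemma H_quadratic: "H j (H j \<phi>) s = v * \<phi> s - (v - 1) * H j \<phi> s"
  unfolding H_def[of j "H j \<phi>"] local_H R_quadratic by (simp add: H_def local_self)

lemma local3_H: "local3 (H j \<phi>) s j = R12 (local3 \<phi> s j)"
proof (intro ext)
  fix a b c
  have "local \<phi> (s(j := a, Suc j := b, Suc (Suc j) := c)) j x y = local3 \<phi> s j x y c" for x y
    unfolding local_def local3_def by (rule arg_cong[where f = \<phi>]) (auto simp: fun_eq_iff)
  then have "local \<phi> (s(j := a, Suc j := b, Suc (Suc j) := c)) j = (\<lambda>x y. local3 \<phi> s j x y c)" by (intro ext)
  then show "local3 (H j \<phi>) s j a b c = R12 (local3 \<phi> s j) a b c"
    unfolding local3_def[of "H j \<phi>"] H_def R12_def by simp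
qed

lemma local3_H_Suc: "local3 (H (Suc j) \<phi>) s j = R23 (local3 \<phi> s j)"
proof (intro ext)
  fix a b c
  have "local \<phi> (s(j := a, Suc j := b, Suc (Suc j) := c)) (Suc j) x y = local3 \<phi> s j a x y" for x y
    unfolding local_def local3_def by (rule arg_cong[where f = \<phi>]) (auto simp: fun_eq_iff)
  then have "local \<phi> (s(j := a, Suc j := b, Suc (Suc j) := c)) (Suc j) = (\<lambda>x y. local3 \<phi> s j a x y)" by (intro ext)
  then show "local3 (H (Suc j) \<phi>) s j a b c = R23 (local3 \<phi> s j) a b c"
    unfolding local3_def[of "H (Suc j) \<phi>"] H_def R23_def by simp
qed

lemma H_braid: "H j (H (Suc j) (H j \<phi>)) = H (Suc j) (H j (H (Suc j) \<phi>))"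
proof
  fix s
  have self: "\<psi> s = local3 \<psi> s j (s j) (s (Suc j)) (s (Suc (Suc j)))" for \<psi> by (simp add: local3_def)
  show "H j (H (Suc j) (H j \<phi>)) s = H (Suc j) (H j (H (Suc j) \<phi>)) s"
    unfolding self[of "H j _"] self[of "H (Suc j) _"] local3_H local3_H_Suc braid3 ..
qed

text \<open>\<open>R\<close> is a finite linear combination of values whose coefficients depend on
  the indices only, so it passes through \<open>R\<close> in the other pair of variables.\<close>

lemma R_R_commute: "R (\<lambda>a b. R (\<lambda>c d. F a b c d) r q) l p = R (\<lambda>c d. R (\<lambda>a b. F a b c d) l p) r q"
proof (cases r q rule: linorder_cases)
  case less
  then have inner: "R h r q = (if N dvd q - r then 1 else - g (r - q)) * h q r
        - (v - 1) * (\<Sum>d<steps (q - r). h (r + int d * N) (q - int d * N))" for h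
    by (simp add: R_def)
  show ?thesis unfolding inner R_diff R_scale R_sum ..
next
  case equal
  then show ?thesis by (simp add: R_def[of _ q q])
next
  case greater
  then have inner: "R h r q = - g (r - q) * h q r
        + (v - 1) * (\<Sum>d\<in>{1..<steps (r - q)}. h (r - int d * N) (q + int d * N))" for h
    by (simp add: R_def)
  show ?thesis unfolding inner R_add R_scale R_sum ..
qed

lemma H_commute:
  assumes "Suc j < i"
  shows "H i (H j \<phi>) = H j (H i \<phi>)"
proof
  fix s
  let ?F = "\<lambda>a b c d. \<phi> (s(j := a, Suc j := b, i := c, Suc i := d))"
  have A: "local (H j \<phi>) s i c d = R (\<lambda>a b. ?F a b c d) (s j) (s (Suc j))" for c d
  proof -
    have "local \<phi> (s(i := c, Suc i := d)) j = (\<lambda>a b. ?F a b c d)"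
      unfolding local_def using assms
      by (intro ext arg_cong[where f = \<phi>]) (auto simp: fun_eq_iff)
    then show ?thesis unfolding local_def[of "H j \<phi>"] H_def using assms by simp
  qed
  have B: "local (H i \<phi>) s j a b = R (\<lambda>c d. ?F a b c d) (s i) (s (Suc i))" for a b
  proof -
    have "local \<phi> (s(j := a, Suc j := b)) i = (\<lambda>c d. ?F a b c d)"
      unfolding local_def ..
    then show ?thesis unfolding local_def[of "H i \<phi>"] H_def using assms by simp
  qed
  have "local (H j \<phi>) s i = (\<lambda>c d. R (\<lambda>a b. ?F a b c d) (s j) (s (Suc j)))"
    "local (H i \<phi>) s j = (\<lambda>a b. R (\<lambda>c d. ?F a b c d) (s i) (s (Suc i)))"
    using A B by (intro ext, simp)+
  then show "H i (H j \<phi>) s = H j (H i \<phi>) s"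
    unfolding H_def[of i "H j \<phi>"] H_def[of j "H i \<phi>"] by (simp only:) (rule R_R_commute[symmetric])
qed

lemma H_scale: "H j (\<lambda>s. c * \<phi> s) s = c * H j \<phi> s"
  unfolding H_def local_def by (rule R_scale)

lemma H_scale_fun: "H j (\<lambda>s. c * \<phi> s) = (\<lambda>s. c * H j \<phi> s)"
  by (intro ext) (rule H_scale)

lemma H_sum: "H j (\<lambda>s. \<Sum>i\<in>I. F i s) s = (\<Sum>i\<in>I. H j (F i) s)"
  unfolding H_def local_def by (rule R_sum)

text \<open>Demanded on all sequences and not only on semi-infinite ones, since the antisymmetrizers
  are built from point functionals without reference to a level.\<close>

definition eigen :: "nat \<Rightarrow> (wedge_seq \<Rightarrow> complex) \<Rightarrow> bool" where
  "eigen j \<phi> \<longleftrightarrow> H j \<phi> = (\<lambda>s. - v * \<phi> s)"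

text \<open>The antisymmetrizer of r + 1 positions is obtained from that of r positions by an alternating sum
  over coset representatives.\<close>

function lowering :: "nat \<Rightarrow> (wedge_seq \<Rightarrow> complex) \<Rightarrow> nat \<Rightarrow> wedge_seq \<Rightarrow> complex" where
  "lowering r \<phi> k = (if k < r then H k (lowering r \<phi> (Suc k)) else \<phi>)"
  by pat_completeness auto
termination by (relation "measure (\<lambda>(r, \<phi>, k). r - k)") auto

declare lowering.simps [simp del]

lemma lowering_less: "k < r \<Longrightarrow> lowering r \<phi> k = H k (lowering r \<phi> (Suc k))"
  by (simp add: lowering.simps[of r \<phi> k])

lemma lowering_self: "lowering r \<phi> r = \<phi>"
  by (simp add: lowering.simps)

lemma eigen_H: "eigen j \<phi> \<Longrightarrow> H k (H j \<phi>) = H j (H k \<phi>) \<Longrightarrow> eigen j (H k \<phi>)"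
proof -
  assume e: "eigen j \<phi>" and c: "H k (H j \<phi>) = H j (H k \<phi>)"
  have "H j (H k \<phi>) = H k (\<lambda>s. - v * \<phi> s)" using e c unfolding eigen_def by simp
  then show "eigen j (H k \<phi>)" unfolding eigen_def H_scale_fun .
qed

text \<open>H_j commutes with every H_i for i \<ge> k > j + 1, and so reaches \<phi>
  unchanged.\<close>

lemma lowering_eigen_below:
  assumes "\<And>j. Suc j < r \<Longrightarrow> eigen j \<phi>" "k \<le> r" "Suc j < k"
  shows "eigen j (lowering r \<phi> k)"
  using assms(2,3)
proof (induction k rule: inc_induct)
  case base
  then show ?case using assms(1) by (simp add: lowering_self)
next
  case (step k)
  have "eigen j (lowering r \<phi> (Suc k))" using step by simp
  then show ?case using step eigen_H[of j _ k] H_commute[of j k] by (simp add: lowering_less)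
qed

text \<open>\<open>lowering r \<phi> k\<close> is H_k ... H_(r-1) \<phi>. For k < j, H_j commutes
  past the factors up to H_(j-2); the braid relation turns H_j H_(j-1) H_j into H_(j-1) H_j H_(j-1),
  and the last H_(j-1) then commutes through to \<phi>.\<close>

lemma lowering_eigen_above:
  assumes hyp: "\<And>j. Suc j < r \<Longrightarrow> eigen j \<phi>" and "j < r" "k < j"
  shows "eigen j (lowering r \<phi> k)"
proof -
  have "k \<le> j - 1" using assms by simp
  then show ?thesis
  proof (induction k rule: inc_induct)
    case base
    define i where "i = j - 1"
    have ij: "j = Suc i" using assms(3) i_def by simp
    define P where "P = lowering r \<phi> (Suc j)"
    have e: "eigen i P" unfolding P_def using assms(2) ij by (intro lowering_eigen_below hyp) auto
    have "lowering r \<phi> i = H i (H (Suc i) P)"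
      using assms(2) ij by (simp add: lowering_less P_def)
    moreover have "H (Suc i) (H i (H (Suc i) P)) = H i (H (Suc i) (H i P))" using H_braid by metis
    ultimately have "H (Suc i) (lowering r \<phi> i) = H i (H (Suc i) (\<lambda>s. - v * P s))"
      using e unfolding eigen_def by simp
    then have "H (Suc i) (lowering r \<phi> i) = (\<lambda>s. - v * lowering r \<phi> i s)"
      unfolding H_scale_fun \<open>lowering r \<phi> i = _\<close> .
    then show ?case unfolding eigen_def ij by simp
  next
    case (step k)
    have "eigen j (lowering r \<phi> (Suc k))" using step by simp
    then show ?case using step assms eigen_H[of j _ k] H_commute[of k j] by (simp add: lowering_less)
  qed
qed

definition antisym_step :: "nat \<Rightarrow> (wedge_seq \<Rightarrow> complex) \<Rightarrow> wedge_seq \<Rightarrow> complex" where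
  "antisym_step r \<phi> s = (\<Sum>k\<le>r. (- 1) ^ (r - k) * lowering r \<phi> k s)"

text \<open>H_j + v annihilates every summand except those with k = j and k = j + 1. These two are
  H_j P and P for the same P, with opposite signs, and (H_j + v)(H_j - 1) = 0.\<close>

lemma antisym_step_eigen:
  assumes "\<And>j. Suc j < r \<Longrightarrow> eigen j \<phi>" "j < r"
  shows "eigen j (antisym_step r \<phi>)"
proof -
  let ?P = "lowering r \<phi>"
  have "H j (antisym_step r \<phi>) s + v * antisym_step r \<phi> s = 0" for s
  proof -
    let ?T = "\<lambda>k. (- 1) ^ (r - k) * (H j (?P k) s + v * ?P k s)"
    have "H j (antisym_step r \<phi>) s + v * antisym_step r \<phi> s = (\<Sum>k\<le>r. ?T k)"
      unfolding antisym_step_def H_sum H_scale sum_distrib_left sum.distrib[symmetric]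
      by (simp add: algebra_simps)
    also have "\<dots> = (\<Sum>k\<in>{j, Suc j}. ?T k)"
    proof (rule sum.mono_neutral_right)
      show "\<forall>k\<in>{..r} - {j, Suc j}. ?T k = 0"
      proof
        fix k assume "k \<in> {..r} - {j, Suc j}"
        then have k: "k \<le> r" "k < j \<or> Suc j < k" by auto
        then have "eigen j (?P k)"
          using lowering_eigen_below[OF assms(1), where j = j and k = k]
            lowering_eigen_above[OF assms(1) assms(2), where k = k] by auto
        then show "?T k = 0" unfolding eigen_def by simp
      qed
    qed (use assms in auto)
    also have "\<dots> = ?T j + ?T (Suc j)" by simp
    also have "\<dots> = 0"
    proof -
      have "?P j = H j (?P (Suc j))" using assms(2) by (rule lowering_less)
      moreover have "(- 1::complex) ^ (r - j) = - ((- 1) ^ (r - Suc j))"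
        using assms(2) by (simp add: Suc_diff_Suc[symmetric])
      ultimately show ?thesis by (simp add: H_quadratic algebra_simps)
    qed
    finally show ?thesis .
  qed
  then show ?thesis unfolding eigen_def by (auto simp: fun_eq_iff eq_neg_iff_add_eq_0)
qed

primrec antisym :: "nat \<Rightarrow> (wedge_seq \<Rightarrow> complex) \<Rightarrow> wedge_seq \<Rightarrow> complex" where
  "antisym 0 \<phi> = \<phi>"
| "antisym (Suc r) \<phi> = antisym_step r (antisym r \<phi>)"

lemma antisym_eigen: "Suc j < r \<Longrightarrow> eigen j (antisym r \<phi>)"
  by (induction r arbitrary: j) (auto intro: antisym_step_eigen)

section \<open>Triangularity of the antisymmetrized point functionals\<close>

text \<open>The value of \<open>H j \<phi>\<close> at s involves only the swap of s and pairs moved closer together, which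
  lowers the sum of squares.  So the antisymmetrized point functional at t lives on rearrangements of
  t and on wedges with a larger sum of squares, and these functionals are triangular.\<close>

definition sq_sum :: "nat \<Rightarrow> wedge_seq \<Rightarrow> int" where
  "sq_sum M s = (\<Sum>i<M. (s i)\<^sup>2)"

lemma sq_sum_update:
  assumes "Suc j < M"
  shows "sq_sum M (s(j := a, Suc j := b)) = sq_sum M s - (s j)\<^sup>2 - (s (Suc j))\<^sup>2 + a\<^sup>2 + b\<^sup>2"
proof -
  have split: "sq_sum M t = (t j)\<^sup>2 + (t (Suc j))\<^sup>2 + (\<Sum>i\<in>{..<M} - {j, Suc j}. (t i)\<^sup>2)" for t
  proof -
    have "{j, Suc j} \<subseteq> {..<M}" using assms by auto
    then show ?thesis
      using sum.subset_diff[of "{j, Suc j}" "{..<M}" "\<lambda>i. (t i)\<^sup>2"] by (simp add: sq_sum_def)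
  qed
  have "(\<Sum>i\<in>{..<M} - {j, Suc j}. ((s(j := a, Suc j := b)) i)\<^sup>2) = (\<Sum>i\<in>{..<M} - {j, Suc j}. (s i)\<^sup>2)"
    by (intro sum.cong) auto
  then show ?thesis unfolding split[of "s(j := a, Suc j := b)"] split[of s] by simp
qed

lemma inner_squares:
  assumes "0 < e" "e < (x::int) - y"
  shows "(x - e)\<^sup>2 + (y + e)\<^sup>2 < x\<^sup>2 + y\<^sup>2"
proof -
  have "e * e < e * (x - y)" using assms by (intro mult_strict_left_mono) auto
  then show ?thesis by (simp add: power2_eq_square algebra_simps)
qed

text \<open>The unswapped value f l p contributes only for l \<le> p, because the sum in
  \<open>R\<close> starts at d = 1 when p < l. This asymmetry makes the antisymmetrizers triangular
  on decreasing sequences.\<close>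

lemma R_cases:
  assumes "R f l p \<noteq> 0"
  obtains (swap) "f p l \<noteq> 0" | (same) "f l p \<noteq> 0" "l \<le> p"
    | (inner) a b where "f a b \<noteq> 0" "a\<^sup>2 + b\<^sup>2 < l\<^sup>2 + p\<^sup>2"
proof (cases l p rule: linorder_cases)
  case equal
  then show ?thesis using assms same by (simp add: R_def)
next
  case greater
  show ?thesis
  proof (rule ccontr)
    assume not: "\<not> thesis"
    have "f (l - int d * N) (p + int d * N) = 0" if "d \<in> {1..<steps (l - p)}" for d
    proof (rule ccontr)
      assume "f (l - int d * N) (p + int d * N) \<noteq> 0"
      moreover have "0 < int d * N" "int d * N < l - p" using that less_steps N_pos by auto
      ultimately show False using inner inner_squares[of "int d * N" l p] not by blast
    qed
    then show False using assms swap greater not by (auto simp: R_def)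
  qed
next
  case less
  show ?thesis
  proof (rule ccontr)
    assume not: "\<not> thesis"
    have "f (l + int d * N) (p - int d * N) = 0" if "d < steps (p - l)" for d
    proof (cases "d = 0")
      case True
      then show ?thesis using same less not by auto
    next
      case False
      show ?thesis
      proof (rule ccontr)
        assume "f (l + int d * N) (p - int d * N) \<noteq> 0"
        moreover have "0 < int d * N" "int d * N < p - l" using that False less_steps N_pos by auto
        ultimately show False using inner inner_squares[of "int d * N" p l] not by (metis add.commute)
      qed
    qed
    then show False using assms swap less not by (auto simp: R_def split: if_splits)
  qed
qed

lemma H_cases:
  assumes "H j \<phi> s \<noteq> 0" "Suc j < M"
  obtains (swap) "\<phi> (s(j := s (Suc j), Suc j := s j)) \<noteq> 0" | (same) "\<phi> s \<noteq> 0" "s j \<le> s (Suc j)"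
    | (inner) s' where "\<phi> s' \<noteq> 0" "sq_sum M s' < sq_sum M s"
proof -
  from assms(1) have "R (local \<phi> s j) (s j) (s (Suc j)) \<noteq> 0" by (simp add: H_def)
  then show ?thesis
  proof (cases rule: R_cases)
    case swap
    then show ?thesis using that(1) by (simp add: local_def)
  next
    case same
    then show ?thesis using that(2) by (simp add: local_def)
  next
    case (inner a b)
    then show ?thesis using that(3)[of "s(j := a, Suc j := b)"] sq_sum_update[OF assms(2), of s a b]
      by (simp add: local_def)
  qed
qed

text \<open>At r = 0 this holds for the point functional at t; each antisymmetrization step frees
  one more position.\<close>

definition supported :: "nat \<Rightarrow> nat \<Rightarrow> wedge_seq \<Rightarrow> (wedge_seq \<Rightarrow> complex) \<Rightarrow> bool" where
  "supported M r t \<phi> \<longleftrightarrow> (\<forall>s. \<phi> s \<noteq> 0 \<longrightarrow> sq_sum M t < sq_sum M s \<or>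
     (sq_sum M s = sq_sum M t \<and> s ` {..<r} = t ` {..<r} \<and> (\<forall>i\<ge>r. s i = t i)))"

lemma supported_H:
  assumes "supported M r t \<phi>" "Suc j < r" "r \<le> M"
  shows "supported M r t (H j \<phi>)"
  unfolding supported_def
proof (intro allI impI)
  fix s assume nz: "H j \<phi> s \<noteq> 0"
  have jM: "Suc j < M" using assms by simp
  from nz jM show "sq_sum M t < sq_sum M s \<or>
     (sq_sum M s = sq_sum M t \<and> s ` {..<r} = t ` {..<r} \<and> (\<forall>i\<ge>r. s i = t i))"
  proof (cases rule: H_cases)
    case swap
    let ?s = "s(j := s (Suc j), Suc j := s j)"
    have q: "sq_sum M ?s = sq_sum M s" by (simp add: sq_sum_update[OF jM])
    have im: "?s ` {..<r} = s ` {..<r}"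
    proof -
      let ?B = "{..<r} - {j, Suc j}"
      have r: "{..<r} = insert j (insert (Suc j) ?B)" using assms(2) by auto
      have "?s ` ?B = s ` ?B" by (intro image_cong) auto
      moreover have "?s ` {..<r} = insert (?s j) (insert (?s (Suc j)) (?s ` ?B))"
        "s ` {..<r} = insert (s j) (insert (s (Suc j)) (s ` ?B))"
        by (subst r, simp only: image_insert)+
      ultimately show ?thesis by auto
    qed
    have ag: "\<forall>i\<ge>r. ?s i = s i" using assms(2) by auto
    show ?thesis using assms(1)[unfolded supported_def, rule_format, OF swap] q im ag by auto
  next
    case same
    then show ?thesis using assms(1) unfolding supported_def by blast
  next
    case (inner s')
    then show ?thesis using assms(1)[unfolded supported_def, rule_format, OF inner(1)] by auto
  qed
qed

lemma supported_Suc: "supported M r t \<phi> \<Longrightarrow> supported M (Suc r) t \<phi>"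
  unfolding supported_def by (auto simp: lessThan_Suc)

lemma supported_lowering:
  assumes "supported M r t \<phi>" "r < M" "k \<le> r"
  shows "supported M (Suc r) t (lowering r \<phi> k)"
  using assms(3)
proof (induction k rule: inc_induct)
  case base
  then show ?case using assms supported_Suc by (simp add: lowering_self)
next
  case (step k)
  then show ?case using assms supported_H[of M "Suc r" t _ k] by (simp add: lowering_less)
qed

lemma supported_antisym:
  assumes "supported M 0 t \<phi>"
  shows "r \<le> M \<Longrightarrow> supported M r t (antisym r \<phi>)"
proof (induction r)
  case (Suc r)
  then have IH: "supported M r t (antisym r \<phi>)" by simp
  show ?case unfolding supported_def
  proof (intro allI impI)
    fix s assume "antisym (Suc r) \<phi> s \<noteq> 0"
    then obtain k where "k \<le> r" "lowering r (antisym r \<phi>) k s \<noteq> 0"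
      unfolding antisym.simps antisym_step_def by (metis (mono_tags, lifting) atMost_iff mult_zero_right sum.neutral)
    then show "sq_sum M t < sq_sum M s \<or>
     (sq_sum M s = sq_sum M t \<and> s ` {..<Suc r} = t ` {..<Suc r} \<and> (\<forall>i\<ge>Suc r. s i = t i))"
      using supported_lowering[OF IH] Suc.prems unfolding supported_def by auto
  qed
qed (use assms in simp)

text \<open>If s_k exceeds s_(k+1), ..., s_r, the diagonal and the inner contributions to H_k are
  excluded; only the swap remains and carries the large entry one place to the right. It ends at
  position r, where it would have to equal t_r, the smallest of t_0, ..., t_r, while a smaller entry
  of s would be one of t_0, ..., t_(r-1).\<close>

lemma lowering_vanishes:
  assumes sup: "supported M r t \<phi>" and rM: "r < M"
    and t: "\<And>i j. i < j \<Longrightarrow> j < M \<Longrightarrow> t j < t i"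
    and "k \<le> r"
  shows "k < r \<Longrightarrow> (\<And>i. k < i \<Longrightarrow> i \<le> r \<Longrightarrow> s i < s k) \<Longrightarrow> sq_sum M s \<le> sq_sum M t \<Longrightarrow> lowering r \<phi> k s = 0"
  using assms(4)
proof (induction k arbitrary: s rule: inc_induct)
  case base
  then show ?case by simp
next
  case (step k)
  show ?case
  proof (rule ccontr)
    assume "lowering r \<phi> k s \<noteq> 0"
    then have "H k (lowering r \<phi> (Suc k)) s \<noteq> 0" using step by (simp add: lowering_less)
    moreover have kM: "Suc k < M" using step rM by simp
    ultimately show False
    proof (cases rule: H_cases)
      case swap
      let ?s = "s(k := s (Suc k), Suc k := s k)"
      have q: "sq_sum M ?s = sq_sum M s" by (simp add: sq_sum_update[OF kM])
      show False
      proof (cases "Suc k < r")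
        case True
        have "lowering r \<phi> (Suc k) ?s = 0"
        proof (rule step.IH[OF True])
          show "sq_sum M ?s \<le> sq_sum M t" unfolding q by (rule step.prems(3))
        next
          fix i assume "Suc k < i" "i \<le> r"
          then show "?s i < ?s (Suc k)" using step.prems(2)[of i] by simp
        qed
        then show False using swap by simp
      next
        case False
        then have k: "Suc k = r" using step by simp
        then have "\<phi> ?s \<noteq> 0" using swap by (simp add: lowering_self)
        moreover have "\<not> sq_sum M t < sq_sum M ?s" unfolding q using step.prems(3) by simp
        ultimately have "?s ` {..<r} = t ` {..<r} \<and> (\<forall>i\<ge>r. ?s i = t i)"
          using sup unfolding supported_def by blast
        then have im: "?s ` {..<r} = t ` {..<r}" and ag: "?s r = t r" by blast+
        have "?s k \<in> ?s ` {..<r}" using k by (intro imageI) simp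
        then obtain i where i: "i < r" "t i = ?s k" unfolding im by auto
        have "t r < t i" using t i rM by blast
        moreover have "t r = s k" using ag k by simp
        moreover have "t i = s r" using i k by auto
        moreover have "s r < s k" using step.prems(2)[of r] k by simp
        ultimately show False by simp
      qed
    next
      case same
      then show False using step.prems(2)[of "Suc k"] step.hyps by simp
    next
      case (inner s')
      then have "sq_sum M t \<le> sq_sum M s'"
        using supported_lowering[OF sup rM, of "Suc k"] step.hyps unfolding supported_def by fastforce
      then show False using inner(2) step.prems(3) by simp
    qed
  qed
qed

text \<open>On a decreasing s of no larger sum of squares every summand but the one of the identity
  coset vanishes, so each step leaves the value unchanged.\<close>

lemma antisym_triangular:
  assumes t: "\<And>i j. i < j \<Longrightarrow> j < M \<Longrightarrow> t j < t i"
  shows "r \<le> M \<Longrightarrow> (\<And>i j. i < j \<Longrightarrow> j < r \<Longrightarrow> s j < s i) \<Longrightarrow> sq_sum M s \<le> sq_sum M t \<Longrightarrow>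
     antisym r (\<lambda>s. if s = t then 1 else 0) s = (if s = t then 1 else 0)"
proof (induction r)
  case (Suc r)
  let ?d = "\<lambda>s. if s = t then 1 else (0::complex)"
  let ?A = "antisym r ?d"
  have "supported M 0 t ?d" unfolding supported_def by auto
  then have sup: "supported M r t ?A" using Suc.prems by (intro supported_antisym) auto
  have "lowering r ?A k s = 0" if "k < r" for k
    by (rule lowering_vanishes[OF sup _ t]) (use that Suc.prems in auto)
  then have "antisym (Suc r) ?d s = (\<Sum>k\<in>{r}. (- 1) ^ (r - k) * lowering r ?A k s)"
    unfolding antisym.simps antisym_step_def by (intro sum.mono_neutral_right) auto
  then show ?case using Suc by (simp add: lowering_self)
qed simp

lemma separating_functional:
  assumes "\<And>i j. i < j \<Longrightarrow> j < M \<Longrightarrow> t j < t i"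
  obtains \<psi> where "\<And>j. Suc j < M \<Longrightarrow> eigen j \<psi>"
    "\<And>s. (\<And>i j. i < j \<Longrightarrow> j < M \<Longrightarrow> s j < s i) \<Longrightarrow> sq_sum M s \<le> sq_sum M t \<Longrightarrow>
       \<psi> s = (if s = t then 1 else 0)"
proof (rule that)
  show "eigen j (antisym M (\<lambda>s. if s = t then 1 else 0))" if "Suc j < M" for j
    using that by (rule antisym_eigen)
  show "antisym M (\<lambda>s. if s = t then 1 else 0) s = (if s = t then 1 else 0)"
    if "\<And>i j. i < j \<Longrightarrow> j < M \<Longrightarrow> s j < s i" "sq_sum M s \<le> sq_sum M t" for s
    by (rule antisym_triangular[OF assms order_refl that])
qed

end

section \<open>Functionals on the Fock space\<close>

definition wcons :: "int \<Rightarrow> wedge_seq \<Rightarrow> wedge_seq" where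
  "wcons a s = case_nat a s"

lemma wcons_simps [simp]: "wcons a s 0 = a" "wcons a s (Suc i) = s i"
  by (simp_all add: wcons_def)

lemma wcons_update [simp]:
  "(wcons a s)(0 := b) = wcons b s" "(wcons a s)(Suc j := b) = wcons a (s(j := b))"
  by (auto simp: fun_eq_iff wcons_def split: nat.splits)

lemma wcons_inject [simp]: "wcons a s = wcons b t \<longleftrightarrow> a = b \<and> s = t"
  by (metis wcons_simps ext)

lemma wcons_eta: "wcons (s 0) (\<lambda>i. s (Suc i)) = s"
  by (auto simp: fun_eq_iff wcons_def split: nat.splits)

lemma semi_infinite_wcons: "s \<in> semi_infinite m \<Longrightarrow> wcons a s \<in> semi_infinite (m + 1)"
proof -
  assume "s \<in> semi_infinite m"
  then obtain K where K: "\<forall>i\<ge>K. s i = m - int i" by (auto simp: semi_infinite_def)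
  have "wcons a s i = m + 1 - int i" if "i \<ge> Suc K" for i using that K by (cases i) auto
  then show ?thesis unfolding semi_infinite_def by blast
qed

lemma semi_infinite_tail: "s \<in> semi_infinite (m + 1) \<Longrightarrow> (\<lambda>i. s (Suc i)) \<in> semi_infinite m"
proof -
  assume "s \<in> semi_infinite (m + 1)"
  then obtain K where "\<forall>i\<ge>K. s i = m + 1 - int i" by (auto simp: semi_infinite_def)
  then have "\<forall>i\<ge>K. s (Suc i) = m - int i" by auto
  then show ?thesis unfolding semi_infinite_def by blast
qed

definition vac :: "int \<Rightarrow> wedge_seq" where
  "vac m = (\<lambda>j. m - int j)"

lemma vac_wcons: "vac m = wcons m (vac (m - 1))"
  by (auto simp: fun_eq_iff wcons_def vac_def split: nat.splits)

lemma vac_semi_infinite [simp]: "vac m \<in> semi_infinite m"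
  by (auto simp: vac_def semi_infinite_def)

definition pre :: "nat \<Rightarrow> wedge_seq \<Rightarrow> wedge_seq \<Rightarrow> wedge_seq" where
  "pre i s t = (\<lambda>j. if j < i then s j else t (j - i))"

lemma pre_semi_infinite: "t \<in> semi_infinite (m - int i) \<Longrightarrow> pre i s t \<in> semi_infinite m"
proof -
  assume "t \<in> semi_infinite (m - int i)"
  then obtain K where "\<forall>j\<ge>K. t j = m - int i - int j" by (auto simp: semi_infinite_def)
  then have "\<forall>j\<ge>i + K. pre i s t j = m - int j" by (auto simp: pre_def of_nat_diff)
  then show ?thesis unfolding semi_infinite_def by blast
qed

lemma pre_wcons: "pre i s (wcons a t) = pre (Suc i) (s(i := a)) t"
proof
  fix j
  consider "j < i" | "j = i" | x where "j = Suc (i + x)"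
    using less_imp_Suc_add linorder_neqE_nat by blast
  then show "pre i s (wcons a t) j = pre (Suc i) (s(i := a)) t j"
    by cases (auto simp: pre_def Suc_diff_le)
qed

definition run :: "int \<Rightarrow> nat \<Rightarrow> wedge_seq \<Rightarrow> wedge_seq" where
  "run p k s = pre k (\<lambda>j. p - int j) s"

lemma run_0 [simp]: "run p 0 s = s"
  by (auto simp: run_def pre_def)

lemma run_Suc: "run p (Suc k) s = run p k (wcons (p - int k) s)"
  unfolding run_def pre_wcons by (auto simp: pre_def fun_eq_iff less_Suc_eq)

lemma sum_triangle:
  fixes F :: "nat \<Rightarrow> nat \<Rightarrow> 'a::comm_monoid_add"
  shows "(\<Sum>k\<le>d. \<Sum>e\<le>d - k. F k e) = (\<Sum>D\<le>d. \<Sum>k\<le>D. F k (D - k))"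
proof -
  have "(\<Sum>k\<le>d. \<Sum>e\<le>d - k. F k e) = (\<Sum>(k, e)\<in>(SIGMA k:{..d}. {..d - k}). F k e)"
    by (rule sum.Sigma) auto
  also have "\<dots> = (\<Sum>(D, k)\<in>(SIGMA D:{..d}. {..D}). F k (D - k))"
    by (rule sum.reindex_bij_witness[of _ "\<lambda>(D, k). (k, D - k)" "\<lambda>(k, e). (k + e, k)"]) auto
  also have "\<dots> = (\<Sum>D\<le>d. \<Sum>k\<le>D. F k (D - k))"
    by (rule sum.Sigma[symmetric]) auto
  finally show ?thesis .
qed

lemma sum_triangle_swap:
  fixes F :: "nat \<Rightarrow> nat \<Rightarrow> 'a::comm_monoid_add"
  shows "(\<Sum>k\<le>d. \<Sum>e\<le>d - k. F k e) = (\<Sum>e\<le>d. \<Sum>k\<le>d - e. F k e)"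
proof -
  have "(\<Sum>k\<le>d. \<Sum>e\<le>d - k. F k e) = (\<Sum>(k, e)\<in>(SIGMA k:{..d}. {..d - k}). F k e)"
    by (rule sum.Sigma) auto
  also have "\<dots> = (\<Sum>(e, k)\<in>(SIGMA e:{..d}. {..d - e}). F k e)"
    by (rule sum.reindex_bij_witness[of _ "\<lambda>(e, k). (k, e)" "\<lambda>(k, e). (e, k)"]) auto
  also have "\<dots> = (\<Sum>e\<le>d. \<Sum>k\<le>d - e. F k e)"
    by (rule sum.Sigma[symmetric]) auto
  finally show ?thesis .
qed

text \<open>The sum of all indices, regularized by the vacuum. The constant m (m + 1) / 2 is chosen
  such that prefixing u_a adds exactly a, whatever the level (\<open>energy_wcons\<close>).\<close>

definition energy :: "int \<Rightarrow> wedge_seq \<Rightarrow> int" where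
  "energy m s = Sum_any (\<lambda>j. s j - (m - int j)) + m * (m + 1) div 2"

lemma energy_sum: "(\<And>j. j \<ge> K \<Longrightarrow> s j = m - int j) \<Longrightarrow> energy m s = (\<Sum>j<K. s j - (m - int j)) + m * (m + 1) div 2"
proof -
  assume K: "\<And>j. j \<ge> K \<Longrightarrow> s j = m - int j"
  have "{j. s j - (m - int j) \<noteq> 0} \<subseteq> {..<K}"
  proof
    fix j assume "j \<in> {j. s j - (m - int j) \<noteq> 0}"
    then show "j \<in> {..<K}" using K[of j] by (cases "K \<le> j") auto
  qed
  then show ?thesis unfolding energy_def by (subst Sum_any.expand_superset[of "{..<K}"]) auto
qed

lemma triangular_Suc: "(m + 1) * (m + 1 + 1) div 2 = m * (m + 1) div 2 + (m + 1 :: int)"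
proof -
  have "(m + 1) * (m + 1 + 1) = m * (m + 1) + (m + 1) * 2" by (simp add: algebra_simps)
  then show ?thesis by simp
qed

lemma energy_wcons:
  assumes "s \<in> semi_infinite m"
  shows "energy (m + 1) (wcons a s) = a + energy m s"
proof -
  obtain K where K: "\<And>j. j \<ge> K \<Longrightarrow> s j = m - int j" using assms by (auto simp: semi_infinite_def)
  have "wcons a s j = m + 1 - int j" if "j \<ge> Suc K" for j using that K by (cases j) auto
  then have "energy (m + 1) (wcons a s)
      = (\<Sum>j<Suc K. wcons a s j - (m + 1 - int j)) + (m + 1) * (m + 1 + 1) div 2"
    by (rule energy_sum)
  then show ?thesis unfolding sum.lessThan_Suc_shift triangular_Suc
    using energy_sum[of K s m] K by simp
qed

lemma energy_update:
  assumes "s \<in> semi_infinite m"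
  shows "energy m (s(i := b)) = energy m s + b - s i"
proof -
  obtain K0 where K0: "\<And>j. j \<ge> K0 \<Longrightarrow> s j = m - int j" using assms by (auto simp: semi_infinite_def)
  define K where "K = max K0 (Suc i)"
  have K: "\<And>j. j \<ge> K \<Longrightarrow> s j = m - int j" "\<And>j. j \<ge> K \<Longrightarrow> (s(i := b)) j = m - int j"
    using K0 by (auto simp: K_def)
  have i: "i \<in> {..<K}" by (auto simp: K_def)
  have "(\<Sum>j<K. (s(i := b)) j - (m - int j)) = b - (m - int i) + (\<Sum>j\<in>{..<K} - {i}. s j - (m - int j))"
    by (subst sum.remove[OF _ i]) (auto intro: sum.cong)
  moreover have "(\<Sum>j<K. s j - (m - int j)) = s i - (m - int i) + (\<Sum>j\<in>{..<K} - {i}. s j - (m - int j))"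
    by (subst sum.remove[OF _ i]) auto
  ultimately show ?thesis using energy_sum[of K s m, OF K(1)] energy_sum[of K "s(i := b)" m, OF K(2)] by simp
qed

context fock_params begin

definition e_coeff :: "nat \<Rightarrow> complex" where
  "e_coeff d = (if d = 0 then 1 else 1 - v)"

lemma exchange_law_self: "exchange_law f \<Longrightarrow> f a a = 0"
proof -
  assume law: "exchange_law f"
  have "N dvd a - a" by simp
  then have "f a a = - f a a" using law unfolding exchange_law_def by blast
  then show "f a a = 0" by simp
qed

text \<open>If N divides p - l > 0, the middle terms cancel, the term with d N = p - l is f p l, and
  the total is f l p + (1 - v) f p l = - v f p l. With g 0 = - v both kinds of relations thus become
  one formula.\<close>

lemma wedge_law:
  assumes "exchange_law f" "l \<le> p"
  shows "(\<Sum>d\<le>nat ((p - l) div N). e_coeff d * f (l + int d * N) (p - int d * N)) = g (l - p) * f p l"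
proof -
  let ?F = "\<lambda>d. f (l + int d * N) (p - int d * N)"
  have anti: "f a b = - f b a" if "N dvd a - b" for a b
    using assms(1) that unfolding exchange_law_def by blast
  have e: "(\<Sum>d\<le>t. e_coeff d * ?F d) = f l p + (1 - v) * (\<Sum>d\<in>{1..<Suc t}. ?F d)" for t
  proof -
    have "(\<Sum>d\<le>t. e_coeff d * ?F d) = e_coeff 0 * ?F 0 + (\<Sum>d\<in>{1..<Suc t}. e_coeff d * ?F d)"
      unfolding lessThan_Suc_atMost[symmetric] by (rule sum_from1) simp
    also have "(\<Sum>d\<in>{1..<Suc t}. e_coeff d * ?F d) = (1 - v) * (\<Sum>d\<in>{1..<Suc t}. ?F d)"
      unfolding sum_distrib_left by (intro sum.cong) (auto simp: e_coeff_def)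
    finally show ?thesis by (simp add: e_coeff_def)
  qed
  show ?thesis
  proof (cases "N dvd p - l")
    case False
    then have lp: "l < p" using assms(2) by (cases "l = p") auto
    have "(p - l) div N \<ge> 0" using lp N_pos by (simp add: pos_imp_zdiv_nonneg_iff)
    then have "int (Suc (nat ((p - l) div N))) = int (steps (p - l))"
      using steps_not_dvd[of "p - l"] False lp by simp
    then have "Suc (nat ((p - l) div N)) = steps (p - l)" by (simp only: of_nat_eq_iff)
    moreover have "f l p = g (l - p) * f p l + (v - 1) * (\<Sum>d\<in>{1..<steps (p - l)}. ?F d)"
      using assms(1) lp False unfolding exchange_law_def by blast
    ultimately show ?thesis unfolding e by (simp add: algebra_simps)
  next
    case True
    then obtain k where k: "p - l = N * k" by (auto simp: dvd_def)
    have k0: "k \<ge> 0" using k assms(2) N_pos by (metis diff_ge_0_iff_ge zero_le_mult_iff not_le)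
    have gl: "g (l - p) = - v" using True by (intro g_dvd) (metis dvd_minus_iff minus_diff_eq)
    have t: "nat ((p - l) div N) = nat k" using k N_pos by simp
    show ?thesis
    proof (cases "l = p")
      case True
      then show ?thesis using anti[of p p] by simp
    next
      case False
      then have lp: "l < p" using assms(2) by simp
      then have "k > 0" using k k0 by (cases "k = 0") auto
      then obtain t' where t': "nat k = Suc t'" by (metis gr0_implies_Suc zero_less_nat_eq)
      have "k = int (Suc t')" using t' k0 by simp
      then have pl: "int (Suc t') * N = p - l" using k by (simp add: mult.commute)
      have st: "steps (p - l) = Suc t'" unfolding pl[symmetric] by (rule steps_mult)
      have "(\<Sum>d\<in>{1..<steps (p - l)}. ?F d) = 0"
      proof (rule antisymmetric_sum_zero[OF lp \<open>N dvd p - l\<close>])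
        fix d
        have "(l + int d * N) - (p - int d * N) = 2 * int d * N - (p - l)" by (simp add: algebra_simps)
        then have "N dvd (l + int d * N) - (p - int d * N)" using \<open>N dvd p - l\<close> by (metis dvd_diff dvd_triv_right)
        then show "?F d = - f (p - int d * N) (l + int d * N)" by (rule anti)
      qed
      moreover have "?F (Suc t') = f p l"
        unfolding pl by simp
      moreover have "f l p = - f p l" using anti[of l p] \<open>N dvd p - l\<close> by (metis dvd_minus_iff minus_diff_eq)
      ultimately show ?thesis unfolding e t t' gl st by (simp add: algebra_simps)
    qed
  qed
qed

section \<open>Functionals under prefixing, and wedges that vanish\<close>

lemma ann_pre: 
  assumes "\<phi> \<in> ann m"
  shows "(\<lambda>t. \<phi> (pre i s t)) \<in> ann (m - int i)"
  unfolding ann_iff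
proof (intro ballI allI)
  fix t j assume t: "t \<in> semi_infinite (m - int i)"
  have "pre i s (t(j := a, Suc j := b)) = (pre i s t)(i + j := a, Suc (i + j) := b)" for a b
    by (auto simp: pre_def fun_eq_iff)
  then have "local (\<lambda>t. \<phi> (pre i s t)) t j = local \<phi> (pre i s t) (i + j)"
    unfolding local_def by simp
  then show "exchange_law (local (\<lambda>t. \<phi> (pre i s t)) t j)"
    using assms pre_semi_infinite[OF t] unfolding ann_iff by simp
qed

lemma ann_wcons:
  assumes "\<phi> \<in> ann (m + 1)"
  shows "(\<lambda>s. \<phi> (wcons a s)) \<in> ann m"
proof -
  have "pre 1 (\<lambda>_. a) t = wcons a t" for t
    by (auto simp: pre_def fun_eq_iff wcons_def split: nat.splits)
  then show ?thesis using ann_pre[OF assms, of 1 "\<lambda>_. a"] by simp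
qed

lemma ann_pair_law:
  assumes "\<phi> \<in> ann (m + 1 + 1)" "s \<in> semi_infinite m"
  shows "exchange_law (\<lambda>a b. \<phi> (wcons a (wcons b s)))"
proof -
  have "exchange_law (local \<phi> (wcons 0 (wcons 0 s)) 0)"
    using assms semi_infinite_wcons unfolding ann_iff by blast
  moreover have "local \<phi> (wcons 0 (wcons 0 s)) 0 = (\<lambda>a b. \<phi> (wcons a (wcons b s)))"
    by (intro ext) (simp add: local_def)
  ultimately show ?thesis by simp
qed

text \<open>Exchange u_b with the leading u_m of the vacuum. In every other term an index of at most
  m - 1 stands directly before the vacuum of level m - 1, at a smaller distance from its top, and
  induction applies.\<close>

lemma wedge_vac_zero:
  assumes "\<phi> \<in> ann (m + 1)" "b \<le> m"
  shows "\<phi> (wcons b (vac m)) = 0"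
  using assms
proof (induction "nat (m - b)" arbitrary: m b \<phi> rule: less_induct)
  case less
  define f where "f x y = \<phi> (wcons x (wcons y (vac (m - 1))))" for x y
  have law: "exchange_law f"
    unfolding f_def using ann_pair_law[of \<phi> "m - 1" "vac (m - 1)"] less.prems(1) by simp
  have shift: "(\<lambda>s. \<phi> (wcons x s)) \<in> ann (m - 1 + 1)" for x
    unfolding diff_add_cancel by (rule ann_wcons[OF less.prems(1)])
  have goal: "\<phi> (wcons b (vac m)) = f b m" by (simp only: f_def vac_wcons[of m])
  show ?case
  proof (cases "b = m")
    case True
    then show ?thesis unfolding goal using exchange_law_self[OF law] by simp
  next
    case False
    then have bm: "b < m" using less.prems by simp
    have "f m b = 0"
      unfolding f_def by (rule less.hyps[OF _ shift]) (use bm in auto)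
    moreover have "f (b + int d * N) (m - int d * N) = 0" if "d \<in> {..nat ((m - b) div N)} - {0}" for d
    proof -
      have d: "d \<ge> 1" "int d \<le> (m - b) div N" using that bm N_pos by (auto simp: le_nat_iff pos_imp_zdiv_nonneg_iff)
      have "int d * N \<le> (m - b) div N * N" using d N_pos by (intro mult_right_mono) auto
      then have dm: "int d * N \<le> m - b" using minus_mod_eq_div_mult[of "m - b" N] pos_mod_sign[OF N_pos, of "m - b"] by linarith
      have "int d * N > 0" using d N_pos by simp
      then show ?thesis unfolding f_def by (intro less.hyps[OF _ shift]) (use dm bm in auto)
    qed
    then have "(\<Sum>d\<le>nat ((m - b) div N). e_coeff d * f (b + int d * N) (m - int d * N)) = e_coeff 0 * f b m"
      by (subst sum.mono_neutral_right[of _ "{0}"]) auto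
    ultimately show ?thesis unfolding goal using wedge_law[OF law, of b m] bm by (simp add: e_coeff_def)
  qed
qed

text \<open>The wedge is u_p \<and> ... \<and> u_(p-k+1) \<and> u_b \<and> s with b among the
  indices of the run. Exchanging u_b with the last factor of the run places, in every other term, an
  index of the shorter run directly behind that run.\<close>

lemma run_wedge_zero:
  assumes "\<phi> \<in> ann (m + int k + 1)" "s \<in> semi_infinite m" "p - int k < b" "b \<le> p"
  shows "\<phi> (run p k (wcons b s)) = 0"
  using assms
proof (induction k arbitrary: b m s)
  case (Suc k)
  define l where "l = p - int k"
  define f where "f x y = \<phi> (run p k (wcons x (wcons y s)))" for x y
  have "(\<lambda>t. \<phi> (run p k t)) \<in> ann (m + 1 + 1)"
    using ann_pre[OF Suc.prems(1), of k] by (simp add: run_def algebra_simps)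
  then have law: "exchange_law f"
    unfolding f_def using ann_pair_law[of "\<lambda>t. \<phi> (run p k t)" m s] Suc.prems(2) by simp
  have IH: "f x y = 0" if "l < x" "x \<le> p" for x y
  proof -
    have "\<phi> \<in> ann (m + 1 + int k + 1)" using Suc.prems(1) by (simp add: algebra_simps)
    then show ?thesis unfolding f_def
      by (rule Suc.IH) (use that Suc.prems semi_infinite_wcons l_def in auto)
  qed
  have goal: "\<phi> (run p (Suc k) (wcons b s)) = f l b" by (simp add: run_Suc f_def l_def)
  show ?case
  proof (cases "b = l")
    case True
    then show ?thesis unfolding goal using exchange_law_self[OF law] by simp
  next
    case False
    then have lb: "l < b" using Suc.prems l_def by simp
    have "f (l + int d * N) (b - int d * N) = 0" if "d \<in> {..nat ((b - l) div N)} - {0}" for d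
    proof -
      have d: "d \<ge> 1" "int d \<le> (b - l) div N" using that lb N_pos by (auto simp: le_nat_iff pos_imp_zdiv_nonneg_iff)
      have "int d * N \<le> (b - l) div N * N" using d N_pos by (intro mult_right_mono) auto
      then have "int d * N \<le> b - l" using minus_mod_eq_div_mult[of "b - l" N] pos_mod_sign[OF N_pos, of "b - l"] by linarith
      moreover have "int d * N > 0" using d N_pos by simp
      ultimately show ?thesis using Suc.prems by (intro IH) auto
    qed
    then have "(\<Sum>d\<le>nat ((b - l) div N). e_coeff d * f (l + int d * N) (b - int d * N)) = e_coeff 0 * f l b"
      by (subst sum.mono_neutral_right[of _ "{0}"]) auto
    moreover have "f b l = 0" using lb Suc.prems by (intro IH) auto
    ultimately show ?thesis unfolding goal using wedge_law[OF law, of l b] lb by (simp add: e_coeff_def)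
  qed
qed simp

section \<open>Transposes of the Heisenberg operators\<close>

definition Jd :: "int \<Rightarrow> (wedge_seq \<Rightarrow> complex) \<Rightarrow> wedge_seq \<Rightarrow> complex" where
  "Jd k \<phi> s = Sum_any (\<lambda>i. \<phi> (s(i := s i - N * k)))"

text \<open>A deep factor is surrounded by consecutive indices. Lowered, it repeats an index of the
  vacuum behind it; raised, it repeats an index of the run before it, the margin n |k| ensuring that
  it does not leave the run. So the sum in \<open>Jd\<close> is finite on
  \<open>ann m\<close>.\<close>

lemma deep_shift_zero:
  assumes "\<phi> \<in> ann m" "\<And>i. i \<ge> K \<Longrightarrow> s i = m - int i" "k \<noteq> 0" "i \<ge> K + n * nat \<bar>k\<bar>"
  shows "\<phi> (s(i := s i - N * k)) = 0"
proof (cases "k > 0")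
  case True
  have "s(i := s i - N * k) = pre i s (wcons (m - int i - N * k) (vac (m - int i - 1)))"
    using assms(2,4) unfolding pre_wcons by (auto simp: fun_eq_iff pre_def vac_def of_nat_diff)
  moreover have "(\<lambda>t. \<phi> (pre i s t)) \<in> ann (m - int i - 1 + 1)" using ann_pre[OF assms(1)] by simp
  moreover have "N * k > 0" using True N_pos by simp
  ultimately show ?thesis using wedge_vac_zero[of "\<lambda>t. \<phi> (pre i s t)" "m - int i - 1" "m - int i - N * k"] by simp
next
  case False
  then have k: "k < 0" using assms(3) by simp
  define k' where "k' = i - K"
  define p where "p = m - int K"
  have iK: "i = K + k'" using assms(4) by (simp add: k'_def)
  define b where "b = m - int i - N * k"
  have "int (n * nat \<bar>k\<bar>) = - (N * k)" using k by simp
  then have nk: "- (N * k) \<le> int k'" using assms(4) unfolding iK by linarith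
  have "s(i := s i - N * k) = pre K s (run p k' (wcons b (\<lambda>j. s (Suc (i + j)))))"
    using assms(2) unfolding run_def pre_wcons
    by (auto simp: fun_eq_iff pre_def p_def b_def iK of_nat_diff)
  moreover have "(\<lambda>t. \<phi> (pre K s t)) \<in> ann (m - int i - 1 + int k' + 1)"
    using ann_pre[OF assms(1), of K s] iK by (simp add: algebra_simps)
  moreover have "(\<lambda>j. s (Suc (i + j))) \<in> semi_infinite (m - int i - 1)"
    using assms(2) iK by (auto simp: semi_infinite_def intro!: exI[of _ 0])
  moreover have "N * k < 0" using k N_pos by (simp add: mult_pos_neg)
  moreover have "p - int k' < b" "b \<le> p" using nk \<open>N * k < 0\<close> by (auto simp: p_def b_def iK)
  ultimately show ?thesis using run_wedge_zero[of "\<lambda>t. \<phi> (pre K s t)" "m - int i - 1" k'] by simp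
qed

lemma Jd_sum:
  assumes "\<phi> \<in> ann m" "\<And>i. i \<ge> K \<Longrightarrow> s i = m - int i" "k \<noteq> 0" "M \<ge> K + n * nat \<bar>k\<bar>"
  shows "Jd k \<phi> s = (\<Sum>i<M. \<phi> (s(i := s i - N * k)))"
proof -
  have "{i. \<phi> (s(i := s i - N * k)) \<noteq> 0} \<subseteq> {..<M}"
  proof
    fix i assume i: "i \<in> {i. \<phi> (s(i := s i - N * k)) \<noteq> 0}"
    show "i \<in> {..<M}"
    proof (rule ccontr)
      assume "i \<notin> {..<M}"
      then have "i \<ge> K + n * nat \<bar>k\<bar>" using assms(4) by simp
      then have "\<phi> (s(i := s i - N * k)) = 0" using deep_shift_zero[OF assms(1), of K s k i] assms(2,3) by blast
      then show False using i by simp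
    qed
  qed
  then show ?thesis unfolding Jd_def by (intro Sum_any.expand_superset) auto
qed

text \<open>The power sum X_1^k + X_2^k in the two shift operators. Symmetric Laurent polynomials in
  the shifts commute with \<open>R\<close>.\<close>

definition power_sum :: "int \<Rightarrow> (int \<Rightarrow> int \<Rightarrow> complex) \<Rightarrow> int \<Rightarrow> int \<Rightarrow> complex" where
  "power_sum k f a b = f (a + k * N) b + f a (b + k * N)"

lemma power_sum_fun: "power_sum k f = (\<lambda>a b. f (a + k * N) b + f a (b + k * N))"
  by (intro ext) (simp add: power_sum_def)

text \<open>For k = 1 the two Bernstein corrections cancel. Higher k follow from Newton's identity
  p_k = p_1 p_(k-1) - e_2 p_(k-2), where e_2 shifts both indices and commutes with
  \<open>R\<close>.\<close>

lemma R_power_sum_nat: "R (power_sum (int k) f) = power_sum (int k) (R f)"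
proof (induction k arbitrary: f rule: less_induct)
  case (less k)
  have one: "R (power_sum 1 f) = power_sum 1 (R f)" for f
    unfolding power_sum_fun by (intro ext) (simp add: R_add R_bernstein1 R_bernstein2)
  consider "k = 0" | "k = 1" | j where "k = Suc (Suc j)" by (metis One_nat_def not0_implies_Suc)
  then show ?case
  proof cases
    case 1
    then show ?thesis unfolding power_sum_fun by (intro ext) (simp add: R_add R_scale)
  next
    case 2
    then show ?thesis using one by simp
  next
    case 3
    define e where "e f = (\<lambda>a b. f (a + N) (b + N))" for f :: "int \<Rightarrow> int \<Rightarrow> complex"
    have newton: "power_sum (int k) f = (\<lambda>a b. power_sum 1 (power_sum (int (Suc j)) f) a b - power_sum (int j) (e f) a b)"
      for f unfolding power_sum_def e_def 3 by (simp add: algebra_simps)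
    have "R (power_sum (int k) f) = (\<lambda>a b. R (power_sum 1 (power_sum (int (Suc j)) f)) a b - R (power_sum (int j) (e f)) a b)"
      unfolding newton by (intro ext) (rule R_diff)
    also have "\<dots> = (\<lambda>a b. power_sum 1 (power_sum (int (Suc j)) (R f)) a b - power_sum (int j) (R (e f)) a b)"
      unfolding one using less[of "Suc j"] less[of j] 3 by simp
    also have "R (e f) = e (R f)" unfolding e_def by (intro ext) (simp add: R_translate)
    finally show ?thesis unfolding newton .
  qed
qed

text \<open>Negative powers are reduced to positive ones by p_(-j) = e_2^(-j) p_j.\<close>

lemma R_power_sum: "R (power_sum k f) l p = power_sum k (R f) l p"
proof (cases "k \<ge> 0")
  case True
  then show ?thesis using R_power_sum_nat[of "nat k" f] by simp
next
  case False
  define j where "j = nat (- k)"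
  have k: "k = - int j" using False by (simp add: j_def)
  have neg: "power_sum k f a b = power_sum (int j) f (a + k * N) (b + k * N)" for f a b
    unfolding power_sum_def k by (simp add: add.commute)
  have "power_sum k f = (\<lambda>a b. power_sum (int j) f (a + k * N) (b + k * N))"
    by (intro ext) (rule neg)
  then have "R (power_sum k f) l p = R (\<lambda>a b. power_sum (int j) f (a + k * N) (b + k * N)) l p"
    by simp
  also have "\<dots> = R (power_sum (int j) f) (l + k * N) (p + k * N)" by (rule R_translate[symmetric])
  also have "\<dots> = power_sum k (R f) l p" unfolding R_power_sum_nat neg ..
  finally show ?thesis .
qed

text \<open>The dual form of the statement that J_k is well defined on the quotient. Seen from
  positions j and j + 1, it is a power sum in their shifts, which commutes with \<open>R\<close>,
  plus shifts at other positions, which preserve the eigenvalue equation.\<close>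

lemma ann_Jd:
  assumes "\<phi> \<in> ann m" "k \<noteq> 0"
  shows "Jd k \<phi> \<in> ann m"
  unfolding ann_iff_R
proof (intro ballI allI)
  fix s j l p assume s: "s \<in> semi_infinite m"
  then obtain K0 where K0: "\<And>i. i \<ge> K0 \<Longrightarrow> s i = m - int i" by (auto simp: semi_infinite_def)
  \<comment> \<open>K lies beyond j + 1, as the same tail has to serve for all pairs a, b put in at
    j and j + 1.\<close>
  define K where "K = max K0 (Suc (Suc j))"
  define M where "M = K + n * nat \<bar>k\<bar>"
  let ?I = "{..<M} - {j, Suc j}"
  have J: "local (Jd k \<phi>) s j a b = power_sum (- k) (local \<phi> s j) a b
      + (\<Sum>i\<in>?I. local \<phi> (s(i := s i - N * k)) j a b)" for a b
  proof -
    let ?s = "s(j := a, Suc j := b)"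
    have "local (Jd k \<phi>) s j a b = (\<Sum>i<M. \<phi> (?s(i := ?s i - N * k)))"
      unfolding local_def by (rule Jd_sum[OF assms(1) _ assms(2), of K]) (use K0 in \<open>auto simp: K_def M_def\<close>)
    also have "\<dots> = (\<Sum>i\<in>{j, Suc j}. \<phi> (?s(i := ?s i - N * k))) + (\<Sum>i\<in>?I. \<phi> (?s(i := ?s i - N * k)))"
      by (subst sum.subset_diff[of "{j, Suc j}"]) (auto simp: M_def K_def)
    also have "(\<Sum>i\<in>{j, Suc j}. \<phi> (?s(i := ?s i - N * k))) = power_sum (- k) (local \<phi> s j) a b"
      by (simp add: power_sum_def local_def fun_upd_twist mult.commute)
    also have "(\<Sum>i\<in>?I. \<phi> (?s(i := ?s i - N * k))) = (\<Sum>i\<in>?I. local \<phi> (s(i := s i - N * k)) j a b)"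
      unfolding local_def by (intro sum.cong refl arg_cong[where f = \<phi>]) (auto simp: fun_eq_iff)
    finally show ?thesis .
  qed
  have Jf: "local (Jd k \<phi>) s j = (\<lambda>a b. power_sum (- k) (local \<phi> s j) a b
      + (\<Sum>i\<in>?I. local \<phi> (s(i := s i - N * k)) j a b))"
    by (intro ext) (rule J)
  have eig: "R (local \<phi> t j) a b = - v * local \<phi> t j a b" if "t \<in> semi_infinite m" for t a b
    using ann_R[OF assms(1) that] .
  have "R (local (Jd k \<phi>) s j) l p = R (\<lambda>a b. power_sum (- k) (local \<phi> s j) a b
      + (\<Sum>i\<in>?I. local \<phi> (s(i := s i - N * k)) j a b)) l p"
    unfolding Jf ..
  also have "\<dots> = power_sum (- k) (R (local \<phi> s j)) l p + (\<Sum>i\<in>?I. R (local \<phi> (s(i := s i - N * k)) j) l p)"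
    unfolding R_add R_sum R_power_sum ..
  also have "\<dots> = - v * local (Jd k \<phi>) s j l p"
    unfolding J power_sum_def using s by (simp add: eig semi_infinite_update sum_distrib_left algebra_simps sum_negf)
  finally show "R (local (Jd k \<phi>) s j) l p = - v * local (Jd k \<phi>) s j l p" .
qed

lemma Jd_wcons:
  assumes "\<phi> \<in> ann (m + 1)" "s \<in> semi_infinite m" "k \<noteq> 0"
  shows "Jd k \<phi> (wcons a s) = \<phi> (wcons (a - N * k) s) + Jd k (\<lambda>s. \<phi> (wcons a s)) s"
proof -
  obtain K where K: "\<And>i. i \<ge> K \<Longrightarrow> s i = m - int i" using assms(2) by (auto simp: semi_infinite_def)
  have K': "wcons a s i = m + 1 - int i" if "i \<ge> Suc K" for i using that K by (cases i) auto
  let ?M = "K + n * nat \<bar>k\<bar>"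
  have "Jd k \<phi> (wcons a s) = (\<Sum>i<Suc ?M. \<phi> ((wcons a s)(i := wcons a s i - N * k)))"
    by (rule Jd_sum[OF assms(1) K' assms(3)]) auto
  also have "\<dots> = \<phi> (wcons (a - N * k) s) + (\<Sum>i<?M. \<phi> (wcons a (s(i := s i - N * k))))"
    unfolding sum.lessThan_Suc_shift by simp
  also have "(\<Sum>i<?M. \<phi> (wcons a (s(i := s i - N * k)))) = Jd k (\<lambda>s. \<phi> (wcons a s)) s"
    by (rule Jd_sum[OF ann_wcons[OF assms(1)] K assms(3), symmetric]) auto
  finally show ?thesis .
qed

lemma Jd_energy:
  assumes "\<And>s. s \<in> semi_infinite m \<Longrightarrow> energy m s = E \<Longrightarrow> \<phi> s = 0"
    and "s \<in> semi_infinite m" "energy m s = E + N * k"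
  shows "Jd k \<phi> s = 0"
proof -
  have "\<phi> (s(i := s i - N * k)) = 0" for i
    by (rule assms(1)) (use assms semi_infinite_update energy_update in auto)
  then show ?thesis unfolding Jd_def by simp
qed

lemma Jd_cong:
  assumes "\<And>s. s \<in> semi_infinite m \<Longrightarrow> \<phi> s = \<psi> s" "s \<in> semi_infinite m"
  shows "Jd k \<phi> s = Jd k \<psi> s"
proof -
  have "\<phi> (s(i := s i - N * k)) = \<psi> (s(i := s i - N * k))" for i
    by (intro assms(1) semi_infinite_update assms(2))
  then show ?thesis unfolding Jd_def by simp
qed

end

section \<open>Normal forms and coordinates\<close>

lemma free_wedges_add: "x \<in> free_wedges m \<Longrightarrow> y \<in> free_wedges m \<Longrightarrow> x + y \<in> free_wedges m"
  unfolding free_wedges_def using Poly_Mapping.keys_add[of x y] by blast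

lemma free_wedges_wscale: "x \<in> free_wedges m \<Longrightarrow> wscale c x \<in> free_wedges m"
  unfolding free_wedges_def using keys_wscale[of c x] by blast

lemma free_wedges_zero: "0 \<in> free_wedges m"
  by (simp add: free_wedges_def)

lemma free_wedges_sum: "(\<And>i. i \<in> I \<Longrightarrow> F i \<in> free_wedges m) \<Longrightarrow> (\<Sum>i\<in>I. F i) \<in> free_wedges m"
  by (induction I rule: infinite_finite_induct) (simp_all add: free_wedges_add free_wedges_zero)

lemma free_wedges_diff: "x \<in> free_wedges m \<Longrightarrow> y \<in> free_wedges m \<Longrightarrow> x - y \<in> free_wedges m"
  using free_wedges_add[of x m "wscale (-1) y"] free_wedges_wscale[of y m "-1"]
  by (metis wvec.scale_minus_left wvec.scale_one add_uminus_conv_diff)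

lemma free_wedges_monomial: "s \<in> semi_infinite m \<Longrightarrow> monomial s \<in> free_wedges m"
  by (simp add: free_wedges_def)

lemma relators_free: "relators n v g m \<subseteq> free_wedges m"
proof
  have kept: "kept s j a b \<in> free_wedges m" if "s \<in> semi_infinite m" for s j a b
    using that by (simp add: kept_def free_wedges_zero free_wedges_monomial semi_infinite_update)
  have ex: "exchange n v g s j \<in> free_wedges m" if "s \<in> semi_infinite m" for s j
    unfolding exchange_def Let_def Sum_any.expand_set
    by (intro free_wedges_add free_wedges_wscale free_wedges_sum kept that)
  fix x assume "x \<in> relators n v g m"
  then show "x \<in> free_wedges m" unfolding relators_def
    by (auto intro!: free_wedges_add free_wedges_diff free_wedges_monomial semi_infinite_update ex)
qed

lemma pair_of_linear:
  assumes add: "\<And>x y. f (x + y) = f x + f y" and scale: "\<And>c x. f (wscale c x) = c * f x"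
  shows "pair (\<lambda>s. f (monomial s)) x = f x"
proof -
  have zero: "f 0 = 0" using scale[of 0 0] by simp
  have sum: "f (\<Sum>i\<in>I. F i) = (\<Sum>i\<in>I. f (F i))" for F and I :: "wedge_seq set"
    by (induction I rule: infinite_finite_induct) (simp_all add: zero add)
  have "x = (\<Sum>s\<in>Poly_Mapping.keys x. wscale (Poly_Mapping.lookup x s) (monomial s))"
    by (rule poly_mapping_eqI)
      (simp add: lookup_sum lookup_single when_def in_keys_iff if_distrib[of "\<lambda>c. _ * c"] cong: if_cong)
  then have "f x = (\<Sum>s\<in>Poly_Mapping.keys x. f (wscale (Poly_Mapping.lookup x s) (monomial s)))"
    using sum by metis
  then show ?thesis unfolding pair_def by (simp add: scale)
qed

text \<open>A basis of the span stays independent when x is added, so a linear functional can be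
  prescribed as 1 at x and 0 on the basis; every linear functional has the form
  \<open>pair \<phi>\<close>.\<close>

lemma span_separation:
  assumes "x \<notin> wvec.span S"
  obtains \<phi> where "\<And>r. r \<in> S \<Longrightarrow> pair \<phi> r = 0" "pair \<phi> x \<noteq> 0"
proof -
  interpret vp: vector_space_pair wscale "(*) :: complex \<Rightarrow> complex \<Rightarrow> complex"
    by unfold_locales (simp_all add: algebra_simps)
  obtain B where B: "B \<subseteq> S" "wvec.independent B" "S \<subseteq> wvec.span B"
    by (rule wvec.maximal_independent_subset)
  have xB: "x \<notin> wvec.span B" using assms B(1) wvec.span_mono by blast
  then have "x \<notin> B" using wvec.span_base by blast
  have "wvec.independent (insert x B)" using B(2) xB \<open>x \<notin> B\<close> by (simp add: wvec.independent_insert)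
  then obtain f where f: "Vector_Spaces.linear wscale (*) f" "\<forall>y\<in>insert x B. f y = (if y = x then 1 else 0)"
    using vp.linear_independent_extend[of "insert x B" "\<lambda>y. if y = x then 1 else 0"] by auto
  have add: "f (a + b) = f a + f b" and scale: "f (wscale c a) = c * f a" for a b c
    using f(1) vp.linear_add vp.linear_scale by auto
  have pf: "pair (\<lambda>s. f (monomial s)) y = f y" for y
    using add scale by (rule pair_of_linear)
  have "f r = 0" if "r \<in> wvec.span B" for r
    using that
  proof (induction rule: wvec.span_induct_alt)
    case base
    show ?case using scale[of 0 0] by simp
  next
    case (step c b y)
    have "f b = 0" using f(2) step \<open>x \<notin> B\<close> by auto
    then show ?case using step by (simp add: add scale)
  qed
  then show thesis using that[of "\<lambda>s. f (monomial s)"] B(3) f(2) by (auto simp: pf)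
qed

context fock_params begin

text \<open>The double annihilator: from here on equality in the Fock space is tested by
  functionals.\<close>

lemma span_iff_ann: "x \<in> wvec.span (relators n v g m) \<longleftrightarrow> (\<forall>\<phi>\<in>ann m. pair \<phi> x = 0)"
proof
  assume "x \<in> wvec.span (relators n v g m)"
  then show "\<forall>\<phi>\<in>ann m. pair \<phi> x = 0"
  proof (induction rule: wvec.span_induct_alt)
    case (step c b y)
    then show ?case by (simp add: pair_add pair_wscale ann_def)
  qed simp
next
  assume A: "\<forall>\<phi>\<in>ann m. pair \<phi> x = 0"
  show "x \<in> wvec.span (relators n v g m)"
  proof (rule ccontr)
    assume "x \<notin> wvec.span (relators n v g m)"
    then obtain \<phi> where "\<And>r. r \<in> relators n v g m \<Longrightarrow> pair \<phi> r = 0" "pair \<phi> x \<noteq> 0"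
      by (rule span_separation) blast
    then show False using A unfolding ann_def by blast
  qed
qed

lemma normal_ordered_less: "s \<in> normal_ordered m \<Longrightarrow> i < j \<Longrightarrow> s j < s i"
proof (induction j)
  case (Suc j)
  have "s (Suc j) < s j" using Suc.prems by (simp add: normal_ordered_def)
  then show ?case using Suc by (cases "i = j") auto
qed simp

text \<open>As a combination of finitely many relators, y is killed for large M by every functional
  antisymmetric at the first M positions. But the one that separates the key t with the largest sum
  of squares yields the nonzero coefficient at t. M has to be fixed before t, as the sums of squares
  run over M entries.\<close>

lemma normal_ordered_independent:
  assumes "Poly_Mapping.keys y \<subseteq> normal_ordered m" "y \<in> wvec.span (relators n v g m)"
  shows "y = 0"
proof (rule ccontr)
  assume "y \<noteq> 0"
  have "\<exists>M0. \<forall>M\<ge>M0. \<forall>\<psi>. (\<forall>j. Suc j < M \<longrightarrow> eigen j \<psi>) \<longrightarrow> pair \<psi> y = 0"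
    using assms(2)
  proof (induction rule: wvec.span_induct_alt)
    case (step c b y)
    obtain s j where sj: "\<And>\<phi>. exchange_law (local \<phi> s j) \<Longrightarrow> pair \<phi> b = 0"
      using relator_killed[OF step(1)] by blast
    obtain M0 where M0: "\<forall>M\<ge>M0. \<forall>\<psi>. (\<forall>j. Suc j < M \<longrightarrow> eigen j \<psi>) \<longrightarrow> pair \<psi> y = 0"
      using step by blast
    have "pair \<psi> (wscale c b + y) = 0" if M: "M \<ge> max M0 (Suc (Suc j))" and e: "\<forall>j. Suc j < M \<longrightarrow> eigen j \<psi>" for M \<psi>
    proof -
      have "eigen j \<psi>" using M e by simp
      then have "R (local \<psi> s j) = local (\<lambda>s. - v * \<psi> s) s j"
        unfolding eigen_def local_H[symmetric] by simp
      then have "R (local \<psi> s j) l p = - v * local \<psi> s j l p" for l p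
        by (simp add: local_def)
      then have "exchange_law (local \<psi> s j)" unfolding exchange_law_iff_R by blast
      then have "pair \<psi> b = 0" by (rule sj)
      moreover have "M0 \<le> M" using M by simp
      then have "pair \<psi> y = 0" using M0 e by blast
      ultimately show ?thesis by (simp add: pair_add pair_wscale)
    qed
    then show ?case by blast
  qed auto
  then obtain M where M: "\<And>\<psi>. (\<And>j. Suc j < M \<Longrightarrow> eigen j \<psi>) \<Longrightarrow> pair \<psi> y = 0" by blast
  let ?Q = "sq_sum M ` Poly_Mapping.keys y"
  have "Max ?Q \<in> ?Q" using \<open>y \<noteq> 0\<close> by (intro Max_in) auto
  then obtain t where t: "t \<in> Poly_Mapping.keys y" "sq_sum M t = Max ?Q" by auto
  have max: "sq_sum M s \<le> sq_sum M t" if "s \<in> Poly_Mapping.keys y" for s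
    unfolding t(2) using that by (intro Max_ge) auto
  have dec: "s j < s i" if "s \<in> Poly_Mapping.keys y" "i < j" for s i j
    using that assms(1) normal_ordered_less by blast
  obtain \<psi> where \<psi>: "\<And>j. Suc j < M \<Longrightarrow> eigen j \<psi>"
    "\<And>s. (\<And>i j. i < j \<Longrightarrow> j < M \<Longrightarrow> s j < s i) \<Longrightarrow> sq_sum M s \<le> sq_sum M t \<Longrightarrow> \<psi> s = (if s = t then 1 else 0)"
    by (rule separating_functional[of M t]) (use dec[OF t(1)] in auto)
  have "pair \<psi> y = (\<Sum>s\<in>Poly_Mapping.keys y. Poly_Mapping.lookup y s * (if s = t then 1 else 0))"
    unfolding pair_def by (intro sum.cong refl) (use \<psi>(2) max dec in auto)
  also have "\<dots> = Poly_Mapping.lookup y t"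
    by (subst sum.mono_neutral_right[of _ "{t}"]) (use t(1) in auto)
  finally show False using M[OF \<psi>(1)] t(1) by (simp add: in_keys_iff)
qed

text \<open>Equality in the Fock space is expressed by testing with \<open>ann m\<close>; recording
  the energy makes the coordinates homogeneous.\<close>

definition normal_form :: "int \<Rightarrow> wedge_seq \<Rightarrow> wedge_vec \<Rightarrow> bool" where
  "normal_form m s y \<longleftrightarrow> Poly_Mapping.keys y \<subseteq> {t \<in> normal_ordered m. energy m t = energy m s} \<and>
     (\<forall>\<phi>\<in>ann m. \<phi> s = pair \<phi> y)"

lemma normal_form_sum:
  assumes "finite I" "\<And>i. i \<in> I \<Longrightarrow> \<exists>y. normal_form m (S i) y"
    and "\<And>i. i \<in> I \<Longrightarrow> energy m (S i) = energy m s"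
    and "\<And>\<phi>. \<phi> \<in> ann m \<Longrightarrow> \<phi> s = (\<Sum>i\<in>I. c i * \<phi> (S i))"
  shows "\<exists>y. normal_form m s y"
proof -
  obtain y where y: "\<And>i. i \<in> I \<Longrightarrow> normal_form m (S i) (y i)" using assms(2) by metis
  let ?y = "\<Sum>i\<in>I. wscale (c i) (y i)"
  have "Poly_Mapping.keys ?y \<subseteq> (\<Union>i\<in>I. Poly_Mapping.keys (wscale (c i) (y i)))"
    by (rule Poly_Mapping.keys_sum)
  also have "\<dots> \<subseteq> (\<Union>i\<in>I. Poly_Mapping.keys (y i))" using keys_wscale by blast
  also have "\<dots> \<subseteq> {t \<in> normal_ordered m. energy m t = energy m s}"
  proof (rule UN_least)
    fix i assume i: "i \<in> I"
    show "Poly_Mapping.keys (y i) \<subseteq> {t \<in> normal_ordered m. energy m t = energy m s}"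
      using y[OF i] unfolding normal_form_def assms(3)[OF i] by (rule conjunct1)
  qed
  finally have "Poly_Mapping.keys ?y \<subseteq> {t \<in> normal_ordered m. energy m t = energy m s}" .
  moreover have "\<phi> s = pair \<phi> ?y" if "\<phi> \<in> ann m" for \<phi>
    unfolding assms(4)[OF that] pair_sum pair_wscale
    by (intro sum.cong refl) (use y that in \<open>simp add: normal_form_def\<close>)
  ultimately show ?thesis unfolding normal_form_def by blast
qed

text \<open>Termination measure of straightening: with weight j at position j it drops when a larger
  index moves forward. The lower bound lo, preserved by the exchanges, keeps it nonnegative.\<close>

definition potential :: "nat \<Rightarrow> int \<Rightarrow> wedge_seq \<Rightarrow> int" where
  "potential K lo s = (\<Sum>j<K. int j * (s j - lo))"

lemma potential_update:
  assumes "Suc j < K" "a + b = s j + s (Suc j)"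
  shows "potential K lo (s(j := a, Suc j := b)) = potential K lo s + b - s (Suc j)"
proof -
  let ?B = "{..<K} - {j, Suc j}"
  have "{j, Suc j} \<subseteq> {..<K}" using assms(1) by auto
  then have split: "potential K lo t = int j * (t j - lo) + int (Suc j) * (t (Suc j) - lo) + (\<Sum>i\<in>?B. int i * (t i - lo))" for t
    using sum.subset_diff[of "{j, Suc j}" "{..<K}" "\<lambda>i. int i * (t i - lo)"] by (simp add: potential_def)
  have "(\<Sum>i\<in>?B. int i * ((s(j := a, Suc j := b)) i - lo)) = (\<Sum>i\<in>?B. int i * (s i - lo))"
    by (intro sum.cong) auto
  moreover have a: "a = s j + s (Suc j) - b" using assms(2) by simp
  have "int j * (a - lo) + int (Suc j) * (b - lo) = int j * (s j - lo) + int (Suc j) * (s (Suc j) - lo) + b - s (Suc j)"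
    unfolding a by (simp add: algebra_simps)
  ultimately show ?thesis unfolding split[of "s(j := a, Suc j := b)"] split[of s] by simp
qed

lemma div_gap:
  assumes "l \<le> p" "d \<le> nat ((p - l) div N)"
  shows "int d * N \<le> p - l"
proof -
  have "(p - l) div N \<ge> 0" using assms N_pos by (simp add: pos_imp_zdiv_nonneg_iff)
  then have "int d \<le> (p - l) div N" using assms by linarith
  then have "int d * N \<le> (p - l) div N * N" using N_pos by (intro mult_right_mono) auto
  then show ?thesis using minus_mod_eq_div_mult[of "p - l" N] pos_mod_sign[OF N_pos, of "p - l"] by linarith
qed

text \<open>An ascent l < p is rewritten by the wedge law; in each resulting pair both indices are
  at least l and the second is below p. Without ascents before K, either the wedge is normal ordered
  or its entry at K - 1 already lies in the range of the vacuum tail, and the wedge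
  vanishes.\<close>

lemma straightening:
  assumes "\<And>i. i \<ge> K \<Longrightarrow> s i = m - int i" "\<And>j. j < K \<Longrightarrow> lo \<le> s j"
  shows "\<exists>y. normal_form m s y"
  using assms
proof (induction "nat (potential K lo s)" arbitrary: s rule: less_induct)
  case less
  have semi: "s \<in> semi_infinite m" using less.prems(1) by (auto simp: semi_infinite_def)
  have zero: ?case if "\<And>\<phi>. \<phi> \<in> ann m \<Longrightarrow> \<phi> s = 0"
    using that by (intro exI[of _ 0]) (auto simp: normal_form_def)
  show ?case
  proof (cases "\<exists>j. Suc j < K \<and> s j \<le> s (Suc j)")
    case True
    then obtain j where j: "Suc j < K" "s j \<le> s (Suc j)" by blast
    define l where "l = s j"
    define p where "p = s (Suc j)"
    have law: "exchange_law (local \<phi> s j)" if "\<phi> \<in> ann m" for \<phi> using that semi ann_iff by blast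
    show ?thesis
    proof (cases "l = p")
      case True
      have "\<phi> s = 0" if "\<phi> \<in> ann m" for \<phi>
        using exchange_law_self[OF law[OF that], of l] local_self[of \<phi> s j] True by (simp add: l_def p_def)
      then show ?thesis by (rule zero)
    next
      case False
      then have lp: "l < p" using j(2) by (simp add: l_def p_def)
      define T where "T = nat ((p - l) div N)"
      \<comment> \<open>d = 0 encodes the swapped pair (p, l), since the unswapped term of the wedge
        law is the one solved for.\<close>
      define A where "A d = (if d = 0 then p else l + int d * N)" for d
      define B where "B d = (if d = 0 then l else p - int d * N)" for d
      define S where "S d = s(j := A d, Suc j := B d)" for d
      have AB: "A d + B d = s j + s (Suc j)" "B d < p" "l \<le> A d" "l \<le> B d" if "d \<le> T" for d
        using div_gap[of l p d] lp that N_pos unfolding T_def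
        by (auto simp: A_def B_def l_def[symmetric] p_def[symmetric] zero_less_mult_iff)
      have lo: "lo \<le> l" using less.prems(2)[of j] j(1) by (simp add: l_def)
      have a1: "\<exists>y. normal_form m (S d) y" if d: "d \<in> {..T}" for d
      proof (rule less.hyps)
        have "potential K lo (S d) = potential K lo s + B d - p"
          unfolding S_def p_def using AB(1) d by (intro potential_update j(1)) auto
        moreover have Slo: "\<And>i. i < K \<Longrightarrow> lo \<le> S d i"
          using less.prems(2) AB(3,4)[of d] d lo by (auto simp: S_def)
        then have "potential K lo (S d) \<ge> 0" unfolding potential_def by (intro sum_nonneg mult_nonneg_nonneg) auto
        ultimately show "nat (potential K lo (S d)) < nat (potential K lo s)" using AB(2)[of d] d by auto
        show "lo \<le> S d i" if "i < K" for i using that by (rule Slo)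
        show "S d i = m - int i" if "K \<le> i" for i
          using that j(1) less.prems(1) by (simp add: S_def)
      qed
      have a2: "energy m (S d) = energy m s" if "d \<in> {..T}" for d
        using AB(1)[of d] that semi by (simp add: S_def energy_update semi_infinite_update)
      have a3: "\<phi> s = (\<Sum>d\<in>{..T}. (if d = 0 then g (l - p) else v - 1) * \<phi> (S d))" if "\<phi> \<in> ann m" for \<phi>
      proof -
        let ?f = "local \<phi> s j"
        have gen: "S1 = c \<Longrightarrow> S1 = F + X \<Longrightarrow> S2 = c + Y \<Longrightarrow> Y = - X \<Longrightarrow> F = P \<Longrightarrow> P = S2" for S1 c F X S2 Y P :: complex
          by (metis add_diff_cancel_right' diff_conv_add_uminus)
        have e1: "(\<Sum>d\<le>T. e_coeff d * ?f (l + int d * N) (p - int d * N)) = g (l - p) * ?f p l"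
          unfolding T_def using law[OF that] lp by (intro wedge_law) auto
        have e2: "(\<Sum>d\<le>T. e_coeff d * ?f (l + int d * N) (p - int d * N))
            = ?f l p + (\<Sum>d\<in>{1..<Suc T}. (1 - v) * ?f (l + int d * N) (p - int d * N))"
          unfolding lessThan_Suc_atMost[symmetric]
          by (subst sum_from1, simp) (auto simp: e_coeff_def intro!: sum.cong)
        have e3: "(\<Sum>d\<le>T. (if d = 0 then g (l - p) else v - 1) * \<phi> (S d))
            = g (l - p) * ?f p l + (\<Sum>d\<in>{1..<Suc T}. (v - 1) * ?f (l + int d * N) (p - int d * N))"
          unfolding lessThan_Suc_atMost[symmetric]
          by (subst sum_from1, simp) (auto simp: S_def A_def B_def local_def intro!: sum.cong)
        have e4: "(\<Sum>d\<in>{1..<Suc T}. (v - 1) * ?f (l + int d * N) (p - int d * N))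
            = - (\<Sum>d\<in>{1..<Suc T}. (1 - v) * ?f (l + int d * N) (p - int d * N))"
          unfolding sum_negf[symmetric] by (intro sum.cong) (simp_all add: algebra_simps)
        have e5: "?f l p = \<phi> s" unfolding l_def p_def by (rule local_self)
        show ?thesis by (rule gen[OF e1 e2 e3 e4 e5])
      qed
      show ?thesis by (rule normal_form_sum[OF finite_atMost a1 a2 a3])
    qed
  next
    case False
    then have dec: "s (Suc j) < s j" if "Suc j < K" for j using that by force
    show ?thesis
    proof (cases "K > 0 \<and> s (K - 1) \<le> m - int K")
      case True
      then obtain K' where K': "K = Suc K'" by (cases K) auto
      have "\<phi> s = 0" if "\<phi> \<in> ann m" for \<phi>
      proof -
        have "s = pre K' s (wcons (s K') (vac (m - int K)))"
          unfolding pre_wcons using less.prems(1) by (auto simp: fun_eq_iff pre_def vac_def K' of_nat_diff)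
        moreover have "(\<lambda>t. \<phi> (pre K' s t)) \<in> ann (m - int K + 1)"
          using ann_pre[OF that, of K' s] by (simp add: K')
        ultimately show ?thesis using wedge_vac_zero[of "\<lambda>t. \<phi> (pre K' s t)" "m - int K" "s K'"] True K' by simp
      qed
      then show ?thesis by (rule zero)
    next
      case last: False
      have "s (Suc j) < s j" for j
      proof -
        consider "Suc j < K" | "Suc j = K" | "K \<le> j" by linarith
        then show ?thesis
        proof cases
          case 2
          then show ?thesis using last less.prems(1)[of K] by auto
        qed (use dec less.prems(1) in auto)
      qed
      then have "s \<in> normal_ordered m" using semi by (simp add: normal_ordered_def)
      then have "normal_form m s (monomial s)" by (simp add: normal_form_def)
      then show ?thesis by blast
    qed
  qed
qed

lemma exists_normal_form:
  assumes "s \<in> semi_infinite m"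
  shows "\<exists>y. normal_form m s y"
proof -
  obtain K where K: "\<And>i. i \<ge> K \<Longrightarrow> s i = m - int i" using assms by (auto simp: semi_infinite_def)
  have "- (\<Sum>i<K. \<bar>s i\<bar>) \<le> s j" if "j < K" for j
  proof -
    have "\<bar>s j\<bar> \<le> (\<Sum>i<K. \<bar>s i\<bar>)" using that by (intro member_le_sum) auto
    then show ?thesis by linarith
  qed
  then show ?thesis using K by (intro straightening[of K s m "- (\<Sum>i<K. \<bar>s i\<bar>)"]) auto
qed

definition nf :: "int \<Rightarrow> wedge_seq \<Rightarrow> wedge_vec" where
  "nf m s = (SOME y. normal_form m s y)"

lemma nf: "s \<in> semi_infinite m \<Longrightarrow> normal_form m s (nf m s)"
  unfolding nf_def using exists_normal_form by (rule someI_ex)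

text \<open>Off \<open>semi_infinite m\<close>, where \<open>nf\<close> carries no information, the
  value is set to 0.\<close>

definition coordinate :: "int \<Rightarrow> wedge_seq \<Rightarrow> wedge_seq \<Rightarrow> complex" where
  "coordinate m \<eta> s = (if s \<in> semi_infinite m then Poly_Mapping.lookup (nf m s) \<eta> else 0)"

definition nf_vec :: "int \<Rightarrow> wedge_vec \<Rightarrow> wedge_vec" where
  "nf_vec m x = (\<Sum>s\<in>Poly_Mapping.keys x. wscale (Poly_Mapping.lookup x s) (nf m s))"

lemma nf_vec:
  assumes "x \<in> free_wedges m"
  shows "Poly_Mapping.keys (nf_vec m x) \<subseteq> normal_ordered m"
    and "\<phi> \<in> ann m \<Longrightarrow> pair \<phi> (nf_vec m x) = pair \<phi> x"
    and "Poly_Mapping.lookup (nf_vec m x) \<eta> = pair (coordinate m \<eta>) x"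
proof -
  have semi: "s \<in> semi_infinite m" if "s \<in> Poly_Mapping.keys x" for s
    using that assms by (auto simp: free_wedges_def)
  have "Poly_Mapping.keys (nf_vec m x)
      \<subseteq> (\<Union>s\<in>Poly_Mapping.keys x. Poly_Mapping.keys (wscale (Poly_Mapping.lookup x s) (nf m s)))"
    unfolding nf_vec_def by (rule Poly_Mapping.keys_sum)
  also have "\<dots> \<subseteq> (\<Union>s\<in>Poly_Mapping.keys x. Poly_Mapping.keys (nf m s))" using keys_wscale by blast
  also have "\<dots> \<subseteq> normal_ordered m"
  proof (rule UN_least)
    fix s assume "s \<in> Poly_Mapping.keys x"
    then show "Poly_Mapping.keys (nf m s) \<subseteq> normal_ordered m"
      using nf[OF semi, of s] unfolding normal_form_def by auto
  qed
  finally show "Poly_Mapping.keys (nf_vec m x) \<subseteq> normal_ordered m" .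
  show "pair \<phi> (nf_vec m x) = pair \<phi> x" if "\<phi> \<in> ann m"
    unfolding nf_vec_def pair_sum pair_wscale unfolding pair_def[of \<phi> x]
    by (intro sum.cong refl) (use nf semi that in \<open>simp add: normal_form_def\<close>)
  show "Poly_Mapping.lookup (nf_vec m x) \<eta> = pair (coordinate m \<eta>) x"
    unfolding nf_vec_def pair_def lookup_sum by (intro sum.cong refl) (simp add: coordinate_def semi)
qed

lemma normal_ordered_eqI:
  assumes "Poly_Mapping.keys x \<subseteq> normal_ordered m" "Poly_Mapping.keys y \<subseteq> normal_ordered m"
    and "\<And>\<phi>. \<phi> \<in> ann m \<Longrightarrow> pair \<phi> x = pair \<phi> y"
  shows "x = y"
proof -
  have "Poly_Mapping.keys (x - y) \<subseteq> normal_ordered m"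
  proof
    fix s assume "s \<in> Poly_Mapping.keys (x - y)"
    then have "s \<in> Poly_Mapping.keys x \<or> s \<in> Poly_Mapping.keys y"
      by (auto simp: in_keys_iff lookup_minus)
    then show "s \<in> normal_ordered m" using assms(1,2) by blast
  qed
  moreover have "x - y \<in> wvec.span (relators n v g m)"
    unfolding span_iff_ann using assms(3) by (simp add: pair_diff)
  ultimately have "x - y = 0" by (rule normal_ordered_independent)
  then show ?thesis by simp
qed

text \<open>Every functional in \<open>ann m\<close> sends the normal form of a relator to 0, so
  that normal form is 0 by independence; the coordinates therefore descend to the Fock
  space.\<close>

lemma coordinate_ann: "coordinate m \<eta> \<in> ann m"
  unfolding ann_def
proof (intro CollectI ballI)
  fix x assume x: "x \<in> relators n v g m"
  then have xf: "x \<in> free_wedges m" using relators_free by blast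
  have "nf_vec m x = 0"
    by (rule normal_ordered_eqI) (use nf_vec[OF xf] x in \<open>auto simp: ann_def\<close>)
  then show "pair (coordinate m \<eta>) x = 0" using nf_vec(3)[OF xf, of \<eta>] by simp
qed

lemma coordinate_normal:
  assumes "\<xi> \<in> normal_ordered m"
  shows "coordinate m \<eta> \<xi> = (if \<xi> = \<eta> then 1 else 0)"
proof -
  have semi: "\<xi> \<in> semi_infinite m" using assms by (simp add: normal_ordered_def)
  have "nf m \<xi> = monomial \<xi>"
    by (rule normal_ordered_eqI[of _ m]) (use nf[OF semi] assms in \<open>auto simp: normal_form_def\<close>)
  then show ?thesis using semi by (simp add: coordinate_def lookup_single when_def)
qed

lemma coordinate_energy: "s \<in> semi_infinite m \<Longrightarrow> energy m s \<noteq> energy m \<eta> \<Longrightarrow> coordinate m \<eta> s = 0"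
  using nf[of s m] by (auto simp: coordinate_def normal_form_def in_keys_iff)

section \<open>The Fock space and the operators J_k in terms of functionals\<close>

lemma fock_class_iff:
  assumes "x \<in> free_wedges m"
  shows "y \<in> fock_class n v g m x \<longleftrightarrow> y \<in> free_wedges m \<and> (\<forall>\<phi>\<in>ann m. pair \<phi> x = pair \<phi> y)"
  using assms by (auto simp: fock_class_def fock_rel_def span_iff_ann pair_diff)

lemma fock_class_eq:
  assumes "x \<in> free_wedges m" "y \<in> free_wedges m" "\<And>\<phi>. \<phi> \<in> ann m \<Longrightarrow> pair \<phi> x = pair \<phi> y"
  shows "fock_class n v g m x = fock_class n v g m y"
  using assms fock_class_iff by auto

text \<open>The definite description is justified: straightening gives existence of the
  normal-ordered representative, independence its uniqueness.\<close>

lemma fock_coeff_eq: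
  assumes "x \<in> free_wedges m"
  shows "fock_coeff m \<eta> (fock_class n v g m x) = pair (coordinate m \<eta>) x"
  unfolding fock_coeff_def
proof (rule the_equality)
  have "normal_ordered m \<subseteq> semi_infinite m" by (auto simp: normal_ordered_def)
  then have "nf_vec m x \<in> fock_class n v g m x"
    unfolding fock_class_iff[OF assms] using nf_vec(1,2)[OF assms] by (auto simp: free_wedges_def)
  then show "\<exists>y\<in>fock_class n v g m x. Poly_Mapping.keys y \<subseteq> normal_ordered m \<and>
      Poly_Mapping.lookup y \<eta> = pair (coordinate m \<eta>) x"
    using nf_vec(1,3)[OF assms] by blast
next
  fix c assume "\<exists>y\<in>fock_class n v g m x. Poly_Mapping.keys y \<subseteq> normal_ordered m \<and> Poly_Mapping.lookup y \<eta> = c"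
  then obtain y where y: "y \<in> fock_class n v g m x" "Poly_Mapping.keys y \<subseteq> normal_ordered m" "Poly_Mapping.lookup y \<eta> = c"
    by blast
  have "y = nf_vec m x"
    by (rule normal_ordered_eqI[OF y(2) nf_vec(1)[OF assms]])
      (use y(1) nf_vec(2)[OF assms] in \<open>simp add: fock_class_iff[OF assms]\<close>)
  then show "c = pair (coordinate m \<eta>) x" using y(3) nf_vec(3)[OF assms] by simp
qed

text \<open>The bound in \<open>deep_shift_zero\<close> is uniform in \<phi>, so the set of summands
  outside the span is finite. An omitted summand is killed by all of \<open>ann m\<close> and
  contributes nothing to the transpose.\<close>

lemma heisenberg_monomial:
  assumes s: "s \<in> semi_infinite m" and k: "k \<noteq> 0"
  shows "heisenberg_monomial n v g m k s \<in> free_wedges m"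
    and "\<phi> \<in> ann m \<Longrightarrow> pair \<phi> (heisenberg_monomial n v g m k s) = Jd k \<phi> s"
proof -
  let ?A = "{j. monomial (s(j := s j - N * k)) \<notin> wvec.span (relators n v g m)}"
  obtain K where K: "\<And>i. i \<ge> K \<Longrightarrow> s i = m - int i" using s by (auto simp: semi_infinite_def)
  have "?A \<subseteq> {..<K + n * nat \<bar>k\<bar>}"
  proof
    fix j assume "j \<in> ?A"
    then obtain \<phi> where "\<phi> \<in> ann m" "\<phi> (s(j := s j - N * k)) \<noteq> 0" by (auto simp: span_iff_ann)
    then show "j \<in> {..<K + n * nat \<bar>k\<bar>}" using deep_shift_zero[of \<phi> m K s k j] K k by (metis lessThan_iff not_le)
  qed
  then have fin: "finite ?A" by (rule finite_subset) simp
  show "heisenberg_monomial n v g m k s \<in> free_wedges m"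
    unfolding heisenberg_monomial_def by (intro free_wedges_sum free_wedges_monomial semi_infinite_update s)
  show "pair \<phi> (heisenberg_monomial n v g m k s) = Jd k \<phi> s" if "\<phi> \<in> ann m"
  proof -
    have "{j. \<phi> (s(j := s j - N * k)) \<noteq> 0} \<subseteq> ?A" using that by (auto simp: span_iff_ann)
    then show ?thesis unfolding heisenberg_monomial_def pair_sum Jd_def pair_monomial
      using fin by (intro Sum_any.expand_superset[symmetric]) auto
  qed
qed

lemma heisenberg_rep:
  assumes x: "x \<in> free_wedges m" and k: "k \<noteq> 0"
  shows "heisenberg_rep n v g m k x \<in> free_wedges m"
    and "\<phi> \<in> ann m \<Longrightarrow> pair \<phi> (heisenberg_rep n v g m k x) = pair (Jd k \<phi>) x"
proof -
  have semi: "s \<in> semi_infinite m" if "s \<in> Poly_Mapping.keys x" for s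
    using that x by (auto simp: free_wedges_def)
  show "heisenberg_rep n v g m k x \<in> free_wedges m"
    unfolding heisenberg_rep_def
    by (intro free_wedges_sum free_wedges_wscale heisenberg_monomial semi k)
  show "pair \<phi> (heisenberg_rep n v g m k x) = pair (Jd k \<phi>) x" if "\<phi> \<in> ann m"
    unfolding heisenberg_rep_def pair_sum pair_wscale unfolding pair_def[of "Jd k \<phi>"]
    by (intro sum.cong refl) (simp add: heisenberg_monomial(2)[OF semi k that])
qed

text \<open>The transposes preserve \<open>ann m\<close>, so all representatives lead to the same
  class and the union in the definition is that single class.\<close>

lemma heisenberg_class:
  assumes x: "x \<in> free_wedges m" and k: "k \<noteq> 0"
  shows "heisenberg n v g m k (fock_class n v g m x) = fock_class n v g m (heisenberg_rep n v g m k x)"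
proof -
  have eq: "fock_class n v g m (heisenberg_rep n v g m k y) = fock_class n v g m (heisenberg_rep n v g m k x)"
    if "y \<in> fock_class n v g m x" for y
  proof -
    have y: "y \<in> free_wedges m" "\<And>\<phi>. \<phi> \<in> ann m \<Longrightarrow> pair \<phi> x = pair \<phi> y"
      using that fock_class_iff[OF x] by auto
    show ?thesis
      by (rule fock_class_eq) (use heisenberg_rep[OF y(1) k] heisenberg_rep[OF x k] y(2) ann_Jd[OF _ k] in auto)
  qed
  have "x \<in> fock_class n v g m x" using fock_class_iff[OF x] x by blast
  then show ?thesis unfolding heisenberg_def using eq by blast
qed

text \<open>Transposition reverses composition: \<open>foldr\<close> applies the head of the list
  last to a vector, so the head acts first on the functional.\<close>

primrec Jl :: "int \<Rightarrow> nat list \<Rightarrow> (wedge_seq \<Rightarrow> complex) \<Rightarrow> wedge_seq \<Rightarrow> complex" where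
  "Jl \<epsilon> [] \<phi> = \<phi>"
| "Jl \<epsilon> (k # ks) \<phi> = Jl \<epsilon> ks (Jd (\<epsilon> * int k) \<phi>)"

lemma foldr_heisenberg:
  assumes "\<epsilon> \<noteq> 0" "0 \<notin> set ks" "\<xi> \<in> semi_infinite m"
  shows "\<exists>x\<in>free_wedges m. foldr (\<lambda>k. heisenberg n v g m (\<epsilon> * int k)) ks (fock_class n v g m (monomial \<xi>)) = fock_class n v g m x
    \<and> (\<forall>\<phi>\<in>ann m. pair \<phi> x = Jl \<epsilon> ks \<phi> \<xi>)"
  using assms(2)
proof (induction ks)
  case Nil
  then show ?case using assms(3) by (auto intro!: bexI[of _ "monomial \<xi>"] free_wedges_monomial)
next
  case (Cons k ks)
  then obtain x where x: "x \<in> free_wedges m"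
    "foldr (\<lambda>k. heisenberg n v g m (\<epsilon> * int k)) ks (fock_class n v g m (monomial \<xi>)) = fock_class n v g m x"
    "\<forall>\<phi>\<in>ann m. pair \<phi> x = Jl \<epsilon> ks \<phi> \<xi>" by auto
  have k: "\<epsilon> * int k \<noteq> 0" using assms(1) Cons.prems by auto
  show ?case
    by (rule bexI[of _ "heisenberg_rep n v g m (\<epsilon> * int k) x"])
      (use x heisenberg_class[OF x(1) k] heisenberg_rep[OF x(1) k] ann_Jd[OF _ k] in auto)
qed

lemma fock_coeff_foldr:
  assumes "\<epsilon> \<noteq> 0" "0 \<notin> set ks" "\<xi> \<in> semi_infinite m"
  shows "fock_coeff m \<eta> (foldr (\<lambda>k. heisenberg n v g m (\<epsilon> * int k)) ks (fock_class n v g m (monomial \<xi>)))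
    = Jl \<epsilon> ks (coordinate m \<eta>) \<xi>"
  using foldr_heisenberg[OF assms] fock_coeff_eq coordinate_ann by auto

end

section \<open>The half-vertex operators\<close>

context fock_params begin

section \<open>The series (1 - v X) / (1 - X) as an exponential\<close>

definition c_coeff :: "nat \<Rightarrow> complex" where
  "c_coeff k = 1 / of_nat k * (1 - v ^ k)"

lemma c_coeff_0 [simp]: "c_coeff 0 = 0"
  by (simp add: c_coeff_def)

lemma of_nat_c_coeff: "of_nat k * c_coeff k = 1 - v ^ k"
  by (cases "k = 0") (simp_all add: c_coeff_def)

text \<open>\<open>c_pow p d\<close> is the coefficient of X^d in c(X)^p / p! for c(X) = \<Sum> c_coeff k X^k, and
  \<open>J_pow \<epsilon> r d\<close> is the dual of the part of degree d in (\<Sum> c_coeff k J_(\<epsilon> k))^r / r!.\<close>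

fun c_pow :: "nat \<Rightarrow> nat \<Rightarrow> complex" where
  "c_pow 0 d = (if d = 0 then 1 else 0)"
| "c_pow (Suc p) d = 1 / of_nat (Suc p) * (\<Sum>k\<le>d. c_coeff k * c_pow p (d - k))"

fun J_pow :: "int \<Rightarrow> nat \<Rightarrow> nat \<Rightarrow> (wedge_seq \<Rightarrow> complex) \<Rightarrow> wedge_seq \<Rightarrow> complex" where
  "J_pow \<epsilon> 0 d \<phi> s = (if d = 0 then \<phi> s else 0)"
| "J_pow \<epsilon> (Suc r) d \<phi> s =
     1 / of_nat (Suc r) * (\<Sum>k\<le>d. c_coeff k * J_pow \<epsilon> r (d - k) (Jd (\<epsilon> * int k) \<phi>) s)"

lemma c_pow_Suc: "of_nat (Suc p) * c_pow (Suc p) d = (\<Sum>k\<le>d. c_coeff k * c_pow p (d - k))"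
  by (simp del: of_nat_Suc)

lemma J_pow_Suc: "of_nat (Suc r) * J_pow \<epsilon> (Suc r) d \<phi> s =
    (\<Sum>k\<le>d. c_coeff k * J_pow \<epsilon> r (d - k) (Jd (\<epsilon> * int k) \<phi>) s)"
  by (simp del: of_nat_Suc)

declare c_pow.simps(2) [simp del] J_pow.simps(2) [simp del]

lemma c_pow_zero: "d < p \<Longrightarrow> c_pow p d = 0"
proof (induction p arbitrary: d)
  case (Suc p)
  have "c_coeff k * c_pow p (d - k) = 0" if "k \<le> d" for k
    using Suc that by (cases "k = 0") auto
  then have "(\<Sum>k\<le>d. c_coeff k * c_pow p (d - k)) = 0" by (intro sum.neutral) blast
  then show ?case by (simp add: c_pow.simps(2))
qed simp

lemma J_pow_zero: "d < r \<Longrightarrow> J_pow \<epsilon> r d \<phi> s = 0"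
proof (induction r arbitrary: d \<phi>)
  case (Suc r)
  have "c_coeff k * J_pow \<epsilon> r (d - k) (Jd (\<epsilon> * int k) \<phi>) s = 0" if "k \<le> d" for k
    using Suc that by (cases "k = 0") auto
  then have "(\<Sum>k\<le>d. c_coeff k * J_pow \<epsilon> r (d - k) (Jd (\<epsilon> * int k) \<phi>) s) = 0" by (intro sum.neutral) blast
  then show ?case by (simp add: J_pow.simps(2))
qed simp

text \<open>Coefficientwise this is X d/dX (c^(p+1) / (p+1)!) = X c' c^p / p! with X c' = \<Sum> (1
  - v^k) X^k. The induction on p uses the Leibniz rule in the form d = k + (d - k).\<close>

lemma c_pow_derivative: "of_nat d * c_pow (Suc p) d = (\<Sum>k\<le>d. (1 - v ^ k) * c_pow p (d - k))"
proof (induction p arbitrary: d)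
  case 0
  have "of_nat d * c_pow (Suc 0) d = of_nat d * (\<Sum>k\<in>{d}. c_coeff k * c_pow 0 (d - k))"
    by (simp only: c_pow.simps(2)) (subst sum.mono_neutral_right[of "{..d}" "{d}"]; auto)
  moreover have "(\<Sum>k\<le>d. (1 - v ^ k) * c_pow 0 (d - k)) = (\<Sum>k\<in>{d}. (1 - v ^ k) * c_pow 0 (d - k))"
    by (rule sum.mono_neutral_right) auto
  ultimately show ?case using of_nat_c_coeff[of d] by simp
next
  case (Suc p)
  let ?n = "of_nat (Suc p) :: complex"
  have "of_nat (Suc (Suc p)) * (of_nat d * c_pow (Suc (Suc p)) d)
      = of_nat d * (\<Sum>k\<le>d. c_coeff k * c_pow (Suc p) (d - k))"
    using c_pow_Suc[of "Suc p" d] by (metis mult.left_commute)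
  also have "\<dots> = (\<Sum>k\<le>d. (1 - v ^ k) * c_pow (Suc p) (d - k))
      + (\<Sum>k\<le>d. c_coeff k * (of_nat (d - k) * c_pow (Suc p) (d - k)))"
    unfolding sum_distrib_left sum.distrib[symmetric]
    by (intro sum.cong refl) (simp add: of_nat_c_coeff[symmetric] of_nat_diff algebra_simps)
  also have "(\<Sum>k\<le>d. c_coeff k * (of_nat (d - k) * c_pow (Suc p) (d - k)))
      = (\<Sum>k\<le>d. \<Sum>l\<le>d - k. c_coeff k * ((1 - v ^ l) * c_pow p (d - k - l)))"
    unfolding Suc sum_distrib_left ..
  also have "\<dots> = (\<Sum>l\<le>d. \<Sum>k\<le>d - l. c_coeff k * ((1 - v ^ l) * c_pow p (d - k - l)))"
    by (rule sum_triangle_swap)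
  also have "\<dots> = (\<Sum>l\<le>d. (1 - v ^ l) * (\<Sum>k\<le>d - l. c_coeff k * c_pow p (d - l - k)))"
    unfolding sum_distrib_left by (intro sum.cong refl) (simp add: add.commute)
  also have "\<dots> = ?n * (\<Sum>l\<le>d. (1 - v ^ l) * c_pow (Suc p) (d - l))"
    unfolding c_pow_Suc[symmetric] sum_distrib_left by (intro sum.cong refl) (simp add: mult_ac)
  finally have "of_nat (Suc (Suc p)) * (of_nat d * c_pow (Suc (Suc p)) d)
      = of_nat (Suc (Suc p)) * (\<Sum>k\<le>d. (1 - v ^ k) * c_pow (Suc p) (d - k))"
    by (simp add: algebra_simps)
  then show ?case by (metis mult_left_cancel of_nat_eq_0_iff nat.distinct(1))
qed

text \<open>The same differential equation X E' = X c' E, now for E = (1 - v X) / (1 - X).\<close>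

lemma e_coeff_derivative: "(\<Sum>k\<le>d. (1 - v ^ k) * e_coeff (d - k)) = of_nat d * e_coeff d"
proof -
  have geo: "(\<Sum>k<d. (1 - v ^ k) * (1 - v)) = of_nat d * (1 - v) - (1 - v ^ d)" for d
    by (induction d) (simp_all add: algebra_simps)
  have "(\<Sum>k\<le>d. (1 - v ^ k) * e_coeff (d - k)) = (\<Sum>k<d. (1 - v ^ k) * e_coeff (d - k)) + (1 - v ^ d)"
    by (simp add: e_coeff_def flip: lessThan_Suc_atMost)
  also have "(\<Sum>k<d. (1 - v ^ k) * e_coeff (d - k)) = (\<Sum>k<d. (1 - v ^ k) * (1 - v))"
    by (intro sum.cong) (auto simp: e_coeff_def)
  finally show ?thesis unfolding geo by (cases "d = 0") (simp_all add: e_coeff_def)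
qed

text \<open>Both sides solve the same differential equation and agree at d = 0. The partial sum
  suffices because c has no constant term, whence \<open>c_pow p d\<close> = 0 for p > d.\<close>

lemma sum_c_pow: "d \<le> P \<Longrightarrow> (\<Sum>p\<le>P. c_pow p d) = e_coeff d"
proof (induction d arbitrary: P rule: less_induct)
  case (less d)
  show ?case
  proof (cases "d = 0")
    case True
    have "(\<Sum>p\<le>P. c_pow p d) = (\<Sum>p\<in>{0}. c_pow p d)"
      using True by (intro sum.mono_neutral_right) (auto simp: c_pow_zero)
    then show ?thesis using True by (simp add: e_coeff_def)
  next
    case False
    then obtain P' where P': "P = Suc P'" using less.prems by (cases P) auto
    have "(\<Sum>p\<le>P. c_pow p d) = (\<Sum>p\<le>P'. c_pow (Suc p) d)"
      unfolding P' sum.atMost_Suc_shift using False by simp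
    then have "of_nat d * (\<Sum>p\<le>P. c_pow p d) = (\<Sum>p\<le>P'. \<Sum>k\<le>d. (1 - v ^ k) * c_pow p (d - k))"
      by (simp only: sum_distrib_left c_pow_derivative)
    also have "\<dots> = (\<Sum>k\<le>d. (1 - v ^ k) * (\<Sum>p\<le>P'. c_pow p (d - k)))"
      unfolding sum_distrib_left by (rule sum.swap)
    also have "\<dots> = (\<Sum>k\<le>d. (1 - v ^ k) * e_coeff (d - k))"
    proof (intro sum.cong refl)
      fix k assume "k \<in> {..d}"
      show "(1 - v ^ k) * (\<Sum>p\<le>P'. c_pow p (d - k)) = (1 - v ^ k) * e_coeff (d - k)"
        using less.IH[of "d - k" P'] less.prems False P' by (cases "k = 0") auto
    qed
    also have "\<dots> = of_nat d * e_coeff d" by (rule e_coeff_derivative)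
    finally show ?thesis using False by simp
  qed
qed

section \<open>The exponential on a wedge with a first factor\<close>

lemma ann_add:
  assumes "\<phi> \<in> ann m" "\<psi> \<in> ann m"
  shows "(\<lambda>s. \<phi> s + \<psi> s) \<in> ann m"
proof -
  have "pair (\<lambda>s. \<phi> s + \<psi> s) x = pair \<phi> x + pair \<psi> x" for x
    unfolding pair_def by (simp add: sum.distrib algebra_simps)
  then show ?thesis using assms by (simp add: ann_def)
qed

lemma Jd_add:
  assumes "\<phi> \<in> ann m" "\<psi> \<in> ann m" "k \<noteq> 0" "s \<in> semi_infinite m"
  shows "Jd k (\<lambda>s. \<phi> s + \<psi> s) s = Jd k \<phi> s + Jd k \<psi> s"
proof -
  obtain K where K: "\<And>i. i \<ge> K \<Longrightarrow> s i = m - int i" using assms(4) by (auto simp: semi_infinite_def)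
  have J: "Jd k \<chi> s = (\<Sum>i<K + n * nat \<bar>k\<bar>. \<chi> (s(i := s i - N * k)))" if "\<chi> \<in> ann m" for \<chi>
    using Jd_sum[OF that, of K s k] K assms(3) by blast
  show ?thesis unfolding J[OF assms(1)] J[OF assms(2)] J[OF ann_add[OF assms(1,2)]] sum.distrib ..
qed

lemma J_pow_cong:
  assumes "\<And>s. s \<in> semi_infinite m \<Longrightarrow> \<phi> s = \<psi> s" "s \<in> semi_infinite m"
  shows "J_pow \<epsilon> r d \<phi> s = J_pow \<epsilon> r d \<psi> s"
  using assms
proof (induction r arbitrary: d \<phi> \<psi>)
  case (Suc r)
  have "J_pow \<epsilon> r (d - k) (Jd (\<epsilon> * int k) \<phi>) s = J_pow \<epsilon> r (d - k) (Jd (\<epsilon> * int k) \<psi>) s" for k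
    by (rule Suc.IH[OF Jd_cong[OF Suc.prems(1)] Suc.prems(2)])
  then show ?case by (simp add: J_pow.simps(2))
qed simp

text \<open>Membership in \<open>ann m\<close> makes the sums in \<open>Jd\<close> finite and hence
  additive. The index k = 0, to which this does not apply, is removed by \<open>c_coeff 0\<close> =
  0.\<close>

lemma J_pow_add:
  assumes "\<phi> \<in> ann m" "\<psi> \<in> ann m" "\<epsilon> \<noteq> 0" "s \<in> semi_infinite m"
  shows "J_pow \<epsilon> r d (\<lambda>s. \<phi> s + \<psi> s) s = J_pow \<epsilon> r d \<phi> s + J_pow \<epsilon> r d \<psi> s"
  using assms(1,2)
proof (induction r arbitrary: d \<phi> \<psi>)
  case (Suc r)
  have "c_coeff k * J_pow \<epsilon> r (d - k) (Jd (\<epsilon> * int k) (\<lambda>s. \<phi> s + \<psi> s)) s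
     = c_coeff k * J_pow \<epsilon> r (d - k) (Jd (\<epsilon> * int k) \<phi>) s + c_coeff k * J_pow \<epsilon> r (d - k) (Jd (\<epsilon> * int k) \<psi>) s" for k
  proof (cases "k = 0")
    case False
    then have k: "\<epsilon> * int k \<noteq> 0" using assms(3) by simp
    have "J_pow \<epsilon> r (d - k) (Jd (\<epsilon> * int k) (\<lambda>s. \<phi> s + \<psi> s)) s
        = J_pow \<epsilon> r (d - k) (\<lambda>s. Jd (\<epsilon> * int k) \<phi> s + Jd (\<epsilon> * int k) \<psi> s) s"
      by (rule J_pow_cong[OF Jd_add[OF Suc.prems k] assms(4)])
    also have "\<dots> = J_pow \<epsilon> r (d - k) (Jd (\<epsilon> * int k) \<phi>) s + J_pow \<epsilon> r (d - k) (Jd (\<epsilon> * int k) \<psi>) s"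
      using Suc.prems by (intro Suc.IH ann_Jd k)
    finally show ?thesis by (simp add: distrib_left)
  qed simp
  then show ?case by (simp add: J_pow.simps(2) sum.distrib distrib_left)
qed simp

text \<open>The binomial theorem for divided powers: on u_a \<and> s the operator H is the sum of
  two commuting parts, one acting on u_a and one on s. In the induction one more factor of H is
  applied to either part; with q of the r + 1 factors on u_a, the two ways contribute q and r + 1 -
  q times the same term, together r + 1.\<close>

lemma J_pow_wcons:
  assumes "\<phi> \<in> ann (m + 1)" "\<epsilon> \<noteq> 0" "s \<in> semi_infinite m"
  shows "J_pow \<epsilon> r d \<phi> (wcons a s)
    = (\<Sum>p\<le>r. \<Sum>D\<le>d. c_pow p D * J_pow \<epsilon> (r - p) (d - D) (\<lambda>t. \<phi> (wcons (a - N * \<epsilon> * int D) t)) s)"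
  using assms(1)
proof (induction r arbitrary: d \<phi>)
  case 0
  have "(\<Sum>D\<le>d. c_pow 0 D * J_pow \<epsilon> 0 (d - D) (\<lambda>t. \<phi> (wcons (a - N * \<epsilon> * int D) t)) s)
     = (\<Sum>D\<in>{0}. c_pow 0 D * J_pow \<epsilon> 0 (d - D) (\<lambda>t. \<phi> (wcons (a - N * \<epsilon> * int D) t)) s)"
    by (rule sum.mono_neutral_right) auto
  then show ?case by simp
next
  case (Suc r)
  define \<Phi> where "\<Phi> D = (\<lambda>t. \<phi> (wcons (a - N * \<epsilon> * int D) t))" for D
  have \<Phi>: "\<Phi> D \<in> ann m" for D unfolding \<Phi>_def by (rule ann_wcons[OF Suc.prems])
  have J: "c_coeff k * J_pow \<epsilon> r (d - k) (Jd (\<epsilon> * int k) \<phi>) (wcons a s)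
     = (\<Sum>p\<le>r. \<Sum>D\<le>d - k. c_coeff k * c_pow p D * J_pow \<epsilon> (r - p) (d - k - D) (\<Phi> (k + D)) s)
     + (\<Sum>p\<le>r. \<Sum>D\<le>d - k. c_pow p D * (c_coeff k * J_pow \<epsilon> (r - p) (d - k - D) (Jd (\<epsilon> * int k) (\<Phi> D)) s))" for k
  proof (cases "k = 0")
    case False
    then have k: "\<epsilon> * int k \<noteq> 0" using assms(2) by simp
    have X: "J_pow \<epsilon> q e (\<lambda>t. Jd (\<epsilon> * int k) \<phi> (wcons (a - N * \<epsilon> * int D) t)) s
        = J_pow \<epsilon> q e (\<Phi> (k + D)) s + J_pow \<epsilon> q e (Jd (\<epsilon> * int k) (\<Phi> D)) s" for q e D
    proof -
      have E: "Jd (\<epsilon> * int k) \<phi> (wcons (a - N * \<epsilon> * int D) t) = \<Phi> (k + D) t + Jd (\<epsilon> * int k) (\<Phi> D) t"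
        if "t \<in> semi_infinite m" for t
        unfolding Jd_wcons[OF Suc.prems that k] \<Phi>_def by (simp add: algebra_simps)
      have "J_pow \<epsilon> q e (\<lambda>t. Jd (\<epsilon> * int k) \<phi> (wcons (a - N * \<epsilon> * int D) t)) s
          = J_pow \<epsilon> q e (\<lambda>t. \<Phi> (k + D) t + Jd (\<epsilon> * int k) (\<Phi> D) t) s"
        by (rule J_pow_cong[OF E assms(3)])
      then show ?thesis using J_pow_add[OF \<Phi> ann_Jd[OF \<Phi> k] assms(2,3)] by simp
    qed
    show ?thesis
      unfolding Suc.IH[OF ann_Jd[OF Suc.prems k]] X sum_distrib_left sum.distrib[symmetric]
      by (intro sum.cong refl) (simp add: algebra_simps)
  qed simp
  have "of_nat (Suc r) * J_pow \<epsilon> (Suc r) d \<phi> (wcons a s)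
     = (\<Sum>k\<le>d. \<Sum>p\<le>r. \<Sum>D\<le>d - k. c_coeff k * c_pow p D * J_pow \<epsilon> (r - p) (d - k - D) (\<Phi> (k + D)) s)
     + (\<Sum>k\<le>d. \<Sum>p\<le>r. \<Sum>D\<le>d - k. c_pow p D * (c_coeff k * J_pow \<epsilon> (r - p) (d - k - D) (Jd (\<epsilon> * int k) (\<Phi> D)) s))"
    unfolding J_pow_Suc J sum.distrib ..
  also have "(\<Sum>k\<le>d. \<Sum>p\<le>r. \<Sum>D\<le>d - k. c_coeff k * c_pow p D * J_pow \<epsilon> (r - p) (d - k - D) (\<Phi> (k + D)) s)
     = (\<Sum>p\<le>r. of_nat (Suc p) * (\<Sum>E\<le>d. c_pow (Suc p) E * J_pow \<epsilon> (r - p) (d - E) (\<Phi> E) s))"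
    (is "?L = _")
  proof -
    have "?L = (\<Sum>p\<le>r. \<Sum>k\<le>d. \<Sum>D\<le>d - k. c_coeff k * c_pow p D * J_pow \<epsilon> (r - p) (d - k - D) (\<Phi> (k + D)) s)"
      by (rule sum.swap)
    also have "\<dots> = (\<Sum>p\<le>r. \<Sum>E\<le>d. \<Sum>k\<le>E. c_coeff k * c_pow p (E - k) * J_pow \<epsilon> (r - p) (d - E) (\<Phi> E) s)"
      unfolding sum_triangle by (intro sum.cong refl) (simp add: diff_diff_eq)
    also have "\<dots> = (\<Sum>p\<le>r. of_nat (Suc p) * (\<Sum>E\<le>d. c_pow (Suc p) E * J_pow \<epsilon> (r - p) (d - E) (\<Phi> E) s))"
      unfolding sum_distrib_right[symmetric] c_pow_Suc[symmetric] by (simp add: sum_distrib_left mult.assoc)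
    finally show ?thesis .
  qed
  also have "(\<Sum>k\<le>d. \<Sum>p\<le>r. \<Sum>D\<le>d - k. c_pow p D * (c_coeff k * J_pow \<epsilon> (r - p) (d - k - D) (Jd (\<epsilon> * int k) (\<Phi> D)) s))
     = (\<Sum>p\<le>r. of_nat (Suc (r - p)) * (\<Sum>D\<le>d. c_pow p D * J_pow \<epsilon> (Suc (r - p)) (d - D) (\<Phi> D) s))"
    (is "?L = _")
  proof -
    have "?L = (\<Sum>p\<le>r. \<Sum>k\<le>d. \<Sum>D\<le>d - k. c_pow p D * (c_coeff k * J_pow \<epsilon> (r - p) (d - k - D) (Jd (\<epsilon> * int k) (\<Phi> D)) s))"
      by (rule sum.swap)
    also have "\<dots> = (\<Sum>p\<le>r. \<Sum>D\<le>d. \<Sum>k\<le>d - D. c_pow p D * (c_coeff k * J_pow \<epsilon> (r - p) (d - D - k) (Jd (\<epsilon> * int k) (\<Phi> D)) s))"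
      by (subst sum_triangle_swap) (simp add: add.commute)
    also have "\<dots> = (\<Sum>p\<le>r. of_nat (Suc (r - p)) * (\<Sum>D\<le>d. c_pow p D * J_pow \<epsilon> (Suc (r - p)) (d - D) (\<Phi> D) s))"
      unfolding sum_distrib_left[symmetric] J_pow_Suc[symmetric] by (simp add: sum_distrib_left mult_ac)
    finally show ?thesis .
  qed
  finally have A: "of_nat (Suc r) * J_pow \<epsilon> (Suc r) d \<phi> (wcons a s)
     = (\<Sum>p\<le>r. of_nat (Suc p) * (\<Sum>E\<le>d. c_pow (Suc p) E * J_pow \<epsilon> (r - p) (d - E) (\<Phi> E) s))
     + (\<Sum>p\<le>r. of_nat (Suc (r - p)) * (\<Sum>D\<le>d. c_pow p D * J_pow \<epsilon> (Suc (r - p)) (d - D) (\<Phi> D) s))" .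
  define X where "X q = (\<Sum>D\<le>d. c_pow q D * J_pow \<epsilon> (Suc r - q) (d - D) (\<Phi> D) s)" for q
  have "(\<Sum>p\<le>r. of_nat (Suc p) * (\<Sum>E\<le>d. c_pow (Suc p) E * J_pow \<epsilon> (r - p) (d - E) (\<Phi> E) s))
      = (\<Sum>q\<le>Suc r. of_nat q * X q)"
    unfolding sum.atMost_Suc_shift X_def by simp
  moreover have "(\<Sum>p\<le>r. of_nat (Suc (r - p)) * (\<Sum>D\<le>d. c_pow p D * J_pow \<epsilon> (Suc (r - p)) (d - D) (\<Phi> D) s))
      = (\<Sum>q\<le>Suc r. of_nat (Suc r - q) * X q)"
    unfolding sum.atMost_Suc X_def by (simp add: Suc_diff_le)
  moreover have "(\<Sum>q\<le>Suc r. of_nat q * X q) + (\<Sum>q\<le>Suc r. of_nat (Suc r - q) * X q) = of_nat (Suc r) * (\<Sum>q\<le>Suc r. X q)"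
  proof -
    have "of_nat q * X q + of_nat (Suc r - q) * X q = of_nat (Suc r) * X q" if "q \<in> {..Suc r}" for q
      using that unfolding distrib_right[symmetric] of_nat_add[symmetric] by simp
    then show ?thesis unfolding sum.distrib[symmetric] sum_distrib_left by (intro sum.cong) auto
  qed
  ultimately have "of_nat (Suc r) * J_pow \<epsilon> (Suc r) d \<phi> (wcons a s) = of_nat (Suc r) * (\<Sum>q\<le>Suc r. X q)"
    unfolding A by simp
  then have "J_pow \<epsilon> (Suc r) d \<phi> (wcons a s) = (\<Sum>q\<le>Suc r. X q)"
    by (metis mult_left_cancel of_nat_eq_0_iff nat.distinct(1))
  then show ?case unfolding X_def \<Phi>_def .
qed

text \<open>The dual of the part of degree d in e^H.\<close>

definition G :: "int \<Rightarrow> nat \<Rightarrow> (wedge_seq \<Rightarrow> complex) \<Rightarrow> wedge_seq \<Rightarrow> complex" where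
  "G \<epsilon> d \<phi> s = (\<Sum>r\<le>d. J_pow \<epsilon> r d \<phi> s)"

lemma G_0 [simp]: "G \<epsilon> 0 \<phi> s = \<phi> s"
  by (simp add: G_def)

text \<open>Summing the binomial formula over r decouples the two parts: only p \<le> D contributes,
  and then the range of q is complete because divided powers of order above the degree
  vanish.\<close>

lemma G_wcons:
  assumes "\<phi> \<in> ann (m + 1)" "\<epsilon> \<noteq> 0" "s \<in> semi_infinite m"
  shows "G \<epsilon> d \<phi> (wcons a s)
    = (\<Sum>D\<le>d. e_coeff D * G \<epsilon> (d - D) (\<lambda>t. \<phi> (wcons (a - N * \<epsilon> * int D) t)) s)"
proof -
  define \<Phi> where "\<Phi> D = (\<lambda>t. \<phi> (wcons (a - N * \<epsilon> * int D) t))" for D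
  have "G \<epsilon> d \<phi> (wcons a s) = (\<Sum>r\<le>d. \<Sum>p\<le>r. \<Sum>D\<le>d. c_pow p D * J_pow \<epsilon> (r - p) (d - D) (\<Phi> D) s)"
    unfolding G_def J_pow_wcons[OF assms] \<Phi>_def ..
  also have "\<dots> = (\<Sum>p\<le>d. \<Sum>q\<le>d - p. \<Sum>D\<le>d. c_pow p D * J_pow \<epsilon> q (d - D) (\<Phi> D) s)"
    by (rule sum_triangle[symmetric])
  also have "\<dots> = (\<Sum>p\<le>d. \<Sum>D\<le>d. \<Sum>q\<le>d - p. c_pow p D * J_pow \<epsilon> q (d - D) (\<Phi> D) s)"
    by (rule sum.cong[OF refl], rule sum.swap)
  also have "\<dots> = (\<Sum>D\<le>d. \<Sum>p\<le>d. \<Sum>q\<le>d - p. c_pow p D * J_pow \<epsilon> q (d - D) (\<Phi> D) s)"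
    by (rule sum.swap)
  also have "\<dots> = (\<Sum>D\<le>d. \<Sum>p\<le>d. c_pow p D * G \<epsilon> (d - D) (\<Phi> D) s)"
  proof (intro sum.cong refl)
    fix D p assume D: "D \<in> {..d}" "p \<in> {..d}"
    show "(\<Sum>q\<le>d - p. c_pow p D * J_pow \<epsilon> q (d - D) (\<Phi> D) s) = c_pow p D * G \<epsilon> (d - D) (\<Phi> D) s"
    proof (cases "p \<le> D")
      case True
      have "(\<Sum>q\<le>d - p. J_pow \<epsilon> q (d - D) (\<Phi> D) s) = (\<Sum>q\<le>d - D. J_pow \<epsilon> q (d - D) (\<Phi> D) s)"
        using True by (intro sum.mono_neutral_right) (auto simp: J_pow_zero)
      then show ?thesis by (simp add: G_def flip: sum_distrib_left)
    next
      case False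
      then show ?thesis by (simp add: c_pow_zero)
    qed
  qed
  also have "\<dots> = (\<Sum>D\<le>d. e_coeff D * G \<epsilon> (d - D) (\<Phi> D) s)"
    unfolding sum_distrib_right[symmetric] by (intro sum.cong refl) (simp add: sum_c_pow)
  finally show ?thesis unfolding \<Phi>_def .
qed

lemma J_pow_energy:
  assumes "\<And>s. s \<in> semi_infinite m \<Longrightarrow> energy m s = E \<Longrightarrow> \<phi> s = 0"
    and "s \<in> semi_infinite m" "energy m s = E + N * \<epsilon> * int d"
  shows "J_pow \<epsilon> r d \<phi> s = 0"
  using assms(1,3)
proof (induction r arbitrary: d \<phi> E)
  case (Suc r)
  have "J_pow \<epsilon> r (d - k) (Jd (\<epsilon> * int k) \<phi>) s = 0" if "k \<le> d" for k
  proof (rule Suc.IH)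
    show "Jd (\<epsilon> * int k) \<phi> t = 0" if "t \<in> semi_infinite m" "energy m t = E + N * (\<epsilon> * int k)" for t
      by (rule Jd_energy[OF Suc.prems(1) that])
    show "energy m s = E + N * (\<epsilon> * int k) + N * \<epsilon> * int (d - k)"
      using Suc.prems(2) that by (simp add: of_nat_diff algebra_simps)
  qed
  then show ?case by (simp add: J_pow.simps(2))
qed (use assms(2) in simp)

lemma G_energy:
  assumes "\<And>s. s \<in> semi_infinite m \<Longrightarrow> energy m s = E \<Longrightarrow> \<phi> s = 0"
    and "s \<in> semi_infinite m" "energy m s = E + N * \<epsilon> * int d"
  shows "G \<epsilon> d \<phi> s = 0"
  unfolding G_def by (intro sum.neutral ballI) (rule J_pow_energy[OF assms])

section \<open>Comparison with the expansion of e^H over lists\<close>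

definition compositions :: "nat \<Rightarrow> nat \<Rightarrow> nat list set" where
  "compositions r d = {ks. length ks = r \<and> 0 \<notin> set ks \<and> sum_list ks = d}"

lemma compositions_Suc: "compositions (Suc r) d = (\<Union>k\<in>{1..d}. (#) k ` compositions r (d - k))"
  by (auto simp: compositions_def length_Suc_conv image_iff)

lemma finite_compositions: "finite (compositions r d)"
proof (induction r arbitrary: d)
  case 0
  have "compositions 0 d \<subseteq> {[]}" by (auto simp: compositions_def)
  then show ?case by (rule finite_subset) simp
qed (simp add: compositions_Suc)

text \<open>Splitting off the head of a list is the recursion of \<open>J_pow\<close>; the factor r!
  undoes its divisions.\<close>

lemma sum_compositions:
  "(\<Sum>ks\<in>compositions r d. prod_list (map c_coeff ks) * Jl \<epsilon> ks \<phi> s) = fact r * J_pow \<epsilon> r d \<phi> s"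
proof (induction r arbitrary: d \<phi>)
  case 0
  have "compositions 0 d = (if d = 0 then {[]} else {})" by (auto simp: compositions_def)
  then show ?case by simp
next
  case (Suc r)
  have "(\<Sum>ks\<in>compositions (Suc r) d. prod_list (map c_coeff ks) * Jl \<epsilon> ks \<phi> s)
      = (\<Sum>k\<in>{1..d}. \<Sum>ks\<in>(#) k ` compositions r (d - k). prod_list (map c_coeff ks) * Jl \<epsilon> ks \<phi> s)"
    unfolding compositions_Suc by (rule sum.UNION_disjoint) (auto simp: finite_compositions)
  also have "\<dots> = (\<Sum>k\<in>{1..d}. c_coeff k * (\<Sum>ks\<in>compositions r (d - k). prod_list (map c_coeff ks) * Jl \<epsilon> ks (Jd (\<epsilon> * int k) \<phi>) s))"
    by (intro sum.cong refl) (subst sum.reindex; simp add: sum_distrib_left mult.assoc)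
  also have "\<dots> = (\<Sum>k\<in>{1..d}. c_coeff k * (fact r * J_pow \<epsilon> r (d - k) (Jd (\<epsilon> * int k) \<phi>) s))"
    unfolding Suc ..
  also have "\<dots> = (\<Sum>k\<le>d. c_coeff k * (fact r * J_pow \<epsilon> r (d - k) (Jd (\<epsilon> * int k) \<phi>) s))"
    by (rule sum.mono_neutral_left) (auto simp: not_less_eq_eq)
  also have "\<dots> = fact r * (of_nat (Suc r) * J_pow \<epsilon> (Suc r) d \<phi> s)"
    unfolding J_pow_Suc sum_distrib_left by (intro sum.cong refl) (simp add: mult_ac)
  finally show ?case by (simp add: mult_ac)
qed

lemma Jl_energy:
  assumes "\<And>s. s \<in> semi_infinite m \<Longrightarrow> energy m s \<noteq> E \<Longrightarrow> \<phi> s = 0"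
    and "s \<in> semi_infinite m" "energy m s \<noteq> E + N * \<epsilon> * int (sum_list ks)"
  shows "Jl \<epsilon> ks \<phi> s = 0"
  using assms(1,3)
proof (induction ks arbitrary: \<phi> E)
  case (Cons k ks)
  have "Jl \<epsilon> ks (Jd (\<epsilon> * int k) \<phi>) s = 0"
  proof (rule Cons.IH)
    show "energy m s \<noteq> (E + N * \<epsilon> * int k) + N * \<epsilon> * int (sum_list ks)"
      using Cons.prems(2) by (simp add: algebra_simps)
    fix t assume t: "t \<in> semi_infinite m" "energy m t \<noteq> E + N * \<epsilon> * int k"
    show "Jd (\<epsilon> * int k) \<phi> t = 0"
    proof (rule Jd_energy[OF _ t(1)])
      show "energy m t = (energy m t - N * (\<epsilon> * int k)) + N * (\<epsilon> * int k)" by simp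
      show "\<phi> s = 0" if "s \<in> semi_infinite m" "energy m s = energy m t - N * (\<epsilon> * int k)" for s
        using Cons.prems(1) that t(2) by (auto simp: mult.assoc)
    qed
  qed
  then show ?case by simp
qed (use assms(2) in simp)

text \<open>Only lists of positive numbers whose sum accounts for the energy difference contribute,
  and their length is at most that sum; so the sum over all lists is a finite one and equals the
  part of degree d.\<close>

lemma half_vertex_coeff_eq:
  assumes "\<epsilon> \<noteq> 0" "z \<noteq> 0" "\<xi> \<in> semi_infinite m"
  shows "energy m \<xi> = energy m \<eta> + N * \<epsilon> * int d \<Longrightarrow>
      half_vertex_coeff n v g m \<epsilon> z \<eta> \<xi> = z powi (\<epsilon> * N * int d) * G \<epsilon> d (coordinate m \<eta>) \<xi>"
    and "(\<And>d. energy m \<xi> \<noteq> energy m \<eta> + N * \<epsilon> * int d) \<Longrightarrow> half_vertex_coeff n v g m \<epsilon> z \<eta> \<xi> = 0"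
proof -
  let ?\<kappa> = "coordinate m \<eta>"
  define trm where "trm = (\<lambda>ks. if 0 \<in> set ks then 0 else
       1 / fact (length ks) * (\<Prod>k\<leftarrow>ks. 1 / of_nat k * (1 - v ^ k) * z powi (\<epsilon> * N * int k))
       * fock_coeff m \<eta> (foldr (\<lambda>k. heisenberg n v g m (\<epsilon> * int k)) ks (fock_class n v g m (monomial \<xi>))))"
  have H: "half_vertex_coeff n v g m \<epsilon> z \<eta> \<xi> = Sum_any trm"
    unfolding half_vertex_coeff_def trm_def ..
  have prod: "(\<Prod>k\<leftarrow>ks. 1 / of_nat k * (1 - v ^ k) * z powi (\<epsilon> * N * int k))
      = prod_list (map c_coeff ks) * z powi (\<epsilon> * N * int (sum_list ks))" for ks
    using assms(2) by (induction ks) (simp_all add: c_coeff_def power_int_add distrib_left)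
  have t: "trm ks = (if 0 \<in> set ks then 0 else
       1 / fact (length ks) * (prod_list (map c_coeff ks) * z powi (\<epsilon> * N * int (sum_list ks))) * Jl \<epsilon> ks ?\<kappa> \<xi>)" for ks
    unfolding trm_def prod using fock_coeff_foldr[OF assms(1) _ assms(3)] by simp
  have supp: "energy m \<xi> = energy m \<eta> + N * \<epsilon> * int (sum_list ks) \<and> 0 \<notin> set ks" if "trm ks \<noteq> 0" for ks
  proof -
    have "0 \<notin> set ks" "Jl \<epsilon> ks ?\<kappa> \<xi> \<noteq> 0" using that unfolding t by (auto split: if_splits)
    then show ?thesis using Jl_energy[of m "energy m \<eta>" ?\<kappa> \<xi> \<epsilon> ks] coordinate_energy assms(3) by blast
  qed
  show "half_vertex_coeff n v g m \<epsilon> z \<eta> \<xi> = 0" if no: "\<And>d. energy m \<xi> \<noteq> energy m \<eta> + N * \<epsilon> * int d"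
  proof -
    have "trm ks = 0" for ks using supp no by blast
    then show ?thesis unfolding H by simp
  qed
  show "half_vertex_coeff n v g m \<epsilon> z \<eta> \<xi> = z powi (\<epsilon> * N * int d) * G \<epsilon> d ?\<kappa> \<xi>"
    if d: "energy m \<xi> = energy m \<eta> + N * \<epsilon> * int d"
  proof -
    let ?A = "\<Union>r\<in>{..d}. compositions r d"
    have len: "length ks \<le> sum_list ks" if "0 \<notin> set ks" for ks :: "nat list"
      using that by (induction ks) auto
    have "{ks. trm ks \<noteq> 0} \<subseteq> ?A"
    proof
      fix ks assume "ks \<in> {ks. trm ks \<noteq> 0}"
      then have s: "energy m \<xi> = energy m \<eta> + N * \<epsilon> * int (sum_list ks)" "0 \<notin> set ks" using supp by auto
      then have "sum_list ks = d" using d assms(1) N_pos by simp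
      then show "ks \<in> ?A" using s(2) len[OF s(2)] by (auto simp: compositions_def)
    qed
    then have "Sum_any trm = (\<Sum>ks\<in>?A. trm ks)"
      by (intro Sum_any.expand_superset) (auto simp: finite_compositions)
    also have "\<dots> = (\<Sum>r\<le>d. \<Sum>ks\<in>compositions r d. trm ks)"
    proof (rule sum.UNION_disjoint)
      show "\<forall>i\<in>{..d}. \<forall>j\<in>{..d}. i \<noteq> j \<longrightarrow> compositions i d \<inter> compositions j d = {}"
        by (auto simp: compositions_def)
    qed (simp_all add: finite_compositions)
    also have "\<dots> = (\<Sum>r\<le>d. z powi (\<epsilon> * N * int d) * J_pow \<epsilon> r d ?\<kappa> \<xi>)"
    proof (intro sum.cong refl)
      fix r
      have "(\<Sum>ks\<in>compositions r d. trm ks)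
          = (\<Sum>ks\<in>compositions r d. z powi (\<epsilon> * N * int d) / fact r * (prod_list (map c_coeff ks) * Jl \<epsilon> ks ?\<kappa> \<xi>))"
        unfolding t by (intro sum.cong refl) (auto simp: compositions_def)
      also have "\<dots> = z powi (\<epsilon> * N * int d) / fact r * (fact r * J_pow \<epsilon> r d ?\<kappa> \<xi>)"
        unfolding sum_distrib_left[symmetric] sum_compositions ..
      finally show "(\<Sum>ks\<in>compositions r d. trm ks) = z powi (\<epsilon> * N * int d) * J_pow \<epsilon> r d ?\<kappa> \<xi>" by simp
    qed
    finally show ?thesis unfolding H G_def sum_distrib_left .
  qed
qed

end

section \<open>Transfer matrices column by column\<close>

definition weight ::
    "(decorated_spin \<Rightarrow> spin \<Rightarrow> decorated_spin \<Rightarrow> spin \<Rightarrow> complex option) \<Rightarrow>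
     decorated_spin \<Rightarrow> spin \<Rightarrow> decorated_spin \<Rightarrow> spin \<Rightarrow> complex" where
  "weight W l t r b = (case W l t r b of None \<Rightarrow> 0 | Some w \<Rightarrow> w)"

definition spins :: "nat \<Rightarrow> decorated_spin set" where
  "spins n = UNIV \<times> {0..<int n}"

lemma spin_UNIV: "(UNIV :: spin set) = {Plus, Minus}"
  using spin.exhaust by auto

lemma finite_spins: "finite (spins n)"
  by (simp add: spins_def spin_UNIV)

lemma sum_spins: "(\<Sum>\<tau>\<in>spins n. (f \<tau> :: complex)) = (\<Sum>b\<in>{0..<int n}. f (Plus, b)) + (\<Sum>b\<in>{0..<int n}. f (Minus, b))"
proof -
  have "(\<Sum>\<tau>\<in>spins n. f \<tau>) = (\<Sum>s\<in>UNIV. \<Sum>b\<in>{0..<int n}. f (s, b))"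
    unfolding spins_def by (simp add: sum.cartesian_product)
  then show ?thesis by (simp add: spin_UNIV)
qed

text \<open>\<open>strip k c \<sigma>\<close> is the partition function of the columns c, c - 1, ..., c - k + 1 with the boundary
  spin \<sigma> on the left and the vacuum spin d on the right.\<close>

fun strip where
  "strip n W d tp bt 0 c \<sigma> = (if \<sigma> = d then 1 else 0 :: complex)"
| "strip n W d tp bt (Suc k) c \<sigma> =
     (\<Sum>\<tau>\<in>spins n. weight W \<sigma> (tp c) \<tau> (bt c) * strip n W d tp bt k (c - 1 :: int) \<tau>)"

lemma strip_cong:
  assumes "\<And>x. x \<le> c \<Longrightarrow> tp x = tp' x" "\<And>x. x \<le> c \<Longrightarrow> bt x = bt' x"
  shows "strip n W d tp bt k c \<sigma> = strip n W d tp' bt' k c \<sigma>"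
  using assms
proof (induction k arbitrary: c \<sigma>)
  case (Suc k)
  have "strip n W d tp bt k (c - 1) \<tau> = strip n W d tp' bt' k (c - 1) \<tau>" for \<tau>
    by (rule Suc.IH) (use Suc.prems in auto)
  then show ?case using Suc.prems by simp
qed simp

definition strip_states :: "nat \<Rightarrow> decorated_spin \<Rightarrow> nat \<Rightarrow> int \<Rightarrow> decorated_spin \<Rightarrow> (int \<Rightarrow> decorated_spin) set" where
  "strip_states n d k c \<sigma> = {h. h c = \<sigma> \<and> (\<forall>x>c. h x = d) \<and> (\<forall>x\<le>c - int k. h x = d) \<and> (\<forall>x. h x \<in> spins n)}"

text \<open>States equal d outside their strip, so cutting off column c resets the edge to its left
  to d, and gluing it on puts \<sigma> there.\<close>

lemma strip_states_Suc:
  assumes "\<sigma> \<in> spins n" "d \<in> spins n"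
  shows "bij_betw (\<lambda>(\<tau>, h). h(c := \<sigma>)) (SIGMA \<tau>:spins n. strip_states n d k (c - 1) \<tau>) (strip_states n d (Suc k) c \<sigma>)"
proof (rule bij_betw_byWitness[where f' = "\<lambda>h. (h (c - 1), h(c := d))"])
  let ?f = "\<lambda>(\<tau>, h). h(c := \<sigma>)" and ?f' = "\<lambda>h. (h (c - 1), h(c := d))"
  let ?S = "SIGMA \<tau>:spins n. strip_states n d k (c - 1) \<tau>" and ?T = "strip_states n d (Suc k) c \<sigma>"
  have low: "x \<le> c - 1 - int k \<longleftrightarrow> x \<le> c - int (Suc k)" for x by auto
  have 1: "?f' (?f (\<tau>, h)) = (\<tau>, h) \<and> ?f (\<tau>, h) \<in> ?T" if "h \<in> strip_states n d k (c - 1) \<tau>" for \<tau> h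
  proof -
    have h: "h (c - 1) = \<tau>" "\<And>x. x > c - 1 \<Longrightarrow> h x = d" "\<And>x. x \<le> c - int (Suc k) \<Longrightarrow> h x = d" "\<And>x. h x \<in> spins n"
      using that unfolding strip_states_def low by blast+
    have "h(c := d) = h" using h(2)[of c] by (intro fun_upd_idem) simp
    then show ?thesis using h assms(1) by (simp add: strip_states_def)
  qed
  have 2: "?f (?f' h) = h \<and> ?f' h \<in> ?S" if "h \<in> ?T" for h
  proof -
    have h: "h c = \<sigma>" "\<And>x. x > c \<Longrightarrow> h x = d" "\<And>x. x \<le> c - int (Suc k) \<Longrightarrow> h x = d" "\<And>x. h x \<in> spins n"
      using that unfolding strip_states_def by blast+
    then show ?thesis using assms(2) by (simp add: strip_states_def low fun_upd_idem)
  qed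
  show "\<forall>a\<in>?S. ?f' (?f a) = a" using 1 by blast
  show "\<forall>h\<in>?T. ?f (?f' h) = h" using 2 by blast
  show "?f ` ?S \<subseteq> ?T" using 1 by blast
  show "?f' ` ?T \<subseteq> ?S" using 2 by blast
qed

lemma strip_eq_sum:
  assumes "\<sigma> \<in> spins n" "d \<in> spins n"
  shows "finite (strip_states n d k c \<sigma>) \<and> strip n W d tp bt k c \<sigma> =
    (\<Sum>h\<in>strip_states n d k c \<sigma>. \<Prod>x\<in>{c - int k<..c}. weight W (h x) (tp x) (h (x - 1)) (bt x))"
  using assms(1)
proof (induction k arbitrary: c \<sigma>)
  case 0
  have "strip_states n d 0 c \<sigma> = (if \<sigma> = d then {\<lambda>_. d} else {})"
  proof -
    have const: "h = (\<lambda>_. d)" if "h \<in> strip_states n d 0 c \<sigma>" for h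
    proof
      fix x
      show "h x = d" using that by (cases "x > c") (auto simp: strip_states_def)
    qed
    have "(\<lambda>_. d) \<in> strip_states n d 0 c d" using assms(2) by (simp add: strip_states_def)
    then have "\<sigma> = d \<Longrightarrow> strip_states n d 0 c \<sigma> = {\<lambda>_. d}" using const by blast
    moreover have "strip_states n d 0 c \<sigma> = {}" if "\<sigma> \<noteq> d"
    proof -
      have "h \<notin> strip_states n d 0 c \<sigma>" for h
        using that by (auto simp: strip_states_def)
      then show ?thesis by blast
    qed
    ultimately show ?thesis by simp
  qed
  then show ?case by simp
next
  case (Suc k)
  let ?w = "\<lambda>h x. weight W (h x) (tp x) (h (x - 1)) (bt x)"
  let ?S = "SIGMA \<tau>:spins n. strip_states n d k (c - 1) \<tau>"
  have fin: "finite ?S" using Suc finite_spins by (intro finite_SigmaI) auto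
  note bij = strip_states_Suc[OF Suc.prems assms(2), where k = k and c = c]
  have I: "{c - int (Suc k)<..c} = insert c {c - 1 - int k<..c - 1}" by auto
  have "(\<Sum>h\<in>strip_states n d (Suc k) c \<sigma>. \<Prod>x\<in>{c - int (Suc k)<..c}. ?w h x)
     = (\<Sum>(\<tau>, h)\<in>?S. \<Prod>x\<in>{c - int (Suc k)<..c}. ?w (h(c := \<sigma>)) x)"
    by (subst sum.reindex_bij_betw[OF bij, symmetric]) (simp add: case_prod_beta)
  also have "\<dots> = (\<Sum>(\<tau>, h)\<in>?S. weight W \<sigma> (tp c) \<tau> (bt c) * (\<Prod>x\<in>{c - 1 - int k<..c - 1}. ?w h x))"
  proof (intro sum.cong refl, clarify)
    fix \<tau>1 \<tau>2 h assume "h \<in> strip_states n d k (c - 1) (\<tau>1, \<tau>2)"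
    then have h: "h (c - 1) = (\<tau>1, \<tau>2)" by (simp add: strip_states_def)
    have "(\<Prod>x\<in>{c - 1 - int k<..c - 1}. ?w (h(c := \<sigma>)) x) = (\<Prod>x\<in>{c - 1 - int k<..c - 1}. ?w h x)"
      by (intro prod.cong) auto
    then show "(\<Prod>x\<in>{c - int (Suc k)<..c}. ?w (h(c := \<sigma>)) x)
      = weight W \<sigma> (tp c) (\<tau>1, \<tau>2) (bt c) * (\<Prod>x\<in>{c - 1 - int k<..c - 1}. ?w h x)"
      unfolding I by (subst prod.insert) (auto simp: h)
  qed
  also have "\<dots> = (\<Sum>\<tau>\<in>spins n. \<Sum>h\<in>strip_states n d k (c - 1) \<tau>. weight W \<sigma> (tp c) \<tau> (bt c) * (\<Prod>x\<in>{c - 1 - int k<..c - 1}. ?w h x))"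
    using Suc finite_spins by (subst sum.Sigma) auto
  also have "\<dots> = strip n W d tp bt (Suc k) c \<sigma>"
    using Suc by (simp add: sum_distrib_left)
  finally show ?case using bij_betw_finite[OF bij] fin by simp
qed

text \<open>Every admissible state is a strip state. A strip state that is not admissible violates a
  vertex inside the strip, as the vertices outside have weight 1, and so its product is 0.\<close>

lemma ice_partition_eq_strip:
  assumes d: "d \<in> spins n" and LC: "L \<le> C"
    and W: "\<And>t. W d t d t = Some 1"
    and above: "\<And>c. c > C \<Longrightarrow> vertical_spin \<xi> c = vertical_spin \<eta> c"
    and below: "\<And>c. c \<le> L \<Longrightarrow> vertical_spin \<xi> c = vertical_spin \<eta> c"
    and outside: "\<And>h c. h \<in> admissible_states n d W \<eta> \<xi> \<Longrightarrow> c \<ge> C \<or> c \<le> L \<Longrightarrow> h c = d"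
  shows "ice_partition n d W \<eta> \<xi> = strip n W d (vertical_spin \<xi>) (vertical_spin \<eta>) (nat (C - L)) C d"
proof -
  let ?A = "admissible_states n d W \<eta> \<xi>" and ?H = "strip_states n d (nat (C - L)) C d"
  let ?w = "\<lambda>h x. weight W (h x) (vertical_spin \<xi> x) (h (x - 1)) (vertical_spin \<eta> x)"
  have kL: "C - int (nat (C - L)) = L" using LC by simp
  have fin: "finite ?H" and strip: "strip n W d (vertical_spin \<xi>) (vertical_spin \<eta>) (nat (C - L)) C d
      = (\<Sum>h\<in>?H. \<Prod>x\<in>{L<..C}. ?w h x)"
    using strip_eq_sum[OF d d, of "nat (C - L)" C W "vertical_spin \<xi>" "vertical_spin \<eta>"] unfolding kL by auto
  have sub: "?A \<subseteq> ?H"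
  proof
    fix h assume h: "h \<in> ?A"
    have "h x \<in> spins n" for x
      using h by (auto simp: admissible_states_def spins_def mem_Times_iff)
    then show "h \<in> ?H" using outside[OF h] kL by (simp add: strip_states_def)
  qed
  have out: "W (h x) (vertical_spin \<xi> x) (h (x - 1)) (vertical_spin \<eta> x) = Some 1"
    if h: "h \<in> ?H" and x: "x \<notin> {L<..C}" for h x
  proof -
    have "h x = d \<and> h (x - 1) = d" using h x kL by (auto simp: strip_states_def) (metis linorder_not_le less_le_not_le zle_diff1_eq order_le_less)
    moreover have "vertical_spin \<xi> x = vertical_spin \<eta> x" using above below x by auto
    ultimately show ?thesis using W by simp
  qed
  have "(\<Sum>h\<in>?H. \<Prod>x\<in>{L<..C}. ?w h x) = (\<Sum>h\<in>?A. \<Prod>x\<in>{L<..C}. ?w h x)"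
  proof (rule sum.mono_neutral_right[OF fin sub], rule ballI)
    fix h assume "h \<in> ?H - ?A"
    then have h: "h \<in> ?H" "h \<notin> ?A" by auto
    have "{c. h c \<noteq> d} \<subseteq> {L<..C}"
    proof
      fix c assume c: "c \<in> {c. h c \<noteq> d}"
      have "c \<noteq> C" "\<not> c > C" "\<not> c \<le> L" using h(1) kL c unfolding strip_states_def by auto
      then show "c \<in> {L<..C}" by auto
    qed
    then have "finite {c. h c \<noteq> d}" by (rule finite_subset) simp
    moreover have "snd (h c) \<in> {0..<int n}" for c
      using h(1) by (auto simp: strip_states_def spins_def mem_Times_iff)
    ultimately obtain x where x: "W (h x) (vertical_spin \<xi> x) (h (x - 1)) (vertical_spin \<eta> x) = None"
      using h(2) unfolding admissible_states_def by blast
    then have "x \<in> {L<..C}" using out[OF h(1)] by fastforce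
    moreover have "?w h x = 0" using x by (simp add: weight_def)
    ultimately show "(\<Prod>x\<in>{L<..C}. ?w h x) = 0" by (intro prod_zero) auto
  qed
  also have "\<dots> = ice_partition n d W \<eta> \<xi>"
    unfolding ice_partition_def
  proof (intro sum.cong refl)
    fix h assume h: "h \<in> ?A"
    let ?p = "\<lambda>c. the (W (h c) (vertical_spin \<xi> c) (h (c - 1)) (vertical_spin \<eta> c))"
    have "{c. ?p c \<noteq> 1} \<subseteq> {L<..C}"
    proof
      fix c assume "c \<in> {c. ?p c \<noteq> 1}"
      then show "c \<in> {L<..C}" using out[of h c] h sub by fastforce
    qed
    then have "Prod_any ?p = (\<Prod>c\<in>{L<..C}. ?p c)" by (intro Prod_any.expand_superset) auto
    also have "\<dots> = (\<Prod>c\<in>{L<..C}. ?w h c)"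
    proof (intro prod.cong refl)
      fix c
      have "W (h c) (vertical_spin \<xi> c) (h (c - 1)) (vertical_spin \<eta> c) \<noteq> None"
        using h by (simp add: admissible_states_def)
      then show "?p c = ?w h c" by (auto simp: weight_def)
    qed
    finally show "(\<Prod>x\<in>{L<..C}. ?w h x) = Prod_any ?p" by simp
  qed
  finally show ?thesis unfolding strip by simp
qed

lemma finite_not_propagating:
  assumes "finite {c::int. h c \<noteq> d}" "h c0 \<noteq> d" "\<And>i. h (c0 + s * int i) \<noteq> d \<Longrightarrow> h (c0 + s * int (Suc i)) \<noteq> d" "s \<noteq> 0"
  shows False
proof -
  have "h (c0 + s * int i) \<noteq> d" for i
    using assms(2,3) by (induction i) auto
  then have "range (\<lambda>i. c0 + s * int i) \<subseteq> {c. h c \<noteq> d}" by auto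
  then have "finite (range (\<lambda>i. c0 + s * int i))" using assms(1) by (rule finite_subset)
  moreover have "inj (\<lambda>i. c0 + s * int i)" using assms(4) by (auto intro: injI)
  ultimately show False using finite_imageD infinite_UNIV_nat by blast
qed

lemma delta_same: "delta_weight n v g z l t r t \<noteq> None \<Longrightarrow>
   (l = (Plus, 0) \<and> r = (Plus, 0)) \<or> (fst l = Minus \<and> fst r = Minus)"
  by (cases l; cases r; cases "fst l"; cases "fst r"; cases t) (auto split: if_splits)

lemma gamma_same: "gamma_weight n v g z l t r t \<noteq> None \<Longrightarrow>
   (l = (Minus, 0) \<and> r = (Minus, 0)) \<or> (fst l = Plus \<and> fst r = Plus)"
  by (cases l; cases r; cases "fst l"; cases "fst r"; cases t) (auto split: if_splits)

text \<open>In a column with equal top and bottom spins either both horizontal edges are d or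
  neither is. A deviation would thus spread to infinitely many edges, leftwards from c \<ge> C and
  rightwards from c \<le> L. The edge C is included as the right edge of column C + 1.\<close>

lemma default_outside:
  assumes h: "h \<in> admissible_states n d W \<eta> \<xi>"
    and same: "\<And>l t r. W l t r t \<noteq> None \<Longrightarrow> (l = d \<and> r = d) \<or> (fst l \<noteq> fst d \<and> fst r \<noteq> fst d)"
    and above: "\<And>c. c > C \<Longrightarrow> vertical_spin \<xi> c = vertical_spin \<eta> c"
    and below: "\<And>c. c \<le> L \<Longrightarrow> vertical_spin \<xi> c = vertical_spin \<eta> c"
    and c: "c \<ge> C \<or> c \<le> L"
  shows "h c = d"
proof (rule ccontr)
  assume nd: "h c \<noteq> d"
  have fin: "finite {c. h c \<noteq> d}" using h by (simp add: admissible_states_def)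
  have step: "(h x = d \<and> h (x - 1) = d) \<or> (h x \<noteq> d \<and> h (x - 1) \<noteq> d)"
    if "vertical_spin \<xi> x = vertical_spin \<eta> x" for x
  proof -
    have "W (h x) (vertical_spin \<xi> x) (h (x - 1)) (vertical_spin \<eta> x) \<noteq> None"
      using h unfolding admissible_states_def by blast
    then have "W (h x) (vertical_spin \<eta> x) (h (x - 1)) (vertical_spin \<eta> x) \<noteq> None"
      unfolding that .
    from same[OF this] show ?thesis by auto
  qed
  show False
  proof (cases "c \<ge> C")
    case True
    show False
    proof (rule finite_not_propagating[OF fin nd, of 1])
      fix i assume "h (c + 1 * int i) \<noteq> d"
      moreover have "c + 1 * int (Suc i) > C" using True by simp
      ultimately show "h (c + 1 * int (Suc i)) \<noteq> d"
        using step[OF above, of "c + 1 * int (Suc i)"] by (simp add: algebra_simps)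
    qed simp
  next
    case False
    then have cL: "c \<le> L" using c by simp
    show False
    proof (rule finite_not_propagating[OF fin nd, of "-1"])
      fix i assume "h (c + - 1 * int i) \<noteq> d"
      moreover have "c + - 1 * int i \<le> L" using cL by simp
      ultimately show "h (c + - 1 * int (Suc i)) \<noteq> d"
        using step[OF below, of "c + - 1 * int i"] by (simp add: algebra_simps)
    qed simp
  qed
qed

lemma vertical_spin_Minus: "c \<in> range s \<Longrightarrow> vertical_spin s c = Minus"
  and vertical_spin_Plus: "c \<notin> range s \<Longrightarrow> vertical_spin s c = Plus"
  by (simp_all add: vertical_spin_def)

lemma range_wcons: "range (wcons a s) = insert a (range s)"
proof -
  have "x \<in> range (wcons a s) \<longleftrightarrow> x = a \<or> x \<in> range s" for x
    by (metis (no_types, lifting) not0_implies_Suc rangeE rangeI wcons_simps)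
  then show ?thesis by auto
qed

lemma vertical_spin_wcons: "x < a \<Longrightarrow> vertical_spin (wcons a s) x = vertical_spin s x"
  by (simp add: vertical_spin_def range_wcons)

section \<open>One column at a time\<close>

definition delta_strip where
  "delta_strip n v g z L c \<sigma> \<eta> \<xi> =
     strip n (delta_weight n v g z) (Plus, 0) (vertical_spin \<xi>) (vertical_spin \<eta>) (nat (c - L)) c \<sigma>"

definition gamma_strip where
  "gamma_strip n v g z L c \<sigma> \<eta> \<xi> =
     strip n (gamma_weight n v g z) (Minus, 0) (vertical_spin \<xi>) (vertical_spin \<eta>) (nat (c - L)) c \<sigma>"

lemma delta_strip_rec: "c > L \<Longrightarrow> delta_strip n v g z L c \<sigma> \<eta> \<xi> =
    (\<Sum>\<tau>\<in>spins n. weight (delta_weight n v g z) \<sigma> (vertical_spin \<xi> c) \<tau> (vertical_spin \<eta> c) * delta_strip n v g z L (c - 1) \<tau> \<eta> \<xi>)"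
proof -
  assume "c > L"
  then have "nat (c - L) = Suc (nat (c - 1 - L))" by simp
  then show ?thesis unfolding delta_strip_def by (simp only: strip.simps)
qed

lemma gamma_strip_rec: "c > L \<Longrightarrow> gamma_strip n v g z L c \<sigma> \<eta> \<xi> =
    (\<Sum>\<tau>\<in>spins n. weight (gamma_weight n v g z) \<sigma> (vertical_spin \<xi> c) \<tau> (vertical_spin \<eta> c) * gamma_strip n v g z L (c - 1) \<tau> \<eta> \<xi>)"
proof -
  assume "c > L"
  then have "nat (c - L) = Suc (nat (c - 1 - L))" by simp
  then show ?thesis unfolding gamma_strip_def by (simp only: strip.simps)
qed

lemma weight_simps:
  "weight W l t r b * x = (case W l t r b of None \<Rightarrow> 0 | Some w \<Rightarrow> w * x)"
  by (simp add: weight_def split: option.split)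

lemma sum_option_delta:
  "finite A \<Longrightarrow> (\<Sum>b\<in>A. case (if b = y then Some w else None) of None \<Rightarrow> 0 | Some w \<Rightarrow> w * (f b :: complex)) =
     (if y \<in> A then w * f y else 0)"
proof -
  assume "finite A"
  have "(case (if b = y then Some w else None) of None \<Rightarrow> 0 | Some w \<Rightarrow> w * f b) = (if b = y then w * f y else 0)" for b
    by simp
  then show ?thesis using \<open>finite A\<close> by simp
qed

lemma delta_strip_steps:
  assumes c: "c > L" and n: "n \<ge> 1"
  shows "c \<notin> range \<xi> \<Longrightarrow> c \<notin> range \<eta> \<Longrightarrow> delta_strip n v g z L c (Plus, 0) \<eta> \<xi> = delta_strip n v g z L (c - 1) (Plus, 0) \<eta> \<xi>"
    and "c \<in> range \<xi> \<Longrightarrow> c \<in> range \<eta> \<Longrightarrow> delta_strip n v g z L c (Plus, 0) \<eta> \<xi> = delta_strip n v g z L (c - 1) (Plus, 0) \<eta> \<xi>"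
    and "c \<in> range \<xi> \<Longrightarrow> c \<notin> range \<eta> \<Longrightarrow> delta_strip n v g z L c (Plus, 0) \<eta> \<xi> = delta_strip n v g z L (c - 1) (Minus, 1 mod int n) \<eta> \<xi>"
    and "c \<notin> range \<xi> \<Longrightarrow> c \<in> range \<eta> \<Longrightarrow> delta_strip n v g z L c (Plus, 0) \<eta> \<xi> = 0"
    and "c \<in> range \<xi> \<Longrightarrow> c \<in> range \<eta> \<Longrightarrow> delta_strip n v g z L c (Minus, a) \<eta> \<xi> = g a * z * delta_strip n v g z L (c - 1) (Minus, (a + 1) mod int n) \<eta> \<xi>"
    and "c \<notin> range \<xi> \<Longrightarrow> c \<notin> range \<eta> \<Longrightarrow> delta_strip n v g z L c (Minus, a) \<eta> \<xi> = z * delta_strip n v g z L (c - 1) (Minus, (a + 1) mod int n) \<eta> \<xi>"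
    and "c \<notin> range \<xi> \<Longrightarrow> c \<in> range \<eta> \<Longrightarrow> delta_strip n v g z L c (Minus, a) \<eta> \<xi> = (if a = 0 then (1 - v) * z * delta_strip n v g z L (c - 1) (Plus, 0) \<eta> \<xi> else 0)"
    and "c \<in> range \<xi> \<Longrightarrow> c \<notin> range \<eta> \<Longrightarrow> delta_strip n v g z L c (Minus, a) \<eta> \<xi> = 0"
  using n unfolding delta_strip_rec[OF c] sum_spins weight_simps
  by (simp_all add: vertical_spin_Minus vertical_spin_Plus sum_option_delta del: option.case_distrib)

lemma gamma_strip_steps:
  assumes c: "c > L" and n: "n \<ge> 1"
  shows "c \<notin> range \<xi> \<Longrightarrow> c \<notin> range \<eta> \<Longrightarrow> gamma_strip n v g z L c (Minus, 0) \<eta> \<xi> = gamma_strip n v g z L (c - 1) (Minus, 0) \<eta> \<xi>"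
    and "c \<in> range \<xi> \<Longrightarrow> c \<in> range \<eta> \<Longrightarrow> gamma_strip n v g z L c (Minus, 0) \<eta> \<xi> = gamma_strip n v g z L (c - 1) (Minus, 0) \<eta> \<xi>"
    and "c \<notin> range \<xi> \<Longrightarrow> c \<in> range \<eta> \<Longrightarrow> gamma_strip n v g z L c (Minus, 0) \<eta> \<xi> = (1 - v) * gamma_strip n v g z L (c - 1) (Plus, 0) \<eta> \<xi>"
    and "c \<in> range \<xi> \<Longrightarrow> c \<notin> range \<eta> \<Longrightarrow> gamma_strip n v g z L c (Minus, 0) \<eta> \<xi> = 0"
  using n unfolding gamma_strip_rec[OF c] sum_spins weight_simps
  by (simp_all add: vertical_spin_Minus vertical_spin_Plus sum_option_delta)

lemma mod_shift_iff: "n \<ge> 1 \<Longrightarrow> a \<in> {0..<int n} \<Longrightarrow> b \<in> {0..<int n} \<Longrightarrow> b = (a + 1) mod int n \<longleftrightarrow> a = (b - 1) mod int n"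
  by (metis add_diff_cancel_right' atLeastLessThan_iff diff_add_cancel mod_add_left_eq mod_diff_left_eq mod_pos_pos_trivial)

lemma sum_option_shift:
  assumes "n \<ge> 1" "b \<in> {0..<int n}"
  shows "(\<Sum>a\<in>{0..<int n}. case (if b = (a + 1) mod int n then Some (w a) else None) of None \<Rightarrow> 0 | Some w \<Rightarrow> w * (f a :: complex))
    = w ((b - 1) mod int n) * f ((b - 1) mod int n)"
proof -
  have "(\<Sum>a\<in>{0..<int n}. case (if b = (a + 1) mod int n then Some (w a) else None) of None \<Rightarrow> 0 | Some w \<Rightarrow> w * f a)
      = (\<Sum>a\<in>{0..<int n}. if a = (b - 1) mod int n then w a * f a else 0)"
    using mod_shift_iff[OF assms(1) _ assms(2)] by (intro sum.cong) auto
  then show ?thesis using assms(1) by simp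
qed

lemma gamma_strip_steps_Plus:
  assumes c: "c > L" and n: "n \<ge> 1" and b: "b \<in> {0..<int n}"
  shows "c \<notin> range \<xi> \<Longrightarrow> c \<notin> range \<eta> \<Longrightarrow> gamma_strip n v g z L c (Plus, b) \<eta> \<xi> = inverse z * gamma_strip n v g z L (c - 1) (Plus, (b - 1) mod int n) \<eta> \<xi>"
    and "c \<in> range \<xi> \<Longrightarrow> c \<in> range \<eta> \<Longrightarrow> gamma_strip n v g z L c (Plus, b) \<eta> \<xi> = inverse z * g ((b - 1) mod int n) * gamma_strip n v g z L (c - 1) (Plus, (b - 1) mod int n) \<eta> \<xi>"
    and "c \<in> range \<xi> \<Longrightarrow> c \<notin> range \<eta> \<Longrightarrow> gamma_strip n v g z L c (Plus, b) \<eta> \<xi> = (if b = 1 mod int n then inverse z * gamma_strip n v g z L (c - 1) (Minus, 0) \<eta> \<xi> else 0)"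
    and "c \<notin> range \<xi> \<Longrightarrow> c \<in> range \<eta> \<Longrightarrow> gamma_strip n v g z L c (Plus, b) \<eta> \<xi> = 0"
  using n sum_option_shift[OF n b] unfolding gamma_strip_rec[OF c] sum_spins weight_simps
  by (simp_all add: vertical_spin_Minus vertical_spin_Plus sum_option_delta)

section \<open>Delta ice\<close>

lemma energy_vac: "energy m (vac m) = m * (m + 1) div 2"
  using energy_sum[of 0 "vac m" m] by (simp add: vac_def)

lemma normal_ordered_diff:
  assumes "s \<in> normal_ordered m" "i \<le> j"
  shows "s i \<ge> s j + int (j - i)"
  using assms(2)
proof (induction j rule: dec_induct)
  case (step k)
  have "s (Suc k) < s k" using assms(1) by (simp add: normal_ordered_def)
  then show ?case using step by (simp add: Suc_diff_le)
qed simp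

lemma normal_ordered_ge:
  assumes "s \<in> normal_ordered m"
  shows "s j \<ge> m - int j"
proof -
  obtain K where K: "\<And>i. i \<ge> K \<Longrightarrow> s i = m - int i"
    using assms by (auto simp: normal_ordered_def semi_infinite_def)
  have "s j \<ge> s (max j K) + int (max j K - j)" by (rule normal_ordered_diff[OF assms]) simp
  then show ?thesis using K[of "max j K"] by (simp add: of_nat_diff)
qed

text \<open>The excesses s_i - (m - i) form a partition: they are nonnegative and weakly decreasing,
  so an excess at position j forces one at each of 0, ..., j.\<close>

lemma normal_ordered_energy:
  assumes "s \<in> normal_ordered m"
  shows "energy m s \<ge> m * (m + 1) div 2"
    and "s j > m - int j \<Longrightarrow> energy m s \<ge> m * (m + 1) div 2 + int (Suc j)"
proof -
  obtain K0 where K0: "\<And>i. i \<ge> K0 \<Longrightarrow> s i = m - int i"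
    using assms by (auto simp: normal_ordered_def semi_infinite_def)
  define K where "K = max K0 (Suc j)"
  have E: "energy m s = (\<Sum>i<K. s i - (m - int i)) + m * (m + 1) div 2"
    by (rule energy_sum) (use K0 in \<open>auto simp: K_def\<close>)
  have nonneg: "s i - (m - int i) \<ge> 0" for i using normal_ordered_ge[OF assms, of i] by simp
  then show "energy m s \<ge> m * (m + 1) div 2" unfolding E by (simp add: sum_nonneg)
  assume sj: "s j > m - int j"
  have "1 \<le> s i - (m - int i)" if "i \<in> {..<Suc j}" for i
    using normal_ordered_diff[OF assms, of i j] that sj by (simp add: of_nat_diff)
  then have "(\<Sum>i<Suc j. 1) \<le> (\<Sum>i<Suc j. s i - (m - int i))" by (rule sum_mono)
  also have "\<dots> \<le> (\<Sum>i<K. s i - (m - int i))"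
    by (rule sum_mono2) (use nonneg in \<open>auto simp: K_def\<close>)
  finally show "energy m s \<ge> m * (m + 1) div 2 + int (Suc j)" unfolding E by simp
qed

text \<open>The possible bottom rows once the columns above c have been summed out.\<close>

definition Omega :: "int \<Rightarrow> int \<Rightarrow> int \<Rightarrow> wedge_seq set" where
  "Omega m E c = {s \<in> normal_ordered m. energy m s = E \<and> s 0 \<le> c}"

text \<open>As partitions, these wedges have parts of at most c - m and no part from position J on,
  where J is the total excess.\<close>

lemma finite_Omega: "finite (Omega m E c)"
proof -
  define J where "J = nat (E - m * (m + 1) div 2)"
  define \<delta> where "\<delta> s = (\<lambda>i. s i - (m - int i))" for s :: wedge_seq
  let ?F = "{f. \<forall>i. (i \<in> {..<J} \<longrightarrow> f i \<in> {0..c - m}) \<and> (i \<notin> {..<J} \<longrightarrow> f i = 0)}"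
  have "\<delta> ` Omega m E c \<subseteq> ?F"
  proof
    fix f assume "f \<in> \<delta> ` Omega m E c"
    then obtain s where s: "s \<in> normal_ordered m" "energy m s = E" "s 0 \<le> c" "f = \<delta> s"
      by (auto simp: Omega_def)
    have "f i \<ge> 0" for i using normal_ordered_ge[OF s(1), of i] by (simp add: s(4) \<delta>_def)
    moreover have "f i \<le> c - m" for i using normal_ordered_diff[OF s(1), of 0 i] s(3) by (simp add: s(4) \<delta>_def)
    moreover have "f i = 0" if "i \<ge> J" for i
    proof (rule ccontr)
      assume "f i \<noteq> 0"
      then have "s i > m - int i" using \<open>f i \<ge> 0\<close> by (simp add: s(4) \<delta>_def)
      then have "E \<ge> m * (m + 1) div 2 + int (Suc i)" using normal_ordered_energy(2)[OF s(1)] s(2) by blast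
      then show False using that by (simp add: J_def)
    qed
    ultimately show "f \<in> ?F" by auto
  qed
  moreover have "finite ?F" by (rule finite_set_of_finite_funs) auto
  ultimately have "finite (\<delta> ` Omega m E c)" by (rule finite_subset)
  moreover have "inj_on \<delta> (Omega m E c)"
    by (rule inj_onI) (auto simp: \<delta>_def fun_eq_iff)
  ultimately show ?thesis by (rule finite_imageD)
qed

lemma normal_ordered_wcons: "wcons a s \<in> normal_ordered (m + 1) \<longleftrightarrow> s \<in> normal_ordered m \<and> s 0 < a"
proof
  assume w: "wcons a s \<in> normal_ordered (m + 1)"
  have "(\<lambda>i. wcons a s (Suc i)) \<in> semi_infinite m"
    using w by (intro semi_infinite_tail) (simp add: normal_ordered_def)
  then have "s \<in> semi_infinite m" by simp
  moreover have "wcons a s (Suc j) < wcons a s j" for j using w by (simp add: normal_ordered_def)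
  from this[of 0] this[of "Suc _"] have "s 0 < a" "\<And>j. s (Suc j) < s j" by simp_all
  ultimately show "s \<in> normal_ordered m \<and> s 0 < a" by (simp add: normal_ordered_def)
next
  assume s: "s \<in> normal_ordered m \<and> s 0 < a"
  have "wcons a s (Suc j) < wcons a s j" for j
    using s by (cases j) (auto simp: normal_ordered_def)
  then show "wcons a s \<in> normal_ordered (m + 1)"
    using s semi_infinite_wcons by (auto simp: normal_ordered_def)
qed

lemma normal_ordered_cases:
  assumes "s \<in> normal_ordered (m + 1)"
  obtains a t where "s = wcons a t" "t \<in> normal_ordered m" "t 0 < a"
  using assms normal_ordered_wcons wcons_eta by metis

text \<open>The alternative is whether column c of the bottom row is occupied, that is, the bottom
  spin of the next vertex.\<close>

lemma Omega_split:
  "Omega (m + 1) E c = wcons c ` Omega m (E - c) (c - 1) \<union> Omega (m + 1) E (c - 1)"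
proof -
  have e: "energy (m + 1) (wcons a t) = a + energy m t" if "t \<in> normal_ordered m" for a t
    using that by (intro energy_wcons) (simp add: normal_ordered_def)
  show ?thesis
  proof (intro set_eqI iffI)
    fix s assume s: "s \<in> Omega (m + 1) E c"
    then have "s \<in> normal_ordered (m + 1)" by (simp add: Omega_def)
    then obtain a t where at: "s = wcons a t" "t \<in> normal_ordered m" "t 0 < a" by (rule normal_ordered_cases)
    show "s \<in> wcons c ` Omega m (E - c) (c - 1) \<union> Omega (m + 1) E (c - 1)"
    proof (cases "a = c")
      case True
      then have "t \<in> Omega m (E - c) (c - 1)" using s at e[OF at(2), of a] by (auto simp: Omega_def)
      then show ?thesis using at True by blast
    next
      case False
      then show ?thesis using s at by (auto simp: Omega_def)
    qed
  next
    fix s assume "s \<in> wcons c ` Omega m (E - c) (c - 1) \<union> Omega (m + 1) E (c - 1)"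
    then show "s \<in> Omega (m + 1) E c"
      using e by (auto simp: Omega_def normal_ordered_wcons)
  qed
qed

lemma sum_Omega_split:
  "(\<Sum>\<eta>\<in>Omega (m + 1) E c. (f \<eta> :: complex)) =
     (\<Sum>\<eta>\<in>Omega m (E - c) (c - 1). f (wcons c \<eta>)) + (\<Sum>\<eta>\<in>Omega (m + 1) E (c - 1). f \<eta>)"
proof -
  have "wcons c ` Omega m (E - c) (c - 1) \<inter> Omega (m + 1) E (c - 1) = {}"
    by (auto simp: Omega_def)
  then show ?thesis unfolding Omega_split[of m E c]
    by (subst sum.union_disjoint) (auto simp: finite_Omega sum.reindex inj_on_def)
qed

lemma normal_full_eq_vac:
  assumes s: "s \<in> normal_ordered m" and "s 0 \<le> L" "{..L} \<subseteq> range s"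
  shows "m = L" "s = vac L"
proof -
  have sj: "s j = L - int j" for j
  proof (induction j rule: less_induct)
    case (less j)
    have "s j \<le> L - int j"
      using normal_ordered_diff[OF s, of 0 j] assms(2) by simp
    moreover have "L - int j \<in> range s" using assms(3) by auto
    then obtain i where i: "s i = L - int j" by force
    moreover have "\<not> i < j" using less.IH[of i] i by auto
    then have "s j \<ge> s i" using normal_ordered_diff[OF s, of j i] by simp
    ultimately show ?case by simp
  qed
  then show "s = vac L" by (auto simp: vac_def)
  obtain K where "\<And>i. i \<ge> K \<Longrightarrow> s i = m - int i"
    using s by (auto simp: normal_ordered_def semi_infinite_def)
  then have "s K = m - int K" by blast
  then show "m = L" using sj[of K] by simp
qed

lemma Omega_vac: "Omega m E m = (if E = m * (m + 1) div 2 then {vac m} else {})"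
proof -
  have "s = vac m" if "s \<in> normal_ordered m" "s 0 \<le> m" for s
  proof
    fix j
    show "s j = vac m j"
      using normal_ordered_ge[OF that(1), of j] normal_ordered_diff[OF that(1), of 0 j] that(2)
      by (simp add: vac_def)
  qed
  then have sub: "Omega m E m \<subseteq> {vac m}" unfolding Omega_def by blast
  have "vac m \<in> normal_ordered m" by (simp add: normal_ordered_def) (simp add: vac_def)
  then have "vac m \<in> Omega m E m \<longleftrightarrow> E = m * (m + 1) div 2"
    unfolding Omega_def by (simp add: energy_vac) (auto simp: vac_def)
  then show ?thesis using sub by (cases "E = m * (m + 1) div 2") (simp_all, blast+)
qed

context fock_params begin

section \<open>Linearity of the exponential, and lowest energy\<close>

lemma ann_scale: "\<phi> \<in> ann m \<Longrightarrow> (\<lambda>s. c * \<phi> s) \<in> ann m"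
proof -
  have "pair (\<lambda>s. c * \<phi> s) x = c * pair \<phi> x" for x
    unfolding pair_def by (simp add: sum_distrib_left mult_ac)
  then show "\<phi> \<in> ann m \<Longrightarrow> (\<lambda>s. c * \<phi> s) \<in> ann m" by (simp add: ann_def)
qed

lemma ann_zero: "(\<lambda>s. 0) \<in> ann m"
  by (simp add: ann_def pair_def)

lemma ann_sum: "(\<And>i. i \<in> I \<Longrightarrow> F i \<in> ann m) \<Longrightarrow> (\<lambda>s. \<Sum>i\<in>I. F i s) \<in> ann m"
  by (induction I rule: infinite_finite_induct) (simp_all add: ann_zero ann_add)

lemma Jd_scale: "\<phi> \<in> ann m \<Longrightarrow> k \<noteq> 0 \<Longrightarrow> s \<in> semi_infinite m \<Longrightarrow> Jd k (\<lambda>s. c * \<phi> s) s = c * Jd k \<phi> s"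
proof -
  assume a: "\<phi> \<in> ann m" "k \<noteq> 0" "s \<in> semi_infinite m"
  obtain K where K: "\<And>i. i \<ge> K \<Longrightarrow> s i = m - int i" using a(3) by (auto simp: semi_infinite_def)
  have J: "Jd k \<chi> s = (\<Sum>i<K + n * nat \<bar>k\<bar>. \<chi> (s(i := s i - N * k)))" if "\<chi> \<in> ann m" for \<chi>
    using Jd_sum[OF that, of K s k] K a(2) by blast
  show ?thesis unfolding J[OF a(1)] J[OF ann_scale[OF a(1)]] sum_distrib_left ..
qed

lemma J_pow_scale:
  assumes "\<phi> \<in> ann m" "\<epsilon> \<noteq> 0" "s \<in> semi_infinite m"
  shows "J_pow \<epsilon> r d (\<lambda>s. c * \<phi> s) s = c * J_pow \<epsilon> r d \<phi> s"
  using assms(1)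
proof (induction r arbitrary: d \<phi>)
  case (Suc r)
  have "c_coeff k * J_pow \<epsilon> r (d - k) (Jd (\<epsilon> * int k) (\<lambda>s. c * \<phi> s)) s
     = c * (c_coeff k * J_pow \<epsilon> r (d - k) (Jd (\<epsilon> * int k) \<phi>) s)" (is "?l k = ?r k") for k
  proof (cases "k = 0")
    case False
    then have k: "\<epsilon> * int k \<noteq> 0" using assms(2) by simp
    have "J_pow \<epsilon> r (d - k) (Jd (\<epsilon> * int k) (\<lambda>s. c * \<phi> s)) s
        = J_pow \<epsilon> r (d - k) (\<lambda>s. c * Jd (\<epsilon> * int k) \<phi> s) s"
      by (rule J_pow_cong[OF Jd_scale[OF Suc.prems k] assms(3)])
    also have "\<dots> = c * J_pow \<epsilon> r (d - k) (Jd (\<epsilon> * int k) \<phi>) s"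
      using Suc.prems by (intro Suc.IH ann_Jd k)
    finally show ?thesis by simp
  qed simp
  then have "(\<Sum>k\<le>d. ?l k) = c * (\<Sum>k\<le>d. c_coeff k * J_pow \<epsilon> r (d - k) (Jd (\<epsilon> * int k) \<phi>) s)"
    unfolding sum_distrib_left by (intro sum.cong refl)
  then show ?case unfolding J_pow.simps(2) by simp
qed simp

lemma G_cong:
  assumes "\<And>s. s \<in> semi_infinite m \<Longrightarrow> \<phi> s = \<psi> s" "s \<in> semi_infinite m"
  shows "G \<epsilon> d \<phi> s = G \<epsilon> d \<psi> s"
  unfolding G_def by (intro sum.cong refl) (rule J_pow_cong[OF assms])

lemma G_linear:
  assumes "\<And>i. i \<in> I \<Longrightarrow> F i \<in> ann m" "\<epsilon> \<noteq> 0" "s \<in> semi_infinite m"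
  shows "G \<epsilon> d (\<lambda>s. \<Sum>i\<in>I. c i * F i s) s = (\<Sum>i\<in>I. c i * G \<epsilon> d (F i) s)"
proof -
  have zero: "J_pow \<epsilon> r d (\<lambda>s. 0) s = 0" for r
    using J_pow_scale[OF ann_zero assms(2,3), of r d 0] by simp
  have "J_pow \<epsilon> r d (\<lambda>s. \<Sum>i\<in>I. c i * F i s) s = (\<Sum>i\<in>I. c i * J_pow \<epsilon> r d (F i) s)" for r
    using assms(1)
  proof (induction I rule: infinite_finite_induct)
    case (insert x I)
    have "J_pow \<epsilon> r d (\<lambda>s. c x * F x s + (\<Sum>i\<in>I. c i * F i s)) s
        = J_pow \<epsilon> r d (\<lambda>s. c x * F x s) s + J_pow \<epsilon> r d (\<lambda>s. \<Sum>i\<in>I. c i * F i s) s"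
      using insert.prems assms(2,3) by (intro J_pow_add[where m = m] ann_scale ann_sum) auto
    then show ?case using insert J_pow_scale[OF _ assms(2,3), of "F x" r d "c x"] by simp
  qed (simp_all add: zero)
  then show ?thesis unfolding G_def sum_distrib_left by (simp add: sum.swap[of _ "{..d}"])
qed

lemma G_vanish: "(\<And>s. s \<in> semi_infinite m \<Longrightarrow> \<phi> s = 0) \<Longrightarrow> \<epsilon> \<noteq> 0 \<Longrightarrow> s \<in> semi_infinite m \<Longrightarrow> G \<epsilon> d \<phi> s = 0"
  using G_cong[of m \<phi> "\<lambda>_. 0" s \<epsilon> d] G_linear[of "{}" undefined m \<epsilon> s d undefined] by simp

text \<open>The normal form of s involves only wedges of the same energy as s.\<close>

lemma energy_vanish:
  assumes "\<phi> \<in> ann m" "s \<in> semi_infinite m"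
    and "\<And>\<eta>. \<eta> \<in> normal_ordered m \<Longrightarrow> energy m \<eta> = energy m s \<Longrightarrow> \<phi> \<eta> = 0"
  shows "\<phi> s = 0"
proof -
  have y: "normal_form m s (nf m s)" by (rule nf[OF assms(2)])
  then have "\<phi> s = pair \<phi> (nf m s)" using assms(1) by (simp add: normal_form_def)
  also have "\<dots> = 0" unfolding pair_def
    by (rule sum.neutral) (use y assms(3) in \<open>auto simp: normal_form_def\<close>)
  finally show ?thesis .
qed

text \<open>Lowering the vacuum would require a normal-ordered wedge of smaller energy at the same
  level, and there is none.\<close>

lemma G_lowering_vac:
  assumes "\<phi> \<in> ann m" "d > 0"
  shows "G 1 d \<phi> (vac m) = 0"
proof (rule G_energy)
  show "energy m (vac m) = (energy m (vac m) - N * int d) + N * 1 * int d" by simp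
  fix s assume s: "s \<in> semi_infinite m" "energy m s = energy m (vac m) - N * int d"
  have "N * int d > 0" using N_pos assms(2) by simp
  then have "energy m s < m * (m + 1) div 2" using s(2) by (simp add: energy_vac)
  then show "\<phi> s = 0" using normal_ordered_energy(1)
    by (intro energy_vanish[OF assms(1) s(1)]) fastforce
qed simp

text \<open>\<open>Gi\<close> reindexes \<open>G\<close> by the change of energy and is 0 where no such part exists.\<close>

definition Gi :: "int \<Rightarrow> int \<Rightarrow> (wedge_seq \<Rightarrow> complex) \<Rightarrow> wedge_seq \<Rightarrow> complex" where
  "Gi \<epsilon> \<gamma> \<phi> s = (if \<gamma> \<ge> 0 \<and> N dvd \<gamma> then G \<epsilon> (nat (\<gamma> div N)) \<phi> s else 0)"

lemma Gi_mult: "Gi \<epsilon> (int d * N) \<phi> s = G \<epsilon> d \<phi> s"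
  using N_pos by (simp add: Gi_def)

lemma Gi_not_dvd: "\<not> N dvd \<gamma> \<Longrightarrow> Gi \<epsilon> \<gamma> \<phi> s = 0"
  by (simp add: Gi_def)

lemma Gi_neg: "\<gamma> < 0 \<Longrightarrow> Gi \<epsilon> \<gamma> \<phi> s = 0"
  by (simp add: Gi_def)

text \<open>The vector carried by a horizontal edge with a minus spin: a particle that has been removed
  and is still to be inserted in one of the columns up to c.\<close>

definition falling :: "int \<Rightarrow> int \<Rightarrow> (wedge_seq \<Rightarrow> complex) \<Rightarrow> wedge_seq \<Rightarrow> complex" where
  "falling c \<beta> \<phi> s = (\<Sum>b\<in>{\<beta>..c}. Gi 1 (b - \<beta>) (\<lambda>t. \<phi> (wcons b t)) s)"

lemma falling_top: "falling c \<beta> \<phi> s = falling (c - 1) \<beta> \<phi> s + Gi 1 (c - \<beta>) (\<lambda>t. \<phi> (wcons c t)) s"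
proof (cases "\<beta> \<le> c")
  case True
  then have "{\<beta>..c} = insert c {\<beta>..c - 1}" by auto
  then show ?thesis by (simp add: falling_def)
qed (simp add: falling_def Gi_neg)

lemma sum_progression:
  assumes "\<beta> \<le> c"
  shows "(\<Sum>b\<in>{\<beta>..c}. if N dvd b - \<beta> then h b else (0::complex)) = (\<Sum>d\<le>nat ((c - \<beta>) div N). h (\<beta> + int d * N))"
proof -
  let ?T = "nat ((c - \<beta>) div N)" and ?h = "\<lambda>d. \<beta> + int d * N"
  have inj: "inj_on ?h {..?T}" using N_pos by (auto intro: inj_onI)
  have sub: "?h ` {..?T} \<subseteq> {\<beta>..c}" using div_gap[of \<beta> c] assms N_pos by fastforce
  have "(\<Sum>b\<in>{\<beta>..c}. if N dvd b - \<beta> then h b else 0) = (\<Sum>b\<in>?h ` {..?T}. if N dvd b - \<beta> then h b else 0)"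
  proof (rule sum.mono_neutral_right[OF _ sub])
    show "\<forall>b\<in>{\<beta>..c} - ?h ` {..?T}. (if N dvd b - \<beta> then h b else 0) = 0"
    proof
      fix b assume b: "b \<in> {\<beta>..c} - ?h ` {..?T}"
      have "\<not> N dvd b - \<beta>"
      proof
        assume "N dvd b - \<beta>"
        then obtain k where k: "b - \<beta> = N * k" by (auto simp: dvd_def)
        then have "k \<ge> 0" using b N_pos by (metis DiffD1 atLeastAtMost_iff diff_ge_0_iff_ge zero_le_mult_iff not_le)
        moreover have "k \<le> (c - \<beta>) div N" using k b N_pos by (simp add: zdiv_mono1[of "N * k" "c - \<beta>" N, simplified])
        ultimately have "b = ?h (nat k)" "nat k \<le> ?T" using k by (auto simp: mult.commute)
        then show False using b by blast
      qed
      then show "(if N dvd b - \<beta> then h b else 0) = 0" by simp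
    qed
  qed simp
  also have "\<dots> = (\<Sum>d\<le>?T. h (?h d))"
    unfolding sum.reindex[OF inj] by simp
  finally show ?thesis .
qed

lemma falling_eq_nat:
  assumes "\<beta> \<le> c"
  shows "falling c \<beta> \<phi> s = (\<Sum>d\<le>nat ((c - \<beta>) div N). G 1 d (\<lambda>t. \<phi> (wcons (\<beta> + int d * N) t)) s)"
proof -
  have "falling c \<beta> \<phi> s = (\<Sum>b\<in>{\<beta>..c}. if N dvd b - \<beta> then Gi 1 (b - \<beta>) (\<lambda>t. \<phi> (wcons b t)) s else 0)"
    unfolding falling_def by (intro sum.cong refl) (simp add: Gi_not_dvd)
  then show ?thesis by (simp add: sum_progression[OF assms] Gi_mult)
qed

text \<open>A falling particle crosses an occupied column. While it is inserted at \<beta> + d N,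
  e^H lowers u_c by D N with coefficient e_D. Grouping by f = d - D, the wedge law sums these terms
  to g (\<beta> - c) times the particle inserted behind u_c. Column c itself then drops out because
  u_c \<and> u_c = 0.\<close>

lemma falling_wcons:
  assumes \<phi>: "\<phi> \<in> ann (m + 1 + 1)" and s: "s \<in> semi_infinite m"
  shows "falling c \<beta> \<phi> (wcons c s) = g (\<beta> - c) * falling (c - 1) \<beta> (\<lambda>t. \<phi> (wcons c t)) s"
proof (cases "\<beta> \<le> c")
  case False
  then show ?thesis by (simp add: falling_def)
next
  case True
  let ?T = "nat ((c - \<beta>) div N)"
  have ann2: "(\<lambda>t. \<phi> (wcons a (wcons b t))) \<in> ann m" for a b
    using ann_wcons[OF ann_wcons[OF \<phi>]] .
  have law: "exchange_law (\<lambda>a b. \<phi> (wcons a (wcons b t)))" if "t \<in> semi_infinite m" for t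
    by (rule ann_pair_law[OF \<phi> that])
  have "falling c \<beta> \<phi> (wcons c s) = (\<Sum>d\<le>?T. \<Sum>D\<le>d. e_coeff D *
      G 1 (d - D) (\<lambda>t. \<phi> (wcons (\<beta> + int d * N) (wcons (c - int D * N) t))) s)"
    unfolding falling_eq_nat[OF True] using G_wcons[OF ann_wcons[OF \<phi>] _ s, of 1 _ _ c]
    by (simp add: mult.commute)
  also have "\<dots> = (\<Sum>D\<le>?T. \<Sum>f\<le>?T - D. e_coeff D *
      G 1 f (\<lambda>t. \<phi> (wcons (\<beta> + int (D + f) * N) (wcons (c - int D * N) t))) s)"
    unfolding sum_triangle by (intro sum.cong refl) simp
  also have "\<dots> = (\<Sum>f\<le>?T. \<Sum>D\<le>?T - f. e_coeff D *
      G 1 f (\<lambda>t. \<phi> (wcons (\<beta> + int (D + f) * N) (wcons (c - int D * N) t))) s)"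
    by (rule sum_triangle_swap)
  also have "\<dots> = (\<Sum>f\<le>?T. g (\<beta> - c) * G 1 f (\<lambda>t. \<phi> (wcons c (wcons (\<beta> + int f * N) t))) s)"
  proof (intro sum.cong refl)
    fix f assume f: "f \<in> {..?T}"
    let ?l = "\<beta> + int f * N"
    have lc: "?l \<le> c" using div_gap[of \<beta> c f] True f by simp
    have T: "?T - f = nat ((c - ?l) div N)"
    proof -
      have "(c - ?l) div N = (c - \<beta>) div N - int f"
        using N_pos div_mult_self1[of N "c - ?l" "int f"] by (simp add: algebra_simps)
      then show ?thesis by simp
    qed
    have "(\<Sum>D\<le>?T - f. e_coeff D * G 1 f (\<lambda>t. \<phi> (wcons (\<beta> + int (D + f) * N) (wcons (c - int D * N) t))) s)
       = G 1 f (\<lambda>t. \<Sum>D\<le>?T - f. e_coeff D * \<phi> (wcons (\<beta> + int (D + f) * N) (wcons (c - int D * N) t))) s"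
      by (rule G_linear[symmetric, OF ann2 _ s]) simp
    also have "\<dots> = G 1 f (\<lambda>t. \<Sum>i\<in>{()}. g (\<beta> - c) * \<phi> (wcons c (wcons ?l t))) s"
    proof (rule G_cong[OF _ s])
      fix t assume t: "t \<in> semi_infinite m"
      have "g (?l - c) = g (\<beta> - c)" using g_shift[of "\<beta> - c" "int f"] by (simp add: algebra_simps)
      then show "(\<Sum>D\<le>?T - f. e_coeff D * \<phi> (wcons (\<beta> + int (D + f) * N) (wcons (c - int D * N) t)))
        = (\<Sum>i\<in>{()}. g (\<beta> - c) * \<phi> (wcons c (wcons ?l t)))"
        using wedge_law[OF law[OF t] lc] unfolding T by (simp add: algebra_simps)
    qed
    also have "\<dots> = (\<Sum>i\<in>{()}. g (\<beta> - c) * G 1 f (\<lambda>t. \<phi> (wcons c (wcons ?l t))) s)"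
      by (rule G_linear[OF ann2 _ s]) simp
    finally show "(\<Sum>D\<le>?T - f. e_coeff D * G 1 f (\<lambda>t. \<phi> (wcons (\<beta> + int (D + f) * N) (wcons (c - int D * N) t))) s)
      = g (\<beta> - c) * G 1 f (\<lambda>t. \<phi> (wcons c (wcons ?l t))) s" by simp
  qed
  also have "\<dots> = g (\<beta> - c) * falling c \<beta> (\<lambda>t. \<phi> (wcons c t)) s"
    unfolding falling_eq_nat[OF True] sum_distrib_left ..
  also have "falling c \<beta> (\<lambda>t. \<phi> (wcons c t)) s = falling (c - 1) \<beta> (\<lambda>t. \<phi> (wcons c t)) s"
  proof -
    have "Gi 1 (c - \<beta>) (\<lambda>t. \<phi> (wcons c (wcons c t))) s = 0"
      using G_vanish[of m "\<lambda>t. \<phi> (wcons c (wcons c t))" 1 s] exchange_law_self[OF law] s by (simp add: Gi_def)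
    then show ?thesis by (subst falling_top) simp
  qed
  finally show ?thesis .
qed

text \<open>The term D = 0 leaves the particle in column c. The terms D > 0 share the coefficient 1
  - v and together form a falling particle; c - \<gamma> is the lowest index that it can
  reach.\<close>

lemma Gi_lowering_wcons:
  assumes "\<phi> \<in> ann (m + 1)" "s \<in> semi_infinite m"
  shows "Gi 1 \<gamma> \<phi> (wcons c s) = Gi 1 \<gamma> (\<lambda>t. \<phi> (wcons c t)) s
     + (if N dvd \<gamma> then (1 - v) * falling (c - 1) (c - \<gamma>) \<phi> s else 0)"
proof (cases "\<gamma> \<ge> 0 \<and> N dvd \<gamma>")
  case False
  then show ?thesis by (auto simp: Gi_def falling_def)
next
  case True
  then obtain k where "\<gamma> = N * k" by (auto simp: dvd_def)
  moreover then have "k \<ge> 0" using True N_pos by (simp add: zero_le_mult_iff)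
  ultimately obtain d where d: "\<gamma> = int d * N" using nonneg_int_cases[of k] by (metis mult.commute)
  have "G 1 d \<phi> (wcons c s) = (\<Sum>D\<le>d. e_coeff D * G 1 (d - D) (\<lambda>t. \<phi> (wcons (c - int D * N) t)) s)"
    using G_wcons[OF assms(1) _ assms(2), of 1 d c] by (simp add: mult.commute)
  also have "\<dots> = G 1 d (\<lambda>t. \<phi> (wcons c t)) s
      + (\<Sum>D\<in>{1..<Suc d}. e_coeff D * G 1 (d - D) (\<lambda>t. \<phi> (wcons (c - int D * N) t)) s)"
    unfolding lessThan_Suc_atMost[symmetric] by (subst sum_from1) (simp_all add: e_coeff_def)
  also have "(\<Sum>D\<in>{1..<Suc d}. e_coeff D * G 1 (d - D) (\<lambda>t. \<phi> (wcons (c - int D * N) t)) s)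
      = (1 - v) * falling (c - 1) (c - \<gamma>) \<phi> s"
  proof (cases d)
    case 0
    then show ?thesis by (simp add: falling_def d)
  next
    case (Suc d')
    have "int (Suc d') * N > 0" using N_pos by simp
    then have le: "c - \<gamma> \<le> c - 1" unfolding d Suc by linarith
    have "nat ((c - 1 - (c - \<gamma>)) div N) = d'"
    proof -
      have eq: "c - 1 - (c - \<gamma>) = (N - 1) + int d' * N" unfolding d Suc by (simp add: algebra_simps)
      have "((N - 1) + int d' * N) div N = int d' + (N - 1) div N"
        using N_pos by (intro div_mult_self1) simp
      moreover have "(N - 1) div N = 0" using N_pos by (intro div_pos_pos_trivial) auto
      ultimately show ?thesis unfolding eq by simp
    qed
    then have "falling (c - 1) (c - \<gamma>) \<phi> s = (\<Sum>f\<le>d'. G 1 f (\<lambda>t. \<phi> (wcons (c - \<gamma> + int f * N) t)) s)"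
      using falling_eq_nat[OF le] by simp
    moreover have "(\<Sum>D\<in>{1..<Suc d}. e_coeff D * G 1 (d - D) (\<lambda>t. \<phi> (wcons (c - int D * N) t)) s)
       = (\<Sum>f\<le>d'. (1 - v) * G 1 f (\<lambda>t. \<phi> (wcons (c - \<gamma> + int f * N) t)) s)"
    proof (rule sum.reindex_bij_witness[of _ "\<lambda>f. d - f" "\<lambda>D. d - D"])
      fix D assume D: "D \<in> {1..<Suc d}"
      then have cD: "c - \<gamma> + int (d - D) * N = c - int D * N" by (simp add: d of_nat_diff algebra_simps)
      show "(1 - v) * G 1 (d - D) (\<lambda>t. \<phi> (wcons (c - \<gamma> + int (d - D) * N) t)) s
        = e_coeff D * G 1 (d - D) (\<lambda>t. \<phi> (wcons (c - int D * N) t)) s"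
        unfolding cD using D by (simp add: e_coeff_def)
    qed (auto simp: Suc)
    ultimately show ?thesis by (simp add: sum_distrib_left)
  qed
  finally show ?thesis using True unfolding d Gi_mult by simp
qed

lemma delta_strip_wcons:
  "delta_strip n v g z L (c - 1) \<sigma> (wcons c \<eta>) \<xi> = delta_strip n v g z L (c - 1) \<sigma> \<eta> \<xi>"
  "delta_strip n v g z L (c - 1) \<sigma> \<eta> (wcons c \<xi>) = delta_strip n v g z L (c - 1) \<sigma> \<eta> \<xi>"
  unfolding delta_strip_def by (rule strip_cong; simp add: vertical_spin_wcons)+

lemma not_in_range_Omega: "s \<in> Omega m E (c - 1) \<Longrightarrow> c \<notin> range s"
proof
  assume s: "s \<in> Omega m E (c - 1)" and "c \<in> range s"
  then obtain i where "c = s i" by blast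
  then show False using normal_ordered_diff[of s m 0 i] s by (simp add: Omega_def)
qed

lemma powi_Suc: "(z::complex) \<noteq> 0 \<Longrightarrow> z powi (a + 1) = z * z powi a"
  by (simp add: power_int_add)

text \<open>The two statements belong to the two kinds of left edge. On a minus edge the decoration
  is forced to be \<beta> - c modulo N, since it grows by one per column and must be 0 where the
  particle lands. If it lands in column b, the columns from c down to b give z^(c - b + 1), and the
  energy b - \<beta> that the rest still has to lose gives z^(b - \<beta>); this explains the
  exponent c - \<beta> + 1.\<close>

lemma delta_main:
  assumes z: "z \<noteq> 0"
  shows "L \<le> c \<Longrightarrow> nat (c - L) = k \<Longrightarrow> \<xi> \<in> normal_ordered m \<Longrightarrow> \<xi> 0 \<le> c \<Longrightarrow> {..L} \<subseteq> range \<xi> \<Longrightarrow>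
    (\<forall>\<phi>\<in>ann m. \<forall>\<gamma>. z powi \<gamma> * Gi 1 \<gamma> \<phi> \<xi>
       = (\<Sum>\<eta>\<in>Omega m (energy m \<xi> - \<gamma>) c. delta_strip n v g z L c (Plus, 0) \<eta> \<xi> * \<phi> \<eta>)) \<and>
    (\<forall>\<phi>\<in>ann (m + 1). \<forall>\<beta>. \<forall>a\<in>{0..<N}.
       (if N dvd \<beta> - c - a then z powi (c - \<beta> + 1) * ((1 - v) * falling c \<beta> \<phi> \<xi>) else 0)
       = (\<Sum>\<eta>\<in>Omega (m + 1) (\<beta> + energy m \<xi>) c. delta_strip n v g z L c (Minus, a) \<eta> \<xi> * \<phi> \<eta>))"
proof (induction k arbitrary: c m \<xi>)
  case 0
  then have c: "c = L" by simp
  \<comment> \<open>At the right end only the vacuum is left. It cannot be lowered, and a particle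
    at or below L repeats one of its indices; this matches the default spin on the last
    edge.\<close>
  have vac: "m = L" "\<xi> = vac L" using normal_full_eq_vac[OF 0(3) _ 0(5)] 0(4) c by auto
  have D: "delta_strip n v g z L c \<sigma> \<eta> \<xi> = (if \<sigma> = (Plus, 0) then 1 else 0)" for \<sigma> \<eta>
    by (simp add: delta_strip_def c)
  have "z powi \<gamma> * Gi 1 \<gamma> \<phi> \<xi> = (\<Sum>\<eta>\<in>Omega m (energy m \<xi> - \<gamma>) c. delta_strip n v g z L c (Plus, 0) \<eta> \<xi> * \<phi> \<eta>)"
    if \<phi>: "\<phi> \<in> ann m" for \<phi> \<gamma>
  proof (cases "\<gamma> = 0")
    case True
    then show ?thesis unfolding D by (simp add: c vac Omega_vac energy_vac Gi_def)
  next
    case False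
    have "Gi 1 \<gamma> \<phi> \<xi> = 0"
    proof (cases "\<gamma> > 0 \<and> N dvd \<gamma>")
      case True
      then have "nat (\<gamma> div N) > 0" using N_pos by (auto simp: dvd_def zero_less_mult_iff)
      then show ?thesis using G_lowering_vac[OF \<phi>] vac by (simp add: Gi_def)
    next
      case False
      then show ?thesis using \<open>\<gamma> \<noteq> 0\<close> by (auto simp: Gi_def)
    qed
    moreover have "Omega m (energy m \<xi> - \<gamma>) c = {}"
      using False by (simp add: c vac Omega_vac energy_vac)
    ultimately show ?thesis by simp
  qed
  moreover have "falling c \<beta> \<phi> \<xi> = 0" if \<phi>: "\<phi> \<in> ann (m + 1)" for \<phi> \<beta>
    unfolding falling_def
  proof (rule sum.neutral, rule ballI)
    fix b assume b: "b \<in> {\<beta>..c}"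
    have an: "(\<lambda>t. \<phi> (wcons b t)) \<in> ann m" by (rule ann_wcons[OF \<phi>])
    show "Gi 1 (b - \<beta>) (\<lambda>t. \<phi> (wcons b t)) \<xi> = 0"
    proof (cases "nat ((b - \<beta>) div N) = 0")
      case True
      have "\<phi> (wcons b (vac L)) = 0" using wedge_vac_zero[of \<phi> L b] \<phi> b c vac by simp
      then show ?thesis using vac(2) by (simp add: Gi_def True)
    next
      case False
      then show ?thesis using G_lowering_vac[OF an] vac by (simp add: Gi_def)
    qed
  qed
  ultimately show ?case by (simp add: D)
next
  case (Suc k)
  have cL: "c > L" using Suc.prems(2) by simp
  have k: "nat (c - 1 - L) = k" "L \<le> c - 1" using Suc.prems(2) cL by auto
  note steps = delta_strip_steps[OF cL n_pos, of _ _ v g z]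
  have semi: "\<xi> \<in> semi_infinite m" using Suc.prems(3) by (simp add: normal_ordered_def)
  have modN: "(a + 1) mod N \<in> {0..<N}" for a using N_pos by simp
  have shift: "N dvd \<beta> - (c - 1) - ((a + 1) mod N) \<longleftrightarrow> N dvd \<beta> - c - a" for \<beta> a
  proof -
    have "\<beta> - (c - 1) - ((a + 1) mod N) = (\<beta> - c - a) + ((a + 1) - (a + 1) mod N)" by simp
    moreover have "N dvd (a + 1) - (a + 1) mod N" by (rule dvd_minus_mod)
    ultimately show ?thesis by (metis dvd_add_left_iff)
  qed
  have pw: "c - 1 - \<beta> + 1 = c - \<beta>" for \<beta> by simp
  show ?case
  proof (cases "c \<in> range \<xi>")
    case False
    have "\<xi> 0 \<noteq> c" using False by blast
    then have x0: "\<xi> 0 \<le> c - 1" using Suc.prems(4) by simp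
    note IH = Suc.IH[OF k(2) k(1) Suc.prems(3) x0 Suc.prems(5)]
    have P1: "z powi \<gamma> * Gi 1 \<gamma> \<phi> \<xi>
       = (\<Sum>\<eta>\<in>Omega m (energy m \<xi> - \<gamma>) (c - 1). delta_strip n v g z L (c - 1) (Plus, 0) \<eta> \<xi> * \<phi> \<eta>)"
      if "\<phi> \<in> ann m" for \<phi> \<gamma> by (rule bspec[OF conjunct1[OF IH] that, THEN spec])
    have P2: "(if N dvd \<beta> - (c - 1) - a then z powi (c - 1 - \<beta> + 1) * ((1 - v) * falling (c - 1) \<beta> \<phi> \<xi>) else 0)
       = (\<Sum>\<eta>\<in>Omega (m + 1) (\<beta> + energy m \<xi>) (c - 1). delta_strip n v g z L (c - 1) (Minus, a) \<eta> \<xi> * \<phi> \<eta>)"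
      if "\<phi> \<in> ann (m + 1)" "a \<in> {0..<N}" for \<phi> \<beta> a
      by (rule bspec[OF conjunct2[OF IH] that(1), THEN spec, THEN bspec, OF that(2)])
    show ?thesis
    proof (intro conjI ballI allI)
      fix \<phi> \<gamma> assume \<phi>: "\<phi> \<in> ann m"
      have "(\<Sum>\<eta>\<in>Omega m (energy m \<xi> - \<gamma>) c. delta_strip n v g z L c (Plus, 0) \<eta> \<xi> * \<phi> \<eta>)
          = (\<Sum>\<eta>\<in>Omega (m - 1) (energy m \<xi> - \<gamma> - c) (c - 1). delta_strip n v g z L c (Plus, 0) (wcons c \<eta>) \<xi> * \<phi> (wcons c \<eta>))
          + (\<Sum>\<eta>\<in>Omega m (energy m \<xi> - \<gamma>) (c - 1). delta_strip n v g z L c (Plus, 0) \<eta> \<xi> * \<phi> \<eta>)"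
        by (rule sum_Omega_split[of _ "m - 1", unfolded diff_add_cancel])
      also have "(\<Sum>\<eta>\<in>Omega (m - 1) (energy m \<xi> - \<gamma> - c) (c - 1). delta_strip n v g z L c (Plus, 0) (wcons c \<eta>) \<xi> * \<phi> (wcons c \<eta>)) = 0"
        by (rule sum.neutral) (simp add: steps(4) False range_wcons)
      also have "(\<Sum>\<eta>\<in>Omega m (energy m \<xi> - \<gamma>) (c - 1). delta_strip n v g z L c (Plus, 0) \<eta> \<xi> * \<phi> \<eta>)
          = z powi \<gamma> * Gi 1 \<gamma> \<phi> \<xi>"
        unfolding P1[OF \<phi>] by (intro sum.cong refl) (simp add: steps(1) False not_in_range_Omega)
      finally show "z powi \<gamma> * Gi 1 \<gamma> \<phi> \<xi>
          = (\<Sum>\<eta>\<in>Omega m (energy m \<xi> - \<gamma>) c. delta_strip n v g z L c (Plus, 0) \<eta> \<xi> * \<phi> \<eta>)" by simp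
    next
      fix \<phi> \<beta> a assume \<phi>: "\<phi> \<in> ann (m + 1)" and a: "a \<in> {0..<N}"
      let ?G = "Gi 1 (c - \<beta>) (\<lambda>t. \<phi> (wcons c t)) \<xi>"
      have "(\<Sum>\<eta>\<in>Omega (m + 1) (\<beta> + energy m \<xi>) c. delta_strip n v g z L c (Minus, a) \<eta> \<xi> * \<phi> \<eta>)
          = (\<Sum>\<eta>\<in>Omega m (\<beta> + energy m \<xi> - c) (c - 1). delta_strip n v g z L c (Minus, a) (wcons c \<eta>) \<xi> * \<phi> (wcons c \<eta>))
          + (\<Sum>\<eta>\<in>Omega (m + 1) (\<beta> + energy m \<xi>) (c - 1). delta_strip n v g z L c (Minus, a) \<eta> \<xi> * \<phi> \<eta>)"
        by (rule sum_Omega_split)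
      also have "(\<Sum>\<eta>\<in>Omega m (\<beta> + energy m \<xi> - c) (c - 1). delta_strip n v g z L c (Minus, a) (wcons c \<eta>) \<xi> * \<phi> (wcons c \<eta>))
          = (if a = 0 then (1 - v) * z * (\<Sum>\<eta>\<in>Omega m (energy m \<xi> - (c - \<beta>)) (c - 1). delta_strip n v g z L (c - 1) (Plus, 0) \<eta> \<xi> * \<phi> (wcons c \<eta>)) else 0)"
      proof -
        have E: "\<beta> + energy m \<xi> - c = energy m \<xi> - (c - \<beta>)" by simp
        show ?thesis unfolding E
          by (simp add: steps(7) False range_wcons delta_strip_wcons sum_distrib_left mult.assoc)
      qed
      also have "\<dots> = (if a = 0 then (1 - v) * z * (z powi (c - \<beta>) * ?G) else 0)"
        using P1[OF ann_wcons[OF \<phi>, of c], of "c - \<beta>"] by simp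
      also have "(\<Sum>\<eta>\<in>Omega (m + 1) (\<beta> + energy m \<xi>) (c - 1). delta_strip n v g z L c (Minus, a) \<eta> \<xi> * \<phi> \<eta>)
          = z * (\<Sum>\<eta>\<in>Omega (m + 1) (\<beta> + energy m \<xi>) (c - 1). delta_strip n v g z L (c - 1) (Minus, (a + 1) mod N) \<eta> \<xi> * \<phi> \<eta>)"
        unfolding sum_distrib_left by (intro sum.cong refl) (simp add: steps(6) False not_in_range_Omega)
      also have "\<dots> = z * (if N dvd \<beta> - c - a then z powi (c - \<beta>) * ((1 - v) * falling (c - 1) \<beta> \<phi> \<xi>) else 0)"
        unfolding P2[OF \<phi> modN, of \<beta> a, unfolded shift pw] ..
      also have "(if a = 0 then (1 - v) * z * (z powi (c - \<beta>) * ?G) else 0) + z * (if N dvd \<beta> - c - a then z powi (c - \<beta>) * ((1 - v) * falling (c - 1) \<beta> \<phi> \<xi>) else 0)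
          = (if N dvd \<beta> - c - a then z powi (c - \<beta> + 1) * ((1 - v) * falling c \<beta> \<phi> \<xi>) else 0)"
      proof -
        \<comment> \<open>If N divides c - \<beta>, the congruence holds exactly for a = 0; so in
          case of a mismatch the landing term vanishes.\<close>
        have G0: "?G = 0" if "(a = 0) \<noteq> (N dvd \<beta> - c - a)"
        proof (rule Gi_not_dvd)
          show "\<not> N dvd c - \<beta>"
          proof
            assume dv: "N dvd c - \<beta>"
            have "\<beta> - c - a = - (c - \<beta>) - a" by simp
            then have "N dvd \<beta> - c - a \<longleftrightarrow> N dvd a" using dv by (metis dvd_diff_right_iff dvd_minus_iff)
            moreover have "N dvd a \<longleftrightarrow> a = 0" using a zdvd_not_zless[of a N] by (cases "a = 0") auto
            ultimately show False using that by blast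
          qed
        qed
        show ?thesis
          using G0 unfolding falling_top[of c] powi_Suc[OF z] by (auto simp: algebra_simps)
      qed
      finally show "(if N dvd \<beta> - c - a then z powi (c - \<beta> + 1) * ((1 - v) * falling c \<beta> \<phi> \<xi>) else 0)
          = (\<Sum>\<eta>\<in>Omega (m + 1) (\<beta> + energy m \<xi>) c. delta_strip n v g z L c (Minus, a) \<eta> \<xi> * \<phi> \<eta>)" by simp
    qed
  next
    case True
    define m' where "m' = m - 1"
    have m: "m = m' + 1" by (simp add: m'_def)
    obtain b t where bt: "\<xi> = wcons b t" "t \<in> normal_ordered m'" "t 0 < b"
      using normal_ordered_cases[of \<xi> m'] Suc.prems(3) m by auto
    have "b = c"
    proof (rule ccontr)
      assume "b \<noteq> c"
      then have "\<xi> \<in> Omega m (energy m \<xi>) (c - 1)" using Suc.prems(3,4) bt by (simp add: Omega_def)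
      then show False using True not_in_range_Omega by blast
    qed
    then have \<xi>: "\<xi> = wcons c t" and t0: "t 0 \<le> c - 1" using bt by auto
    have tsemi: "t \<in> semi_infinite m'" using bt(2) by (simp add: normal_ordered_def)
    have full: "{..L} \<subseteq> range t" using Suc.prems(5) cL unfolding \<xi> range_wcons by auto
    have en: "energy m \<xi> = c + energy m' t" unfolding \<xi> m by (rule energy_wcons[OF tsemi])
    note IH = Suc.IH[OF k(2) k(1) bt(2) t0 full]
    have P1: "z powi \<gamma> * Gi 1 \<gamma> \<phi> t
       = (\<Sum>\<eta>\<in>Omega m' (energy m' t - \<gamma>) (c - 1). delta_strip n v g z L (c - 1) (Plus, 0) \<eta> t * \<phi> \<eta>)"
      if "\<phi> \<in> ann m'" for \<phi> \<gamma> by (rule bspec[OF conjunct1[OF IH] that, THEN spec])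
    have P2: "(if N dvd \<beta> - (c - 1) - a then z powi (c - 1 - \<beta> + 1) * ((1 - v) * falling (c - 1) \<beta> \<phi> t) else 0)
       = (\<Sum>\<eta>\<in>Omega m (\<beta> + energy m' t) (c - 1). delta_strip n v g z L (c - 1) (Minus, a) \<eta> t * \<phi> \<eta>)"
      if "\<phi> \<in> ann m" "a \<in> {0..<N}" for \<phi> \<beta> a
      using bspec[OF conjunct2[OF IH], THEN spec, THEN bspec, of \<phi> a \<beta>] that unfolding m by simp
    show ?thesis
    proof (intro conjI ballI allI)
      fix \<phi> \<gamma> assume \<phi>: "\<phi> \<in> ann m"
      have \<phi>': "\<phi> \<in> ann (m' + 1)" using \<phi> m by simp
      have "(\<Sum>\<eta>\<in>Omega m (energy m \<xi> - \<gamma>) c. delta_strip n v g z L c (Plus, 0) \<eta> \<xi> * \<phi> \<eta>)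
          = (\<Sum>\<eta>\<in>Omega m' (energy m' t - \<gamma>) (c - 1). delta_strip n v g z L c (Plus, 0) (wcons c \<eta>) \<xi> * \<phi> (wcons c \<eta>))
          + (\<Sum>\<eta>\<in>Omega m (c - \<gamma> + energy m' t) (c - 1). delta_strip n v g z L c (Plus, 0) \<eta> \<xi> * \<phi> \<eta>)"
      proof -
        have E: "energy m \<xi> - \<gamma> = c - \<gamma> + energy m' t" "c - \<gamma> + energy m' t - c = energy m' t - \<gamma>"
          unfolding en by simp_all
        show ?thesis unfolding E(1) using sum_Omega_split[of _ m' "c - \<gamma> + energy m' t" c] unfolding m E(2) .
      qed
      also have "(\<Sum>\<eta>\<in>Omega m' (energy m' t - \<gamma>) (c - 1). delta_strip n v g z L c (Plus, 0) (wcons c \<eta>) \<xi> * \<phi> (wcons c \<eta>))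
          = z powi \<gamma> * Gi 1 \<gamma> (\<lambda>s. \<phi> (wcons c s)) t"
        unfolding P1[OF ann_wcons[OF \<phi>'], of \<gamma> c]
        by (intro sum.cong refl) (simp add: steps(2) \<xi> range_wcons delta_strip_wcons)
      also have "(\<Sum>\<eta>\<in>Omega m (c - \<gamma> + energy m' t) (c - 1). delta_strip n v g z L c (Plus, 0) \<eta> \<xi> * \<phi> \<eta>)
          = (\<Sum>\<eta>\<in>Omega m (c - \<gamma> + energy m' t) (c - 1). delta_strip n v g z L (c - 1) (Minus, 1 mod N) \<eta> t * \<phi> \<eta>)"
        by (intro sum.cong refl) (simp add: steps(3) \<xi> range_wcons delta_strip_wcons not_in_range_Omega)
      also have "\<dots> = (if N dvd \<gamma> then z powi \<gamma> * ((1 - v) * falling (c - 1) (c - \<gamma>) \<phi> t) else 0)"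
      proof -
        have E: "N dvd c - \<gamma> - c - 0 \<longleftrightarrow> N dvd \<gamma>" "c - (c - \<gamma>) = \<gamma>" by simp_all
        show ?thesis using P2[OF \<phi> modN, of "c - \<gamma>" 0] unfolding shift pw E by simp
      qed
      finally show "z powi \<gamma> * Gi 1 \<gamma> \<phi> \<xi>
          = (\<Sum>\<eta>\<in>Omega m (energy m \<xi> - \<gamma>) c. delta_strip n v g z L c (Plus, 0) \<eta> \<xi> * \<phi> \<eta>)"
        unfolding \<xi> Gi_lowering_wcons[OF \<phi>' tsemi] by (simp add: algebra_simps)
    next
      fix \<phi> \<beta> a assume \<phi>: "\<phi> \<in> ann (m + 1)" and a: "a \<in> {0..<N}"
      have "(\<Sum>\<eta>\<in>Omega (m + 1) (\<beta> + energy m \<xi>) c. delta_strip n v g z L c (Minus, a) \<eta> \<xi> * \<phi> \<eta>)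
          = (\<Sum>\<eta>\<in>Omega m (\<beta> + energy m' t) (c - 1). delta_strip n v g z L c (Minus, a) (wcons c \<eta>) \<xi> * \<phi> (wcons c \<eta>))
          + (\<Sum>\<eta>\<in>Omega (m + 1) (\<beta> + energy m \<xi>) (c - 1). delta_strip n v g z L c (Minus, a) \<eta> \<xi> * \<phi> \<eta>)"
      proof -
        have E: "\<beta> + energy m \<xi> - c = \<beta> + energy m' t" unfolding en by simp
        show ?thesis using sum_Omega_split[of _ m "\<beta> + energy m \<xi>" c] unfolding E .
      qed
      also have "(\<Sum>\<eta>\<in>Omega (m + 1) (\<beta> + energy m \<xi>) (c - 1). delta_strip n v g z L c (Minus, a) \<eta> \<xi> * \<phi> \<eta>) = 0"
        by (rule sum.neutral) (simp add: steps(8) True not_in_range_Omega)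
      also have "(\<Sum>\<eta>\<in>Omega m (\<beta> + energy m' t) (c - 1). delta_strip n v g z L c (Minus, a) (wcons c \<eta>) \<xi> * \<phi> (wcons c \<eta>))
          = g a * z * (\<Sum>\<eta>\<in>Omega m (\<beta> + energy m' t) (c - 1). delta_strip n v g z L (c - 1) (Minus, (a + 1) mod N) \<eta> t * \<phi> (wcons c \<eta>))"
        unfolding sum_distrib_left
        by (intro sum.cong refl) (simp add: steps(5) \<xi> range_wcons delta_strip_wcons)
      also have "\<dots> = g a * z * (if N dvd \<beta> - c - a then z powi (c - \<beta>) * ((1 - v) * falling (c - 1) \<beta> (\<lambda>s. \<phi> (wcons c s)) t) else 0)"
        unfolding P2[OF ann_wcons[OF \<phi>] modN, of \<beta> a c, unfolded shift pw] ..
      also have "\<dots> = (if N dvd \<beta> - c - a then z powi (c - \<beta> + 1) * ((1 - v) * falling c \<beta> \<phi> \<xi>) else 0)"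
      proof -
        have "g (\<beta> - c) = g a" if "N dvd \<beta> - c - a"
          using that by (intro g_mod) (simp add: mod_eq_dvd_iff)
        moreover have "falling c \<beta> \<phi> \<xi> = g (\<beta> - c) * falling (c - 1) \<beta> (\<lambda>s. \<phi> (wcons c s)) t"
          unfolding \<xi> using \<phi> by (intro falling_wcons[OF _ tsemi]) (simp add: m)
        ultimately show ?thesis unfolding powi_Suc[OF z] by simp
      qed
      finally show "(if N dvd \<beta> - c - a then z powi (c - \<beta> + 1) * ((1 - v) * falling c \<beta> \<phi> \<xi>) else 0)
          = (\<Sum>\<eta>\<in>Omega (m + 1) (\<beta> + energy m \<xi>) c. delta_strip n v g z L c (Minus, a) \<eta> \<xi> * \<phi> \<eta>)" by simp
    qed
  qed
qed

end

section \<open>Gamma ice\<close>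

lemma normal_ordered_full:
  assumes s: "s \<in> normal_ordered m" and L: "L \<le> m - (energy m s - m * (m + 1) div 2)"
  shows "{..L} \<subseteq> range s"
proof
  fix x assume "x \<in> {..L}"
  then have x: "x \<le> m - (energy m s - m * (m + 1) div 2)" using L by simp
  define j where "j = nat (m - x)"
  have "x \<le> m" using x normal_ordered_energy(1)[OF s] by simp
  then have j: "int j = m - x" by (simp add: j_def)
  have "\<not> s j > m - int j" using normal_ordered_energy(2)[OF s, of j] j x by auto
  then have "s j = x" using normal_ordered_ge[OF s, of j] j by simp
  then show "x \<in> range s" by blast
qed

lemma normal_ordered_top:
  assumes s: "s \<in> normal_ordered m"
  shows "s 0 \<le> m + (energy m s - m * (m + 1) div 2)"
proof -
  obtain K0 where K0: "\<And>i. i \<ge> K0 \<Longrightarrow> s i = m - int i"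
    using s by (auto simp: normal_ordered_def semi_infinite_def)
  define K where "K = Suc K0"
  have E: "energy m s = (\<Sum>i<K. s i - (m - int i)) + m * (m + 1) div 2"
    by (rule energy_sum) (use K0 in \<open>auto simp: K_def\<close>)
  have "s 0 - (m - int 0) \<le> (\<Sum>i<K. s i - (m - int i))"
  proof (rule member_le_sum)
    show "0 \<le> s i - (m - int i)" for i using normal_ordered_ge[OF s, of i] by simp
  qed (auto simp: K_def)
  then show ?thesis unfolding E by simp
qed

lemma vertical_spin_full: "{..L} \<subseteq> range s \<Longrightarrow> c \<le> L \<Longrightarrow> vertical_spin s c = Minus"
  by (auto simp: vertical_spin_def)

lemma vertical_spin_above: "s \<in> normal_ordered m \<Longrightarrow> s 0 \<le> C \<Longrightarrow> c > C \<Longrightarrow> vertical_spin s c = Plus"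
proof -
  assume a: "s \<in> normal_ordered m" "s 0 \<le> C" "c > C"
  have "s i \<noteq> c" for i using normal_ordered_diff[OF a(1), of 0 i] a by simp
  then show ?thesis by (auto simp: vertical_spin_def)
qed

lemma T_Delta_eq_strip:
  assumes "n \<ge> 1" "\<xi> \<in> normal_ordered m" "\<eta> \<in> normal_ordered m" "\<xi> 0 \<le> C" "\<eta> 0 \<le> C"
    "{..L} \<subseteq> range \<xi>" "{..L} \<subseteq> range \<eta>" "L \<le> C"
  shows "T_Delta n v g z \<eta> \<xi> = delta_strip n v g z L C (Plus, 0) \<eta> \<xi>"
  unfolding T_Delta_def delta_strip_def
proof (rule ice_partition_eq_strip)
  show above: "vertical_spin \<xi> c = vertical_spin \<eta> c" if "c > C" for c
    using vertical_spin_above[OF assms(2,4) that] vertical_spin_above[OF assms(3,5) that] by simp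
  show below: "vertical_spin \<xi> c = vertical_spin \<eta> c" if "c \<le> L" for c
    using vertical_spin_full[OF assms(6) that] vertical_spin_full[OF assms(7) that] by simp
  show "delta_weight n v g z (Plus, 0) t (Plus, 0) t = Some 1" for t by (cases t) simp_all
  show "h c = (Plus, 0)" if "h \<in> admissible_states n (Plus, 0) (delta_weight n v g z) \<eta> \<xi>" "c \<ge> C \<or> c \<le> L" for h c
    by (rule default_outside[OF that(1) _ above below that(2)]) (use delta_same in fastforce)
qed (use assms in \<open>auto simp: spins_def\<close>)

lemma T_Gamma_eq_strip:
  assumes "n \<ge> 1" "\<xi> \<in> normal_ordered m" "\<eta> \<in> normal_ordered m" "\<xi> 0 \<le> C" "\<eta> 0 \<le> C"
    "{..L} \<subseteq> range \<xi>" "{..L} \<subseteq> range \<eta>" "L \<le> C"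
  shows "T_Gamma n v g z \<eta> \<xi> = gamma_strip n v g z L C (Minus, 0) \<eta> \<xi>"
  unfolding T_Gamma_def gamma_strip_def
proof (rule ice_partition_eq_strip)
  show above: "vertical_spin \<xi> c = vertical_spin \<eta> c" if "c > C" for c
    using vertical_spin_above[OF assms(2,4) that] vertical_spin_above[OF assms(3,5) that] by simp
  show below: "vertical_spin \<xi> c = vertical_spin \<eta> c" if "c \<le> L" for c
    using vertical_spin_full[OF assms(6) that] vertical_spin_full[OF assms(7) that] by simp
  show "gamma_weight n v g z (Minus, 0) t (Minus, 0) t = Some 1" for t by (cases t) simp_all
  show "h c = (Minus, 0)" if "h \<in> admissible_states n (Minus, 0) (gamma_weight n v g z) \<eta> \<xi>" "c \<ge> C \<or> c \<le> L" for h c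
    by (rule default_outside[OF that(1) _ above below that(2)]) (use gamma_same in fastforce)
qed (use assms in \<open>auto simp: spins_def\<close>)

lemma Omega_large: "c \<ge> m + (E - m * (m + 1) div 2) \<Longrightarrow> Omega m E c = {s \<in> normal_ordered m. energy m s = E}"
  using normal_ordered_top unfolding Omega_def by fastforce

lemma Omega_low: "E < m * (m + 1) div 2 \<Longrightarrow> Omega m E c = {}"
  using normal_ordered_energy(1) unfolding Omega_def by fastforce

lemma gamma_strip_wcons:
  "c < b \<Longrightarrow> gamma_strip n v g z L c \<sigma> (wcons b \<eta>) \<xi> = gamma_strip n v g z L c \<sigma> \<eta> \<xi>"
  "c < b \<Longrightarrow> gamma_strip n v g z L c \<sigma> \<eta> (wcons b \<xi>) = gamma_strip n v g z L c \<sigma> \<eta> \<xi>"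
  unfolding gamma_strip_def by (rule strip_cong; simp add: vertical_spin_wcons)+

context fock_params begin

text \<open>Since \<epsilon>^2 = 1, both signs are treated at once: \<epsilon> times the energy
  difference is N times the degree.\<close>

lemma half_vertex_Gi:
  assumes "\<epsilon> = 1 \<or> \<epsilon> = -1" "z \<noteq> 0" "\<xi> \<in> semi_infinite m"
  shows "half_vertex_coeff n v g m \<epsilon> z \<eta> \<xi>
    = z powi (energy m \<xi> - energy m \<eta>) * Gi \<epsilon> (\<epsilon> * (energy m \<xi> - energy m \<eta>)) (coordinate m \<eta>) \<xi>"
proof -
  let ?e = "energy m \<xi> - energy m \<eta>"
  have ne: "\<epsilon> \<noteq> 0" and sq: "\<epsilon> * \<epsilon> = 1" using assms(1) by auto
  show ?thesis
  proof (cases "\<exists>d. energy m \<xi> = energy m \<eta> + N * \<epsilon> * int d")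
    case True
    then obtain d where d: "energy m \<xi> = energy m \<eta> + N * \<epsilon> * int d" by blast
    have e: "?e = \<epsilon> * N * int d" using d by (simp add: mult.commute)
    have "\<epsilon> * (\<epsilon> * N * int d) = (\<epsilon> * \<epsilon>) * (int d * N)" by (simp only: mult_ac)
    then have "\<epsilon> * (\<epsilon> * N * int d) = int d * N" unfolding sq by simp
    then show ?thesis unfolding half_vertex_coeff_eq(1)[OF ne assms(2,3) d] e by (simp only: Gi_mult)
  next
    case False
    have "Gi \<epsilon> (\<epsilon> * ?e) (coordinate m \<eta>) \<xi> = 0"
    proof (cases "\<epsilon> * ?e \<ge> 0 \<and> N dvd \<epsilon> * ?e")
      case True
      then obtain k where k: "\<epsilon> * ?e = N * k" by (auto simp: dvd_def)
      then have "k \<ge> 0" using True N_pos by (simp add: zero_le_mult_iff)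
      then have "\<epsilon> * (\<epsilon> * ?e) = \<epsilon> * (N * int (nat k))" using k by simp
      then have "?e = N * \<epsilon> * int (nat k)" unfolding mult.assoc[symmetric] sq by (simp add: mult_ac)
      then have "energy m \<xi> = energy m \<eta> + N * \<epsilon> * int (nat k)" by simp
      then show ?thesis using False by blast
    qed (auto simp: Gi_def)
    then show ?thesis using half_vertex_coeff_eq(2)[OF ne assms(2,3), of \<eta>] False by auto
  qed
qed

text \<open>Testing an identity of functionals on the coordinate of \<eta> extracts the matrix
  coefficient at \<eta>.\<close>

lemma sum_coordinate:
  assumes "\<eta> \<in> Omega m E c"
  shows "(\<Sum>\<zeta>\<in>Omega m E c. F \<zeta> * coordinate m \<eta> \<zeta>) = F \<eta>"
proof -
  have "(\<Sum>\<zeta>\<in>Omega m E c. F \<zeta> * coordinate m \<eta> \<zeta>) = (\<Sum>\<zeta>\<in>{\<eta>}. F \<zeta> * coordinate m \<eta> \<zeta>)"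
  proof (rule sum.mono_neutral_right)
    show "\<forall>\<zeta>\<in>Omega m E c - {\<eta>}. F \<zeta> * coordinate m \<eta> \<zeta> = 0"
      by (auto simp: coordinate_normal Omega_def)
  qed (use assms in \<open>auto simp: finite_Omega\<close>)
  also have "\<dots> = F \<eta>" using assms by (simp add: coordinate_normal Omega_def)
  finally show ?thesis .
qed

theorem exp_H_plus_eq:
  assumes z: "z \<noteq> 0" and \<xi>: "\<xi> \<in> normal_ordered m" and \<eta>: "\<eta> \<in> normal_ordered m"
  shows "exp_H_plus n v g m z \<eta> \<xi> = T_Delta n v g z \<eta> \<xi>"
proof -
  define C where "C = max (\<xi> 0) (\<eta> 0)"
  \<comment> \<open>Below m minus the energy excess every column is occupied in both rows, so the
    ice is frozen there.\<close>
  define L where "L = min C (m - max (energy m \<xi>) (energy m \<eta>) + m * (m + 1) div 2)"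
  have full: "{..L} \<subseteq> range \<xi>" "{..L} \<subseteq> range \<eta>"
    by (rule normal_ordered_full[OF \<xi>], simp add: L_def) (rule normal_ordered_full[OF \<eta>], simp add: L_def)
  have LC: "L \<le> C" and top: "\<xi> 0 \<le> C" "\<eta> 0 \<le> C" by (auto simp: L_def C_def)
  let ?\<gamma> = "energy m \<xi> - energy m \<eta>"
  have "z powi ?\<gamma> * Gi 1 ?\<gamma> (coordinate m \<eta>) \<xi>
      = (\<Sum>\<zeta>\<in>Omega m (energy m \<xi> - ?\<gamma>) C. delta_strip n v g z L C (Plus, 0) \<zeta> \<xi> * coordinate m \<eta> \<zeta>)"
    by (rule bspec[OF conjunct1[OF delta_main[OF z LC refl \<xi> top(1) full(1)]] coordinate_ann, THEN spec])
  also have "\<dots> = delta_strip n v g z L C (Plus, 0) \<eta> \<xi>"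
    by (rule sum_coordinate) (use \<eta> top in \<open>simp add: Omega_def\<close>)
  also have "\<dots> = T_Delta n v g z \<eta> \<xi>"
    by (rule T_Delta_eq_strip[symmetric, OF n_pos \<xi> \<eta> top full LC])
  finally show ?thesis
    unfolding exp_H_plus_def using half_vertex_Gi[of 1 z \<xi> m \<eta>] z \<xi> by (simp add: normal_ordered_def)
qed

text \<open>Terms with D N > \<gamma> vanish. The cutoff M is left free because the same recursion
  for the ice holds from some other cutoff on.\<close>

lemma Gi_raising_wcons:
  assumes "\<phi> \<in> ann (m + 1)" "s \<in> semi_infinite m" "\<gamma> \<le> int M"
  shows "Gi (-1) \<gamma> \<phi> (wcons a s) = (\<Sum>D\<le>M. e_coeff D * Gi (-1) (\<gamma> - int D * N) (\<lambda>t. \<phi> (wcons (a + int D * N) t)) s)"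
proof (cases "\<gamma> \<ge> 0 \<and> N dvd \<gamma>")
  case False
  have "Gi (-1) (\<gamma> - int D * N) \<psi> s = 0" for D \<psi>
  proof (cases "N dvd \<gamma>")
    case True
    have "int D * N \<ge> 0" using N_pos by simp
    moreover have "\<gamma> < 0" using False True by auto
    ultimately have "\<gamma> - int D * N < 0" by linarith
    then show ?thesis by (rule Gi_neg)
  next
    case False
    then have "\<not> N dvd \<gamma> - int D * N" by (metis dvd_diff_left_iff dvd_triv_right)
    then show ?thesis by (rule Gi_not_dvd)
  qed
  moreover have "Gi (-1) \<gamma> \<phi> (wcons a s) = 0" using False by (auto simp: Gi_def)
  ultimately show ?thesis by simp
next
  case True
  then obtain k where "\<gamma> = N * k" by (auto simp: dvd_def)
  moreover then have "k \<ge> 0" using True N_pos by (simp add: zero_le_mult_iff)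
  ultimately obtain d where d: "\<gamma> = int d * N" using nonneg_int_cases[of k] by (metis mult.commute)
  have "int d \<le> int d * N" using N_pos by (simp add: mult_le_cancel_left1)
  then have dM: "d \<le> M" using assms(3) d by linarith
  have "G (-1) d \<phi> (wcons a s) = (\<Sum>D\<le>d. e_coeff D * G (-1) (d - D) (\<lambda>t. \<phi> (wcons (a + int D * N) t)) s)"
    using G_wcons[OF assms(1) _ assms(2), of "-1" d a] by (simp add: mult.commute)
  also have "\<dots> = (\<Sum>D\<le>d. e_coeff D * Gi (-1) (\<gamma> - int D * N) (\<lambda>t. \<phi> (wcons (a + int D * N) t)) s)"
  proof (intro sum.cong refl)
    fix D assume "D \<in> {..d}"
    then have "\<gamma> - int D * N = int (d - D) * N" by (simp add: d of_nat_diff algebra_simps)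
    then show "e_coeff D * G (-1) (d - D) (\<lambda>t. \<phi> (wcons (a + int D * N) t)) s
      = e_coeff D * Gi (-1) (\<gamma> - int D * N) (\<lambda>t. \<phi> (wcons (a + int D * N) t)) s"
      by (simp only: Gi_mult)
  qed
  also have "\<dots> = (\<Sum>D\<le>M. e_coeff D * Gi (-1) (\<gamma> - int D * N) (\<lambda>t. \<phi> (wcons (a + int D * N) t)) s)"
  proof (rule sum.mono_neutral_left)
    show "\<forall>D\<in>{..M} - {..d}. e_coeff D * Gi (-1) (\<gamma> - int D * N) (\<lambda>t. \<phi> (wcons (a + int D * N) t)) s = 0"
    proof
      fix D assume "D \<in> {..M} - {..d}"
      then have "int d < int D" by simp
      then have "\<gamma> - int D * N < 0" unfolding d using N_pos by simp
      then show "e_coeff D * Gi (-1) (\<gamma> - int D * N) (\<lambda>t. \<phi> (wcons (a + int D * N) t)) s = 0"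
        by (simp add: Gi_neg)
    qed
  qed (use dM in auto)
  finally show ?thesis by (simp add: d Gi_mult)
qed

section \<open>Gamma ice above the top wedge\<close>

lemma gamma_strip_rise:
  assumes z: "z \<noteq> 0" and cL: "c \<ge> L" and x: "\<And>b. b > c \<Longrightarrow> b \<notin> range \<xi>"
  shows "(\<Sum>\<eta>\<in>Omega m E (c + int k). gamma_strip n v g z L (c + int k) (Plus, a mod N) \<eta> \<xi> * \<phi> \<eta>)
    = z powi (- int k) * (\<Sum>\<eta>\<in>Omega m E c. gamma_strip n v g z L c (Plus, (a - int k) mod N) \<eta> \<xi> * \<phi> \<eta>)"
proof (induction k arbitrary: a)
  case (Suc k)
  let ?C = "c + int (Suc k)"
  have CL: "?C > L" and C1: "?C - 1 = c + int k" using cL by auto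
  have xC: "?C \<notin> range \<xi>" by (rule x) simp
  have am: "a mod N \<in> {0..<N}" using N_pos by simp
  note steps = gamma_strip_steps_Plus[OF CL n_pos am, of \<xi> _ v g z]
  have "(\<Sum>\<eta>\<in>Omega m E ?C. gamma_strip n v g z L ?C (Plus, a mod N) \<eta> \<xi> * \<phi> \<eta>)
      = (\<Sum>\<eta>\<in>Omega (m - 1) (E - ?C) (?C - 1). gamma_strip n v g z L ?C (Plus, a mod N) (wcons ?C \<eta>) \<xi> * \<phi> (wcons ?C \<eta>))
      + (\<Sum>\<eta>\<in>Omega m E (?C - 1). gamma_strip n v g z L ?C (Plus, a mod N) \<eta> \<xi> * \<phi> \<eta>)"
    by (rule sum_Omega_split[of _ "m - 1", unfolded diff_add_cancel])
  also have "(\<Sum>\<eta>\<in>Omega (m - 1) (E - ?C) (?C - 1). gamma_strip n v g z L ?C (Plus, a mod N) (wcons ?C \<eta>) \<xi> * \<phi> (wcons ?C \<eta>)) = 0"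
    by (rule sum.neutral, rule ballI) (subst steps(4)[OF xC], simp_all add: range_wcons)
  also have "(\<Sum>\<eta>\<in>Omega m E (?C - 1). gamma_strip n v g z L ?C (Plus, a mod N) \<eta> \<xi> * \<phi> \<eta>)
      = inverse z * (\<Sum>\<eta>\<in>Omega m E (?C - 1). gamma_strip n v g z L (?C - 1) (Plus, (a - 1) mod N) \<eta> \<xi> * \<phi> \<eta>)"
    unfolding sum_distrib_left
  proof (intro sum.cong refl)
    fix \<eta> assume "\<eta> \<in> Omega m E (?C - 1)"
    then have "?C \<notin> range \<eta>" by (rule not_in_range_Omega)
    then show "gamma_strip n v g z L ?C (Plus, a mod N) \<eta> \<xi> * \<phi> \<eta>
       = inverse z * (gamma_strip n v g z L (?C - 1) (Plus, (a - 1) mod N) \<eta> \<xi> * \<phi> \<eta>)"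
      by (subst steps(1)[OF xC]) (simp_all add: mod_diff_left_eq)
  qed
  also have "\<dots> = inverse z * (z powi (- int k) * (\<Sum>\<eta>\<in>Omega m E c. gamma_strip n v g z L c (Plus, (a - 1 - int k) mod N) \<eta> \<xi> * \<phi> \<eta>))"
    unfolding C1 Suc ..
  also have "\<dots> = z powi (- int (Suc k)) * (\<Sum>\<eta>\<in>Omega m E c. gamma_strip n v g z L c (Plus, (a - int (Suc k)) mod N) \<eta> \<xi> * \<phi> \<eta>)"
  proof -
    have "- int k = - int (Suc k) + 1" by simp
    then have "z powi (- int k) = z * z powi (- int (Suc k))" using powi_Suc[OF z] by metis
    then have "inverse z * z powi (- int k) = z powi (- int (Suc k))" using z by simp
    moreover have "a - 1 - int k = a - int (Suc k)" by simp
    ultimately show ?thesis by (simp only: mult.assoc[symmetric])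
  qed
  finally show ?case by simp
qed simp

text \<open>The columns above c have plus on top. Coming from the left, the edge keeps its default
  spin until some column b has a minus at the bottom, with weight 1 - v, or until c is reached.
  After b the edge is plus and collects 1/z in each of the b - 1 - c columns before c, where no
  further minus is admissible at the bottom.\<close>

lemma gamma_strip_above:
  assumes z: "z \<noteq> 0" and cL: "c \<ge> L" and x: "\<And>b. b > c \<Longrightarrow> b \<notin> range \<xi>"
  shows "(\<Sum>\<eta>\<in>Omega (m + 1) E (c + int k). gamma_strip n v g z L (c + int k) (Minus, 0) \<eta> \<xi> * \<phi> \<eta>)
    = (\<Sum>\<eta>\<in>Omega (m + 1) E c. gamma_strip n v g z L c (Minus, 0) \<eta> \<xi> * \<phi> \<eta>)
    + (1 - v) * (\<Sum>b\<in>{c + 1..c + int k}. z powi (c + 1 - b) *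
        (\<Sum>\<eta>\<in>Omega m (E - b) c. gamma_strip n v g z L c (Plus, (c + 1 - b) mod N) \<eta> \<xi> * \<phi> (wcons b \<eta>)))"
proof (induction k)
  case (Suc k)
  let ?C = "c + int (Suc k)"
  let ?H = "\<lambda>b. z powi (c + 1 - b) *
        (\<Sum>\<eta>\<in>Omega m (E - b) c. gamma_strip n v g z L c (Plus, (c + 1 - b) mod N) \<eta> \<xi> * \<phi> (wcons b \<eta>))"
  have CL: "?C > L" and C1: "?C - 1 = c + int k" using cL by auto
  have xC: "?C \<notin> range \<xi>" by (rule x) simp
  note steps = gamma_strip_steps[OF CL n_pos, of \<xi> _ v g z]
  have "(\<Sum>\<eta>\<in>Omega (m + 1) E ?C. gamma_strip n v g z L ?C (Minus, 0) \<eta> \<xi> * \<phi> \<eta>)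
      = (\<Sum>\<eta>\<in>Omega m (E - ?C) (?C - 1). gamma_strip n v g z L ?C (Minus, 0) (wcons ?C \<eta>) \<xi> * \<phi> (wcons ?C \<eta>))
      + (\<Sum>\<eta>\<in>Omega (m + 1) E (?C - 1). gamma_strip n v g z L ?C (Minus, 0) \<eta> \<xi> * \<phi> \<eta>)"
    by (rule sum_Omega_split)
  also have "(\<Sum>\<eta>\<in>Omega (m + 1) E (?C - 1). gamma_strip n v g z L ?C (Minus, 0) \<eta> \<xi> * \<phi> \<eta>)
      = (\<Sum>\<eta>\<in>Omega (m + 1) E (?C - 1). gamma_strip n v g z L (?C - 1) (Minus, 0) \<eta> \<xi> * \<phi> \<eta>)"
  proof (intro sum.cong refl)
    fix \<eta> assume "\<eta> \<in> Omega (m + 1) E (?C - 1)"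
    then have "?C \<notin> range \<eta>" by (rule not_in_range_Omega)
    then show "gamma_strip n v g z L ?C (Minus, 0) \<eta> \<xi> * \<phi> \<eta> = gamma_strip n v g z L (?C - 1) (Minus, 0) \<eta> \<xi> * \<phi> \<eta>"
      by (subst steps(1)[OF xC]) simp_all
  qed
  also have "(\<Sum>\<eta>\<in>Omega m (E - ?C) (?C - 1). gamma_strip n v g z L ?C (Minus, 0) (wcons ?C \<eta>) \<xi> * \<phi> (wcons ?C \<eta>))
      = (1 - v) * (\<Sum>\<eta>\<in>Omega m (E - ?C) (c + int k). gamma_strip n v g z L (c + int k) (Plus, 0 mod N) \<eta> \<xi> * \<phi> (wcons ?C \<eta>))"
    unfolding sum_distrib_left C1
  proof (intro sum.cong refl)
    fix \<eta>
    have "?C \<in> range (wcons ?C \<eta>)" by (simp add: range_wcons)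
    then show "gamma_strip n v g z L ?C (Minus, 0) (wcons ?C \<eta>) \<xi> * \<phi> (wcons ?C \<eta>)
      = (1 - v) * (gamma_strip n v g z L (c + int k) (Plus, 0 mod N) \<eta> \<xi> * \<phi> (wcons ?C \<eta>))"
      unfolding steps(3)[OF xC \<open>?C \<in> range (wcons ?C \<eta>)\<close>] C1 by (simp add: gamma_strip_wcons)
  qed
  also have "\<dots> = (1 - v) * ?H ?C"
    using gamma_strip_rise[OF z cL x, where m = m and E = "E - ?C" and k = k and a = 0 and \<phi> = "\<lambda>\<eta>. \<phi> (wcons ?C \<eta>)"] by simp
  also have "(\<Sum>\<eta>\<in>Omega (m + 1) E (?C - 1). gamma_strip n v g z L (?C - 1) (Minus, 0) \<eta> \<xi> * \<phi> \<eta>)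
      = (\<Sum>\<eta>\<in>Omega (m + 1) E c. gamma_strip n v g z L c (Minus, 0) \<eta> \<xi> * \<phi> \<eta>) + (1 - v) * (\<Sum>b\<in>{c + 1..c + int k}. ?H b)"
    unfolding C1 Suc ..
  also have "(1 - v) * ?H ?C + ((\<Sum>\<eta>\<in>Omega (m + 1) E c. gamma_strip n v g z L c (Minus, 0) \<eta> \<xi> * \<phi> \<eta>) + (1 - v) * (\<Sum>b\<in>{c + 1..c + int k}. ?H b))
      = (\<Sum>\<eta>\<in>Omega (m + 1) E c. gamma_strip n v g z L c (Minus, 0) \<eta> \<xi> * \<phi> \<eta>) + (1 - v) * (\<Sum>b\<in>{c + 1..?C}. ?H b)"
  proof -
    have "{c + 1..?C} = insert ?C {c + 1..c + int k}" by auto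
    then have "(\<Sum>b\<in>{c + 1..?C}. ?H b) = ?H ?C + (\<Sum>b\<in>{c + 1..c + int k}. ?H b)" by (simp only:) (subst sum.insert; simp)
    then show ?thesis by (simp only: distrib_left add_ac)
  qed
  finally show ?case .
qed simp

end

abbreviation triangular :: "int \<Rightarrow> int" where
  "triangular m \<equiv> m * (m + 1) div 2"

context fock_params begin

text \<open>Gamma ice as an operation on functionals, restricted to one degree. The factor
  z^\<gamma> normalizes it for the comparison with the part of e^(H_-) that raises the energy by
  \<gamma>.\<close>

definition ice_sum :: "complex \<Rightarrow> int \<Rightarrow> (wedge_seq \<Rightarrow> complex) \<Rightarrow> wedge_seq \<Rightarrow> int \<Rightarrow> complex" where
  "ice_sum z m \<phi> \<xi> \<gamma> = z powi \<gamma> *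
     (\<Sum>\<eta>\<in>{\<eta> \<in> normal_ordered m. energy m \<eta> = energy m \<xi> + \<gamma>}. T_Gamma n v g z \<eta> \<xi> * \<phi> \<eta>)"

lemma ice_sum_strip:
  assumes \<xi>: "\<xi> \<in> normal_ordered m" and E: "E = energy m \<xi> + \<gamma>"
    and C: "C \<ge> m + (E - triangular m)" "C \<ge> \<xi> 0" "L \<le> C"
    and L: "{..L} \<subseteq> range \<xi>" "L \<le> m - (E - triangular m)"
  shows "ice_sum z m \<phi> \<xi> \<gamma> = z powi \<gamma> * (\<Sum>\<eta>\<in>Omega m E C. gamma_strip n v g z L C (Minus, 0) \<eta> \<xi> * \<phi> \<eta>)"
proof -
  have "T_Gamma n v g z \<eta> \<xi> = gamma_strip n v g z L C (Minus, 0) \<eta> \<xi>" if "\<eta> \<in> Omega m E C" for \<eta>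
  proof -
    have \<eta>: "\<eta> \<in> normal_ordered m" "energy m \<eta> = E" "\<eta> 0 \<le> C" using that by (auto simp: Omega_def)
    have "{..L} \<subseteq> range \<eta>" by (rule normal_ordered_full[OF \<eta>(1)]) (use L(2) \<eta>(2) in simp)
    then show ?thesis by (rule T_Gamma_eq_strip[OF n_pos \<xi> \<eta>(1) C(2) \<eta>(3) L(1) _ C(3)])
  qed
  then show ?thesis unfolding ice_sum_def E[symmetric] Omega_large[OF C(1), symmetric]
    by (metis (no_types, lifting) sum.cong)
qed

lemma ice_sum_above:
  assumes z: "z \<noteq> 0" and \<xi>: "\<xi> \<in> normal_ordered (m + 1)" and E: "E = energy (m + 1) \<xi> + \<gamma>"
    and C: "C = c + int k" "C \<ge> m + 1 + (E - triangular (m + 1))" and c: "c \<ge> \<xi> 0" "c \<ge> L"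
    and L: "{..L} \<subseteq> range \<xi>" "L \<le> m + 1 - (E - triangular (m + 1))"
  shows "ice_sum z (m + 1) \<phi> \<xi> \<gamma> = z powi \<gamma> *
    ((\<Sum>\<eta>\<in>Omega (m + 1) E c. gamma_strip n v g z L c (Minus, 0) \<eta> \<xi> * \<phi> \<eta>)
    + (1 - v) * (\<Sum>b\<in>{c + 1..C}. z powi (c + 1 - b) *
        (\<Sum>\<eta>\<in>Omega m (E - b) c. gamma_strip n v g z L c (Plus, (c + 1 - b) mod N) \<eta> \<xi> * \<phi> (wcons b \<eta>))))"
proof -
  have x: "b \<notin> range \<xi>" if "b > c" for b
  proof
    assume "b \<in> range \<xi>"
    then obtain i where "b = \<xi> i" by blast
    then show False using normal_ordered_diff[OF \<xi>, of 0 i] c(1) that by simp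
  qed
  show ?thesis
    using ice_sum_strip[OF \<xi> E C(2) _ _ L] c C(1) gamma_strip_above[OF z c(2) x, where k = k]
    unfolding C(1) by simp
qed

lemma div_N_less: "x div N < y \<longleftrightarrow> x < y * N"
proof
  assume "x div N < y"
  then have "(x div N + 1) * N \<le> y * N" using N_pos by (intro mult_right_mono) auto
  moreover have "x = x div N * N + x mod N" "x mod N < N" using N_pos by simp_all
  moreover have "(x div N + 1) * N = x div N * N + N" by (simp only: distrib_right mult_1)
  ultimately show "x < y * N" by linarith
next
  assume x: "x < y * N"
  have "x = x div N * N + x mod N" "x mod N \<ge> 0" using N_pos by simp_all
  then have "x div N * N < y * N" using x by linarith
  then show "x div N < y" using N_pos by simp
qed

lemma div_N_le: "x \<ge> 0 \<Longrightarrow> x div N \<le> x"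
proof -
  assume "x \<ge> 0"
  then have "(x + 1) * 1 \<le> (x + 1) * N" using N_pos by (intro mult_left_mono) auto
  then show ?thesis using div_N_less[of x "x + 1"] by simp
qed

lemma sum_e_coeff:
  assumes C: "C = a + int M" and F: "\<And>b. b > C \<Longrightarrow> F b = 0"
  shows "(\<Sum>D\<le>M. e_coeff D * F (a + int D * N))
    = F a + (1 - v) * (\<Sum>b\<in>{a + 1..C}. if N dvd b - a then F b else 0)"
proof -
  have "e_coeff D * F (a + int D * N) = (1 - v) * F (a + int D * N) + (if D = 0 then v * F a else 0)" for D
    by (simp add: e_coeff_def algebra_simps)
  then have "(\<Sum>D\<le>M. e_coeff D * F (a + int D * N)) = (1 - v) * (\<Sum>D\<le>M. F (a + int D * N)) + v * F a"
    by (simp add: sum.distrib sum_distrib_left)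
  also have "(\<Sum>D\<le>M. F (a + int D * N)) = (\<Sum>D\<le>nat ((C - a) div N). F (a + int D * N))"
  proof (rule sum.mono_neutral_right)
    have "(C - a) div N \<le> int M"
      using div_N_le[of "C - a"] by (simp add: C)
    then show "{..nat ((C - a) div N)} \<subseteq> {..M}" by auto
    show "\<forall>D\<in>{..M} - {..nat ((C - a) div N)}. F (a + int D * N) = 0"
    proof
      fix D assume "D \<in> {..M} - {..nat ((C - a) div N)}"
      then have "(C - a) div N < int D" by auto
      then have "C - a < int D * N" by (simp add: div_N_less)
      then show "F (a + int D * N) = 0" by (intro F) simp
    qed
  qed simp
  also have "\<dots> = (\<Sum>b\<in>{a..C}. if N dvd b - a then F b else 0)"
    by (rule sum_progression[symmetric]) (simp add: C)
  also have "{a..C} = insert a {a + 1..C}" using C by auto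
  also have "(\<Sum>b\<in>insert a {a + 1..C}. if N dvd b - a then F b else 0)
      = F a + (\<Sum>b\<in>{a + 1..C}. if N dvd b - a then F b else 0)"
    by (subst sum.insert) auto
  finally show ?thesis by (simp add: algebra_simps)
qed

text \<open>Regrouping by the column b + D N leaves for D exactly the range of the wedge
  law.\<close>

lemma sum_shifted_columns:
  assumes C: "C = a + int M" and F: "\<And>D b. b > C \<Longrightarrow> F D b = (0::complex)"
  shows "(\<Sum>D\<le>M. \<Sum>b\<in>{a..C}. F D (b + int D * N)) = (\<Sum>b\<in>{a..C}. \<Sum>D\<le>nat ((b - a) div N). F D b)"
proof -
  have "(\<Sum>b\<in>{a..C}. F D (b + int D * N)) = (\<Sum>b\<in>{a..C}. if a + int D * N \<le> b then F D b else 0)" for D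
  proof -
    have sub: "{a + int D * N..C} \<subseteq> {a + int D * N..C + int D * N}" "{a + int D * N..C} \<subseteq> {a..C}"
      using N_pos by auto
    have "(\<Sum>b\<in>{a..C}. F D (b + int D * N)) = (\<Sum>b\<in>{a + int D * N..C + int D * N}. F D b)"
      by (rule sum.reindex_bij_witness[of _ "\<lambda>b. b - int D * N" "\<lambda>b. b + int D * N"]) auto
    also have "\<dots> = (\<Sum>b\<in>{a + int D * N..C}. F D b)"
      by (rule sum.mono_neutral_right[OF _ sub(1)]) (use F in auto)
    also have "\<dots> = (\<Sum>b\<in>{a + int D * N..C}. if a + int D * N \<le> b then F D b else 0)"
      by (intro sum.cong refl) simp
    also have "\<dots> = (\<Sum>b\<in>{a..C}. if a + int D * N \<le> b then F D b else 0)"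
      by (rule sum.mono_neutral_left[OF _ sub(2)]) auto
    finally show ?thesis .
  qed
  then have "(\<Sum>D\<le>M. \<Sum>b\<in>{a..C}. F D (b + int D * N))
      = (\<Sum>b\<in>{a..C}. \<Sum>D\<le>M. if a + int D * N \<le> b then F D b else 0)"
    by (simp add: sum.swap[of _ "{..M}"])
  also have "\<dots> = (\<Sum>b\<in>{a..C}. \<Sum>D\<le>nat ((b - a) div N). F D b)"
  proof (rule sum.cong[OF refl])
    fix b assume b: "b \<in> {a..C}"
    have le: "a + int D * N \<le> b \<longleftrightarrow> D \<le> nat ((b - a) div N)" for D
    proof -
      have "(b - a) div N < int D \<longleftrightarrow> b - a < int D * N" by (rule div_N_less)
      moreover have "(b - a) div N \<ge> 0" using b N_pos by (simp add: pos_imp_zdiv_nonneg_iff)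
      ultimately show ?thesis by linarith
    qed
    have "(b - a) div N \<le> b - a" using b by (intro div_N_le) simp
    then have "nat ((b - a) div N) \<le> M" using b C by auto
    then have "{..nat ((b - a) div N)} \<subseteq> {..M}" by auto
    then have "(\<Sum>D\<le>M. if a + int D * N \<le> b then F D b else 0)
        = (\<Sum>D\<le>nat ((b - a) div N). if a + int D * N \<le> b then F D b else 0)"
      by (intro sum.mono_neutral_right) (auto simp: le)
    also have "\<dots> = (\<Sum>D\<le>nat ((b - a) div N). F D b)"
      by (intro sum.cong refl) (simp add: le)
    finally show "(\<Sum>D\<le>M. if a + int D * N \<le> b then F D b else 0) = (\<Sum>D\<le>nat ((b - a) div N). F D b)" .
  qed
  finally show ?thesis .
qed

text \<open>The ice obeys the recursion of \<open>Gi_raising_wcons\<close>. On the left the columns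
  above a and then column a are summed out, on the right the columns from a on for the tail t. In
  \<open>X\<close> the bottom row has one entry b \<ge> a. In \<open>Y\<close> it has two, u_b
  \<and> u_a; the right side has pairs u_(a + D N) \<and> u_(b - D N) instead, collected in
  \<open>W\<close>, and the wedge law sums them to \<open>Y\<close>.\<close>

lemma ice_sum_wcons:
  assumes z: "z \<noteq> 0" and t: "t \<in> normal_ordered m" "t 0 < a" and \<phi>: "\<phi> \<in> ann (m + 1)"
  shows "\<exists>M0. \<forall>M\<ge>M0. ice_sum z (m + 1) \<phi> (wcons a t) \<gamma>
    = (\<Sum>D\<le>M. e_coeff D * ice_sum z m (\<lambda>s. \<phi> (wcons (a + int D * N) s)) t (\<gamma> - int D * N))"
proof -
  define E where "E = a + energy m t + \<gamma>"
  \<comment> \<open>The first two bounds ensure that no bottom row of the energy in question exceeds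
    C on the left and on the right; the other two make \<open>X\<close> and \<open>W\<close> vanish
    beyond C, where no energy is left for the remaining factors.\<close>
  define B where "B = max (max (m + 1 + (E - triangular (m + 1))) (m + (E - a - triangular m)))
    (max (E - triangular m) (E - a - triangular (m - 1)))"
  define L where "L = min (a - 1) (min (m - (energy m t - triangular m))
    (min (m + 1 - (E - triangular (m + 1))) (m - (E - a - triangular m))))"
  have \<xi>: "wcons a t \<in> normal_ordered (m + 1)" using t by (simp add: normal_ordered_wcons)
  have ts: "t \<in> semi_infinite m" using t(1) by (simp add: normal_ordered_def)
  have ew: "energy (m + 1) (wcons a t) = a + energy m t" by (rule energy_wcons[OF ts])
  have full: "{..L} \<subseteq> range t" by (rule normal_ordered_full[OF t(1)]) (unfold L_def, linarith)
  have ran: "a \<notin> range t"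
  proof
    assume "a \<in> range t"
    then obtain i where "a = t i" by blast
    then show False using normal_ordered_diff[OF t(1), of 0 i] t(2) by simp
  qed
  have main: "ice_sum z (m + 1) \<phi> (wcons a t) \<gamma>
    = (\<Sum>D\<le>M. e_coeff D * ice_sum z m (\<lambda>s. \<phi> (wcons (a + int D * N) s)) t (\<gamma> - int D * N))"
    if M: "M \<ge> nat (B - a)" for M
  proof -
    define C where "C = a + int M"
    have CB: "B \<le> C" using M by (simp add: C_def)
    define X where "X b = (\<Sum>\<eta>\<in>Omega m (E - b) (a - 1). gamma_strip n v g z L (a - 1) (Minus, 0) \<eta> t * \<phi> (wcons b \<eta>))" for b
    define W where "W D b = (\<Sum>\<eta>\<in>Omega (m - 1) (E - a - b) (a - 1).
      gamma_strip n v g z L (a - 1) (Plus, (a - b) mod N) \<eta> t * \<phi> (wcons (a + int D * N) (wcons (b - int D * N) \<eta>)))" for D b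
    define Y where "Y b = (\<Sum>\<eta>\<in>Omega (m - 1) (E - a - b) (a - 1).
      gamma_strip n v g z L (a - 1) (Plus, (a - b) mod N) \<eta> t * \<phi> (wcons b (wcons a \<eta>)))" for b
    have X0: "X b = 0" if "b > C" for b
    proof -
      have "Omega m (E - b) (a - 1) = {}" using that CB by (intro Omega_low) (simp add: B_def)
      then show ?thesis by (simp add: X_def)
    qed
    have W0: "W D b = 0" if "b > C" for D b
    proof -
      have "Omega (m - 1) (E - a - b) (a - 1) = {}" using that CB by (intro Omega_low) (simp add: B_def)
      then show ?thesis by (simp add: W_def)
    qed
    have WY: "(\<Sum>D\<le>nat ((b - a) div N). e_coeff D * W D b) = g (a - b) * Y b" if "b \<ge> a" for b
    proof -
      have "(\<Sum>D\<le>nat ((b - a) div N). e_coeff D * W D b)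
        = (\<Sum>\<eta>\<in>Omega (m - 1) (E - a - b) (a - 1). gamma_strip n v g z L (a - 1) (Plus, (a - b) mod N) \<eta> t
           * (\<Sum>D\<le>nat ((b - a) div N). e_coeff D * \<phi> (wcons (a + int D * N) (wcons (b - int D * N) \<eta>))))"
        unfolding W_def sum_distrib_left by (subst sum.swap) (simp only: mult.left_commute)
      also have "\<dots> = (\<Sum>\<eta>\<in>Omega (m - 1) (E - a - b) (a - 1). g (a - b) * (gamma_strip n v g z L (a - 1) (Plus, (a - b) mod N) \<eta> t
           * \<phi> (wcons b (wcons a \<eta>))))"
      proof (intro sum.cong refl)
        fix \<eta> assume "\<eta> \<in> Omega (m - 1) (E - a - b) (a - 1)"
        then have "\<eta> \<in> semi_infinite (m - 1)" by (simp add: Omega_def normal_ordered_def)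
        then have "exchange_law (\<lambda>x y. \<phi> (wcons x (wcons y \<eta>)))"
          by (intro ann_pair_law[of _ "m - 1"]) (simp_all add: \<phi>)
        from wedge_law[OF this that]
        show "gamma_strip n v g z L (a - 1) (Plus, (a - b) mod N) \<eta> t
           * (\<Sum>D\<le>nat ((b - a) div N). e_coeff D * \<phi> (wcons (a + int D * N) (wcons (b - int D * N) \<eta>)))
           = g (a - b) * (gamma_strip n v g z L (a - 1) (Plus, (a - b) mod N) \<eta> t * \<phi> (wcons b (wcons a \<eta>)))"
          by (simp only: mult.left_commute)
      qed
      finally show ?thesis unfolding Y_def sum_distrib_left .
    qed
    \<comment> \<open>By u_a \<and> u_a = 0 this removes the column b = a, which occurs on the right
      side only.\<close>
    have Ya: "Y a = 0"
    proof -
      have "\<phi> (wcons a (wcons a \<eta>)) = 0" if "\<eta> \<in> Omega (m - 1) (E - a - a) (a - 1)" for \<eta>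
      proof -
        have "\<eta> \<in> semi_infinite (m - 1)" using that by (simp add: Omega_def normal_ordered_def)
        then have "exchange_law (\<lambda>x y. \<phi> (wcons x (wcons y \<eta>)))"
          by (intro ann_pair_law[of _ "m - 1"]) (simp_all add: \<phi>)
        then show ?thesis by (rule exchange_law_self)
      qed
      then show ?thesis unfolding Y_def by (intro sum.neutral) simp
    qed
    have left: "ice_sum z (m + 1) \<phi> (wcons a t) \<gamma>
      = z powi \<gamma> * (X a + (1 - v) * (\<Sum>b\<in>{a + 1..C}. z powi (a - b) * (g (a - b) * Y b + (if N dvd b - a then X b else 0))))"
    proof -
      have La: "a > L" by (simp add: L_def)
      note steps = gamma_strip_steps[OF La n_pos, of "wcons a t" _ v g z]
      have aw: "a \<in> range (wcons a s)" for s by (simp add: range_wcons)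
      have "(\<Sum>\<eta>\<in>Omega (m + 1) E a. gamma_strip n v g z L a (Minus, 0) \<eta> (wcons a t) * \<phi> \<eta>)
          = (\<Sum>\<eta>\<in>Omega m (E - a) (a - 1). gamma_strip n v g z L a (Minus, 0) (wcons a \<eta>) (wcons a t) * \<phi> (wcons a \<eta>))
          + (\<Sum>\<eta>\<in>Omega (m + 1) E (a - 1). gamma_strip n v g z L a (Minus, 0) \<eta> (wcons a t) * \<phi> \<eta>)"
        by (rule sum_Omega_split)
      also have "(\<Sum>\<eta>\<in>Omega (m + 1) E (a - 1). gamma_strip n v g z L a (Minus, 0) \<eta> (wcons a t) * \<phi> \<eta>) = 0"
        by (rule sum.neutral, rule ballI) (subst steps(4)[OF aw not_in_range_Omega], assumption, simp)
      also have "(\<Sum>\<eta>\<in>Omega m (E - a) (a - 1). gamma_strip n v g z L a (Minus, 0) (wcons a \<eta>) (wcons a t) * \<phi> (wcons a \<eta>)) = X a"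
        unfolding X_def steps(2)[OF aw aw] by (simp add: gamma_strip_wcons)
      finally have top: "(\<Sum>\<eta>\<in>Omega (m + 1) E a. gamma_strip n v g z L a (Minus, 0) \<eta> (wcons a t) * \<phi> \<eta>) = X a"
        by simp
      have col: "z powi (a + 1 - b) *
        (\<Sum>\<eta>\<in>Omega m (E - b) a. gamma_strip n v g z L a (Plus, (a + 1 - b) mod N) \<eta> (wcons a t) * \<phi> (wcons b \<eta>))
        = z powi (a - b) * (g (a - b) * Y b + (if N dvd b - a then X b else 0))" for b
      proof -
        have bm: "(a + 1 - b) mod N \<in> {0..<N}" using N_pos by simp
        have md: "((a + 1 - b) mod N - 1) mod N = (a - b) mod N" by (simp add: mod_diff_left_eq)
        have gm: "g ((a - b) mod N) = g (a - b)" by (rule g_mod) simp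
        have dv: "(a + 1 - b) mod N = 1 mod N \<longleftrightarrow> N dvd b - a"
          unfolding mod_eq_dvd_iff by (simp add: dvd_diff_commute)
        note stepsP = gamma_strip_steps_Plus[OF La n_pos bm, of "wcons a t" _ v g z, unfolded md gm dv]
        have "(\<Sum>\<eta>\<in>Omega m (E - b) a. gamma_strip n v g z L a (Plus, (a + 1 - b) mod N) \<eta> (wcons a t) * \<phi> (wcons b \<eta>))
          = (\<Sum>\<eta>\<in>Omega (m - 1) (E - b - a) (a - 1). gamma_strip n v g z L a (Plus, (a + 1 - b) mod N) (wcons a \<eta>) (wcons a t) * \<phi> (wcons b (wcons a \<eta>)))
          + (\<Sum>\<eta>\<in>Omega m (E - b) (a - 1). gamma_strip n v g z L a (Plus, (a + 1 - b) mod N) \<eta> (wcons a t) * \<phi> (wcons b \<eta>))"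
          by (rule sum_Omega_split[of _ "m - 1", unfolded diff_add_cancel])
        also have "(\<Sum>\<eta>\<in>Omega (m - 1) (E - b - a) (a - 1). gamma_strip n v g z L a (Plus, (a + 1 - b) mod N) (wcons a \<eta>) (wcons a t) * \<phi> (wcons b (wcons a \<eta>)))
          = inverse z * (g (a - b) * Y b)"
        proof -
          have e: "E - b - a = E - a - b" by simp
          show ?thesis unfolding Y_def stepsP(2)[OF aw aw] sum_distrib_left e
            by (simp add: gamma_strip_wcons mult.assoc)
        qed
        also have "(\<Sum>\<eta>\<in>Omega m (E - b) (a - 1). gamma_strip n v g z L a (Plus, (a + 1 - b) mod N) \<eta> (wcons a t) * \<phi> (wcons b \<eta>))
          = inverse z * (if N dvd b - a then X b else 0)"
        proof -
          have "gamma_strip n v g z L a (Plus, (a + 1 - b) mod N) \<eta> (wcons a t)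
            = (if N dvd b - a then inverse z * gamma_strip n v g z L (a - 1) (Minus, 0) \<eta> t else 0)"
            if "\<eta> \<in> Omega m (E - b) (a - 1)" for \<eta>
            unfolding stepsP(3)[OF aw not_in_range_Omega[OF that]] by (simp add: gamma_strip_wcons)
          then show ?thesis unfolding X_def by (simp add: sum_distrib_left mult.assoc)
        qed
        finally have S: "(\<Sum>\<eta>\<in>Omega m (E - b) a. gamma_strip n v g z L a (Plus, (a + 1 - b) mod N) \<eta> (wcons a t) * \<phi> (wcons b \<eta>))
          = inverse z * (g (a - b) * Y b + (if N dvd b - a then X b else 0))" by (simp only: distrib_left)
        have "z powi (a + 1 - b) = z * z powi (a - b)"
          using powi_Suc[OF z, of "a - b"] by (simp add: algebra_simps)
        then show ?thesis unfolding S using z by simp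
      qed
      have Ew: "E = energy (m + 1) (wcons a t) + \<gamma>" by (simp only: ew E_def)
      have CC: "m + 1 + (E - triangular (m + 1)) \<le> C" using CB unfolding B_def by linarith
      have LL: "L \<le> m + 1 - (E - triangular (m + 1))" unfolding L_def by linarith
      have full': "{..L} \<subseteq> range (wcons a t)" using full unfolding range_wcons by blast
      show ?thesis
        by (subst ice_sum_above[OF z \<xi> Ew C_def CC _ _ full' LL]) (simp_all only: top col wcons_simps order_refl La less_imp_le)
    qed
    have right: "ice_sum z m (\<lambda>s. \<phi> (wcons (a + int D * N) s)) t (\<gamma> - int D * N)
      = z powi \<gamma> * (z powi (a - (a + int D * N)) * X (a + int D * N)
        + (1 - v) * (\<Sum>b\<in>{a..C}. z powi (a - (b + int D * N)) * W D (b + int D * N)))" for D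
    proof -
      have t': "t \<in> normal_ordered (m - 1 + 1)" using t(1) by simp
      \<comment> \<open>For the tail t column a is already one of the columns above the top, so the
        strip starts from a - 1 and has one column more.\<close>
      have Ct: "C = (a - 1) + int (Suc M)" by (simp add: C_def)
      have DN: "int D * N \<ge> 0" using N_pos by simp
      let ?E = "E - (a + int D * N)"
      have Et: "?E = energy (m - 1 + 1) t + (\<gamma> - int D * N)" by (simp add: E_def)
      have CC: "m - 1 + 1 + (?E - triangular (m - 1 + 1)) \<le> C"
        using CB DN unfolding B_def diff_add_cancel by linarith
      have "L \<le> m - (E - a - triangular m)" unfolding L_def by linarith
      then have LL: "L \<le> m - 1 + 1 - (?E - triangular (m - 1 + 1))"
        using DN unfolding diff_add_cancel by linarith
      have La: "L \<le> a - 1" unfolding L_def by linarith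
      have t0: "t 0 \<le> a - 1" using t(2) by simp
      have pz: "z powi (\<gamma> - int D * N) = z powi \<gamma> * z powi (- (int D * N))"
        using z by (simp add: power_int_add[symmetric])
      have pb: "z powi (a - b) * z powi (- (int D * N)) = z powi (a - (b + int D * N))" for b
        using z by (simp add: power_int_add[symmetric] algebra_simps)
      have Wb: "(\<Sum>\<eta>\<in>Omega (m - 1) (?E - b) (a - 1). gamma_strip n v g z L (a - 1) (Plus, (a - b) mod N) \<eta> t * \<phi> (wcons (a + int D * N) (wcons b \<eta>)))
        = W D (b + int D * N)" for b
      proof -
        have e: "?E - b = E - a - (b + int D * N)" and w: "b + int D * N - int D * N = b" by simp_all
        have md: "(a - b) mod N = (a - (b + int D * N)) mod N" by (simp add: mod_eq_dvd_iff)
        show ?thesis unfolding W_def e w md ..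
      qed
      have "ice_sum z m (\<lambda>s. \<phi> (wcons (a + int D * N) s)) t (\<gamma> - int D * N)
        = z powi (\<gamma> - int D * N) * (X (a + int D * N)
          + (1 - v) * (\<Sum>b\<in>{a..C}. z powi (a - b) * W D (b + int D * N)))"
        using ice_sum_above[OF z t' Et Ct CC t0 La full LL, of "\<lambda>s. \<phi> (wcons (a + int D * N) s)"]
        unfolding diff_add_cancel Wb X_def .
      also have "\<dots> = z powi \<gamma> * (z powi (- (int D * N)) * X (a + int D * N)
          + (1 - v) * (\<Sum>b\<in>{a..C}. z powi (a - b) * z powi (- (int D * N)) * W D (b + int D * N)))"
        unfolding pz by (simp add: sum_distrib_left distrib_left mult_ac)
      finally show ?thesis unfolding pb by simp
    qed
    define F where "F D b = e_coeff D * (z powi (a - b) * W D b)" for D b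
    have F0: "F D b = 0" if "b > C" for D b using W0[OF that] by (simp add: F_def)
    have "(\<Sum>D\<le>M. e_coeff D * ice_sum z m (\<lambda>s. \<phi> (wcons (a + int D * N) s)) t (\<gamma> - int D * N))
      = (\<Sum>D\<le>M. z powi \<gamma> * (e_coeff D * (z powi (a - (a + int D * N)) * X (a + int D * N))
          + (1 - v) * (\<Sum>b\<in>{a..C}. F D (b + int D * N))))"
      unfolding right F_def by (simp add: sum_distrib_left distrib_left mult_ac)
    also have "\<dots> = z powi \<gamma> * ((\<Sum>D\<le>M. e_coeff D * (z powi (a - (a + int D * N)) * X (a + int D * N)))
          + (1 - v) * (\<Sum>D\<le>M. \<Sum>b\<in>{a..C}. F D (b + int D * N)))"
      by (simp only: sum.distrib sum_distrib_left[symmetric])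
    also have "(\<Sum>D\<le>M. e_coeff D * (z powi (a - (a + int D * N)) * X (a + int D * N)))
      = X a + (1 - v) * (\<Sum>b\<in>{a + 1..C}. if N dvd b - a then z powi (a - b) * X b else 0)"
      using sum_e_coeff[OF C_def, of "\<lambda>b. z powi (a - b) * X b"] X0 by simp
    also have "(\<Sum>D\<le>M. \<Sum>b\<in>{a..C}. F D (b + int D * N)) = (\<Sum>b\<in>{a..C}. \<Sum>D\<le>nat ((b - a) div N). F D b)"
      by (rule sum_shifted_columns[OF C_def F0])
    also have "\<dots> = (\<Sum>b\<in>{a..C}. z powi (a - b) * (g (a - b) * Y b))"
    proof (intro sum.cong refl)
      fix b assume "b \<in> {a..C}"
      then have "b \<ge> a" by simp
      show "(\<Sum>D\<le>nat ((b - a) div N). F D b) = z powi (a - b) * (g (a - b) * Y b)"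
        unfolding WY[OF \<open>b \<ge> a\<close>, symmetric] F_def sum_distrib_left by (simp only: mult.left_commute)
    qed
    also have "\<dots> = (\<Sum>b\<in>{a + 1..C}. z powi (a - b) * (g (a - b) * Y b))"
    proof (rule sum.mono_neutral_right)
      show "\<forall>b\<in>{a..C} - {a + 1..C}. z powi (a - b) * (g (a - b) * Y b) = 0"
      proof
        fix b assume "b \<in> {a..C} - {a + 1..C}"
        then have "b = a" by auto
        then show "z powi (a - b) * (g (a - b) * Y b) = 0" using Ya by simp
      qed
    qed auto
    finally show ?thesis unfolding left
      by (simp only: distrib_left sum.distrib if_distrib[of "(*) _"] mult_zero_right add_ac)
  qed
  then show ?thesis by blast
qed

lemma ice_sum_low: "energy m \<xi> + \<gamma> < triangular m \<Longrightarrow> ice_sum z m \<phi> \<xi> \<gamma> = 0"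
proof -
  assume "energy m \<xi> + \<gamma> < triangular m"
  then have "{\<eta> \<in> normal_ordered m. energy m \<eta> = energy m \<xi> + \<gamma>} = {}"
    using normal_ordered_energy(1) by fastforce
  then show ?thesis unfolding ice_sum_def by (simp only: sum.empty mult_zero_right)
qed

lemma Gi_low: "\<xi> \<in> normal_ordered m \<Longrightarrow> energy m \<xi> + \<gamma> < triangular m \<Longrightarrow> Gi \<epsilon> \<gamma> \<phi> \<xi> = 0"
  using normal_ordered_energy(1)[of \<xi> m] by (intro Gi_neg) linarith

section \<open>The defect between e^(H_-) and Gamma ice\<close>

definition defect :: "complex \<Rightarrow> int \<Rightarrow> (wedge_seq \<Rightarrow> complex) \<Rightarrow> wedge_seq \<Rightarrow> int \<Rightarrow> complex" where
  "defect z m \<phi> \<xi> \<gamma> = Gi (-1) \<gamma> \<phi> \<xi> - ice_sum z m \<phi> \<xi> \<gamma>"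

lemma defect_low: "\<xi> \<in> normal_ordered m \<Longrightarrow> energy m \<xi> + \<gamma> < triangular m \<Longrightarrow> defect z m \<phi> \<xi> \<gamma> = 0"
  by (simp only: defect_def ice_sum_low Gi_low diff_self)

text \<open>Both sides satisfy the same linear recursion, so the defect does as well; of its terms
  only D = 0, with e_0 = 1, survives.\<close>

lemma defect_wcons:
  assumes z: "z \<noteq> 0" and t: "t \<in> normal_ordered m" "t 0 < a" and \<phi>: "\<phi> \<in> ann (m + 1)"
    and small: "\<And>D. D > 0 \<Longrightarrow> defect z m (\<lambda>s. \<phi> (wcons (a + int D * N) s)) t (\<gamma> - int D * N) = 0"
  shows "defect z (m + 1) \<phi> (wcons a t) \<gamma> = defect z m (\<lambda>s. \<phi> (wcons a s)) t \<gamma>"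
proof -
  obtain M0 where M0: "\<And>M. M \<ge> M0 \<Longrightarrow> ice_sum z (m + 1) \<phi> (wcons a t) \<gamma>
    = (\<Sum>D\<le>M. e_coeff D * ice_sum z m (\<lambda>s. \<phi> (wcons (a + int D * N) s)) t (\<gamma> - int D * N))"
    using ice_sum_wcons[OF z t \<phi>, of \<gamma>] by blast
  define M where "M = max M0 (nat \<gamma>)"
  have ts: "t \<in> semi_infinite m" using t(1) by (simp add: normal_ordered_def)
  have M: "M0 \<le> M" "\<gamma> \<le> int M" by (auto simp: M_def)
  have "defect z (m + 1) \<phi> (wcons a t) \<gamma>
      = (\<Sum>D\<le>M. e_coeff D * defect z m (\<lambda>s. \<phi> (wcons (a + int D * N) s)) t (\<gamma> - int D * N))"
    unfolding defect_def Gi_raising_wcons[OF \<phi> ts M(2)] M0[OF M(1)] right_diff_distrib sum_subtractf ..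
  also have "\<dots> = (\<Sum>D\<in>{0}. e_coeff D * defect z m (\<lambda>s. \<phi> (wcons (a + int D * N) s)) t (\<gamma> - int D * N))"
    by (rule sum.mono_neutral_right) (auto simp: small)
  finally show ?thesis by (simp add: e_coeff_def)
qed

lemma vac_normal_ordered: "vac m \<in> normal_ordered m"
  by (simp add: normal_ordered_def) (simp add: vac_def)

text \<open>At the vacuum the term D = 0 has the same excess at the level below, so induction on the
  energy stalls. After x removals \<phi> is evaluated on u_m \<and> ... \<and> u_(m-x+1) \<and> s.
  For x > 0 a normal-ordered s of excess x has its first entry among these x indices, so the wedge
  vanishes and with it both terms of the defect.\<close>

lemma defect_vac:
  assumes z: "z \<noteq> 0" and \<phi>: "\<phi> \<in> ann m"
    and small: "\<And>\<psi> m \<gamma>. \<psi> \<in> ann m \<Longrightarrow> \<gamma> < int x \<Longrightarrow> defect z m \<psi> (vac m) \<gamma> = 0"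
  shows "defect z m \<phi> (vac m) (int x) = 0"
proof -
  have run_ann: "(\<lambda>s. \<phi> (run m k s)) \<in> ann (m - int k)" for k
    unfolding run_def by (rule ann_pre[OF \<phi>])
  have "defect z m \<phi> (vac m) (int x) = defect z (m - int k) (\<lambda>s. \<phi> (run m k s)) (vac (m - int k)) (int x)" for k
  proof (induction k)
    case (Suc k)
    let ?m = "m - int (Suc k)"
    have m: "m - int k = ?m + 1" by simp
    have \<psi>: "(\<lambda>s. \<phi> (run m k s)) \<in> ann (?m + 1)" using run_ann[of k] by (simp only: m)
    have v: "vac (?m + 1) = wcons (?m + 1) (vac ?m)" using vac_wcons[of "?m + 1"] unfolding add_diff_cancel_right' .
    have "defect z (?m + 1) (\<lambda>s. \<phi> (run m k s)) (wcons (?m + 1) (vac ?m)) (int x)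
        = defect z ?m (\<lambda>s. \<phi> (run m k (wcons (?m + 1) s))) (vac ?m) (int x)"
    proof (rule defect_wcons[OF z vac_normal_ordered _ \<psi>])
      show "vac ?m 0 < ?m + 1" by (simp add: vac_def)
      fix D :: nat assume "D > 0"
      then have "int D * N > 0" using N_pos by simp
      then have lt: "int x - int D * N < int x" by linarith
      show "defect z ?m (\<lambda>s. \<phi> (run m k (wcons (?m + 1 + int D * N) s))) (vac ?m) (int x - int D * N) = 0"
        by (rule small[OF ann_wcons[OF \<psi>] lt])
    qed
    then have "defect z (m - int k) (\<lambda>s. \<phi> (run m k s)) (vac (m - int k)) (int x)
        = defect z ?m (\<lambda>s. \<phi> (run m (Suc k) s)) (vac ?m) (int x)"
      unfolding run_Suc m[symmetric] v[symmetric, folded m] .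
    then show ?case using Suc by simp
  qed simp
  from this[of x] have "defect z m \<phi> (vac m) (int x)
      = defect z (m - int x) (\<lambda>s. \<phi> (run m x s)) (vac (m - int x)) (int x)" .
  also have "\<dots> = 0"
  proof (cases "x = 0")
    case True
    have "{\<eta> \<in> normal_ordered m. energy m \<eta> = triangular m} = {vac m}"
      using Omega_large[of m "triangular m" m] Omega_vac[of m "triangular m"] by simp
    moreover have "T_Gamma n v g z (vac m) (vac m) = 1"
    proof -
      have "{..m} \<subseteq> range (vac m)"
        by (rule normal_ordered_full[OF vac_normal_ordered]) (simp add: energy_vac)
      \<comment> \<open>With L = C = m the strip has no columns, and its partition function is
        1.\<close>
      then show ?thesis
        using T_Gamma_eq_strip[OF n_pos vac_normal_ordered vac_normal_ordered, of m m m v g z]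
        by (simp add: vac_def gamma_strip_def)
    qed
    ultimately have "ice_sum z m \<phi> (vac m) 0 = \<phi> (vac m)"
      unfolding ice_sum_def by (simp add: energy_vac)
    moreover have "Gi (-1) 0 \<phi> (vac m) = \<phi> (vac m)" using Gi_mult[of "-1" 0] by simp
    ultimately show ?thesis using True by (simp add: defect_def)
  next
    case False
    let ?m = "m - int x" and ?\<psi> = "\<lambda>s. \<phi> (run m x s)"
    have kill: "?\<psi> \<eta> = 0" if \<eta>: "\<eta> \<in> normal_ordered ?m" "energy ?m \<eta> = triangular ?m + int x" for \<eta>
    proof -
      have "\<eta> 0 \<le> m" using normal_ordered_top[OF \<eta>(1)] \<eta>(2) by simp
      moreover have "\<not> \<eta> 0 \<le> ?m"
      proof
        assume "\<eta> 0 \<le> ?m"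
        then have "\<eta> \<in> Omega ?m (energy ?m \<eta>) ?m" using \<eta>(1) by (simp add: Omega_def)
        then have "energy ?m \<eta> = triangular ?m" unfolding Omega_vac by (simp only: empty_iff split: if_splits)
        then show False using \<eta>(2) False by simp
      qed
      moreover obtain b s where s: "\<eta> = wcons b s" "s \<in> normal_ordered (?m - 1)"
        using normal_ordered_cases[of \<eta> "?m - 1"] \<eta>(1) unfolding diff_add_cancel by blast
      moreover have "\<phi> \<in> ann (?m - 1 + int x + 1)" using \<phi> by simp
      moreover have "s \<in> semi_infinite (?m - 1)" using s(2) by (simp add: normal_ordered_def)
      ultimately show ?thesis
        using run_wedge_zero[of \<phi> "?m - 1" x s m b] by simp
    qed
    have "ice_sum z ?m ?\<psi> (vac ?m) (int x) = 0"
      unfolding ice_sum_def by (simp add: energy_vac kill)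
    moreover have "Gi (-1) (int x) ?\<psi> (vac ?m) = 0"
    proof (cases "N dvd int x")
      case True
      then have "n dvd x" by simp
      then obtain d where d: "x = n * d" by (rule dvdE)
      have xd: "int x = int d * N" by (simp add: d)
      have all: "?\<psi> s = 0" if s: "s \<in> semi_infinite ?m" "energy ?m s = triangular ?m + int x" for s
        by (rule energy_vanish[OF run_ann s(1)], rule kill) (simp_all only: s(2))
      have "energy ?m (vac ?m) = (triangular ?m + int x) + N * (-1) * int d" by (simp add: energy_vac d)
      from G_energy[OF all vac_semi_infinite this]
      have "G (-1) d ?\<psi> (vac ?m) = 0" .
      then show ?thesis using Gi_mult[of "-1" d ?\<psi> "vac ?m"] by (simp only: xd)
    qed (rule Gi_not_dvd)
    ultimately show ?thesis by (simp add: defect_def)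
  qed
  finally show ?thesis .
qed

text \<open>x is the energy of the target above the vacuum. Splitting off the first factor a and
  raising it by D N lowers x by a - m + D N, which is positive except for the vacuum with D =
  0.\<close>

lemma defect_eq_0:
  assumes z: "z \<noteq> 0"
  shows "\<phi> \<in> ann m \<Longrightarrow> \<xi> \<in> normal_ordered m \<Longrightarrow> energy m \<xi> + \<gamma> = triangular m + int x \<Longrightarrow> defect z m \<phi> \<xi> \<gamma> = 0"
proof (induction x arbitrary: m \<phi> \<xi> \<gamma> rule: less_induct)
  case (less x)
  have small: "defect z k \<psi> s \<delta> = 0"
    if "\<psi> \<in> ann k" "s \<in> normal_ordered k" "energy k s + \<delta> < triangular k + int x" for k \<psi> s \<delta>
  proof (cases "energy k s + \<delta> < triangular k")
    case True
    then show ?thesis by (rule defect_low[OF that(2)])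
  next
    case False
    then show ?thesis using that(3)
      by (intro less.IH[OF _ that(1,2), of "nat (energy k s + \<delta> - triangular k)"]) linarith+
  qed
  obtain a t where at: "\<xi> = wcons a t" "t \<in> normal_ordered (m - 1)" "t 0 < a"
    using normal_ordered_cases[of \<xi> "m - 1"] less.prems(2) unfolding diff_add_cancel by blast
  have ts: "t \<in> semi_infinite (m - 1)" using at(2) by (simp add: normal_ordered_def)
  have \<phi>: "\<phi> \<in> ann (m - 1 + 1)" using less.prems(1) by simp
  have e: "energy m \<xi> = a + energy (m - 1) t" using energy_wcons[OF ts, of a] by (simp add: at(1))
  have tri: "triangular m = triangular (m - 1) + m" using triangular_Suc[of "m - 1"] by simp
  have am: "a \<ge> m" using normal_ordered_ge[OF less.prems(2), of 0] by (simp add: at(1))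
  show ?case
  proof (cases "a = m")
    case True
    have "t 0 \<le> m - 1" using at(3) True by simp
    then have "t \<in> Omega (m - 1) (energy (m - 1) t) (m - 1)" using at(2) by (simp add: Omega_def)
    then have "t = vac (m - 1)" unfolding Omega_vac by (simp only: empty_iff singleton_iff split: if_splits)
    then have v: "\<xi> = vac m" using vac_wcons[of m] at(1) True by simp
    have "\<gamma> = int x" using less.prems(3) by (simp add: v energy_vac)
    then show ?thesis unfolding v
    proof (elim ssubst, intro defect_vac[OF z less.prems(1)])
      fix \<psi> k \<delta> assume "\<psi> \<in> ann k" "\<delta> < int x"
      then show "defect z k \<psi> (vac k) \<delta> = 0"
        by (intro small vac_normal_ordered) (simp_all add: energy_vac)
    qed
  next
    case False
    have s: "defect z (m - 1) (\<lambda>s. \<phi> (wcons (a + int D * N) s)) t (\<gamma> - int D * N) = 0" for D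
    proof (rule small[OF ann_wcons[OF \<phi>] at(2)])
      have "int D * N \<ge> 0" using N_pos by simp
      then show "energy (m - 1) t + (\<gamma> - int D * N) < triangular (m - 1) + int x"
        using less.prems(3) am False unfolding e tri by linarith
    qed
    have "defect z m \<phi> \<xi> \<gamma> = defect z (m - 1) (\<lambda>s. \<phi> (wcons a s)) t \<gamma>"
      using defect_wcons[OF z at(2,3) \<phi> s] unfolding diff_add_cancel at(1)[symmetric] .
    then show ?thesis using s[of 0] by simp
  qed
qed

theorem exp_H_minus_eq:
  assumes z: "z \<noteq> 0" and \<xi>: "\<xi> \<in> normal_ordered m" and \<eta>: "\<eta> \<in> normal_ordered m"
  shows "exp_H_minus n v g m z \<eta> \<xi> = T_Gamma n v g z \<eta> \<xi>"
proof -
  let ?\<gamma> = "energy m \<eta> - energy m \<xi>" and ?\<kappa> = "coordinate m \<eta>"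
  let ?C = "m + (energy m \<eta> - triangular m)"
  have "energy m \<xi> + ?\<gamma> = triangular m + int (nat (energy m \<eta> - triangular m))"
    using normal_ordered_energy(1)[OF \<eta>] by simp
  from defect_eq_0[OF z coordinate_ann \<xi> this]
  have "Gi (-1) ?\<gamma> ?\<kappa> \<xi> = ice_sum z m ?\<kappa> \<xi> ?\<gamma>" by (simp add: defect_def)
  also have "\<dots> = z powi ?\<gamma> * (\<Sum>\<zeta>\<in>Omega m (energy m \<eta>) ?C. T_Gamma n v g z \<zeta> \<xi> * ?\<kappa> \<zeta>)"
    unfolding ice_sum_def Omega_large[OF order_refl] by simp
  also have "(\<Sum>\<zeta>\<in>Omega m (energy m \<eta>) ?C. T_Gamma n v g z \<zeta> \<xi> * ?\<kappa> \<zeta>) = T_Gamma n v g z \<eta> \<xi>"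
    by (rule sum_coordinate) (simp add: Omega_large[OF order_refl] \<eta>)
  finally have "Gi (-1) ?\<gamma> ?\<kappa> \<xi> = z powi ?\<gamma> * T_Gamma n v g z \<eta> \<xi>" .
  moreover have "\<xi> \<in> semi_infinite m" using \<xi> by (simp add: normal_ordered_def)
  then have "exp_H_minus n v g m z \<eta> \<xi> = z powi (energy m \<xi> - energy m \<eta>) * Gi (-1) ?\<gamma> ?\<kappa> \<xi>"
    unfolding exp_H_minus_def using half_vertex_Gi[of "-1" z \<xi> m \<eta>] z by simp
  moreover have "z powi (energy m \<xi> - energy m \<eta>) * z powi ?\<gamma> = 1"
    using z by (simp add: power_int_add[symmetric])
  ultimately show ?thesis by (simp add: mult.assoc[symmetric])
qed

end

theorem theorem1:
  fixes n :: nat and v z :: complex and g :: "int \<Rightarrow> complex" and m :: int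
    and \<xi> \<eta> :: wedge_seq
  assumes "n \<ge> 1"
    and "v \<noteq> 0"
    and "\<forall>r::nat. r > 0 \<longrightarrow> v ^ r \<noteq> 1"
    and "\<forall>a. g (a + int n) = g a"
    and "g 0 = - v"
    and "\<forall>a. \<not> int n dvd a \<longrightarrow> g a * g (- a) = v"
    and "z \<noteq> 0"
    and "\<xi> \<in> normal_ordered m"
    and "\<eta> \<in> normal_ordered m"
  shows "exp_H_plus n v g m z \<eta> \<xi> = T_Delta n v g z \<eta> \<xi> \<and>
         exp_H_minus n v g m z \<eta> \<xi> = T_Gamma n v g z \<eta> \<xi>"
proof -
  \<comment> \<open>The case r = 2 excludes v = -1, so that 1 and - v are distinct
    eigenvalues.\<close>
  have "v ^ 2 \<noteq> 1" using assms(3) by (metis zero_less_numeral)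
  then have "1 + v \<noteq> 0" by (metis add_eq_0_iff power2_minus one_power2)
  then interpret fock_params n v g
    using assms(1-6) by unfold_locales blast+
  show ?thesis
    using exp_H_plus_eq[OF assms(7-9)] exp_H_minus_eq[OF assms(7-9)] by simp
qed

end
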